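(* Let $\ell,n\ge 1$ be integers, let $Q_1,\dots,Q_\ell$ be independent $\mathrm{GOE}(n)$ random matrices, and let $\mathscr{S}_{\ell,n}\subset S^\ell$ be the associated random spherical spectrahedron, with relative volume $|\mathscr{S}_{\ell,n}|_{\mathrm{rel}}=|\mathscr{S}_{\ell,n}|/|S^\ell|$. Let $F_\ell$ be the cumulative distribution function of Student's t-distribution with $\ell$ degrees of freedom and let $\Phi$ be the cumulative distribution function of the standard normal distribution. Then: (1) $\displaystyle \mathbb{E}\,|\mathscr{S}_{\ell,n}|_{\mathrm{rel}}=\mathbb{E}_{Q\sim \mathrm{GOE}(n)}\, F_\ell\big(\tilde\lambda_{\min}(Q)\big)$. (2) $\displaystyle \mathbb{E}\,|\mathscr{S}_{\ell,n}|_{\mathrm{rel}}=\Phi(-1)+\mathcal{O}(\ell^{-1})+\mathcal{O}(n^{-2/3})$, where the implied constants in $\mathcal{O}(\ell^{-1})$ and $\mathcal{O}(n^{-2/3})$ are independent of $\ell$ and $n$.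
   Context: $\mathrm{Sym}(n,\mathbb{R})$ is the space of real symmetric $n\times n$ matrices, $\mathcal{P}_n\subset \mathrm{Sym}(n,\mathbb{R})$ is the cone of positive semidefinite matrices, and $\mathbf{1}$ is the identity matrix. $Q\sim\mathrm{GOE}(n)$ means that $Q\in\mathrm{Sym}(n,\mathbb{R})$ is a random matrix with density proportional to $\exp(-\|Q\|_F^2/2)$, where $\|Q\|_F^2=\mathrm{tr}(Q^2)$; that is, the entries $Q_{ij}$, $i\le j$, are independent centered Gaussians, with variance $1$ on the diagonal and variance $1/2$ off the diagonal. $S^\ell$ is the unit sphere in $\mathbb{R}^{\ell+1}$ and $|\cdot|$ denotes its standard $\ell$-dimensional volume. The random spherical spectrahedron is $$\mathscr{S}_{\ell,n}=\Big\{x=(x_0,\dots,x_\ell)\in S^\ell \;:\; x_0\mathbf{1}+\tfrac{1}{\sqrt{2n\ell}}(x_1Q_1+\cdots+x_\ell Q_\ell)\in\mathcal{P}_n\Big\}.$$ For $Q\in\mathrm{Sym}(n,\mathbb{R})$, $\lambda_{\min}(Q)$ is its smallest eigenvalue and $\tilde\lambda_{\min}(Q)=\lambda_{\min}(Q)/\sqrt{2n}$. Asymptotic notation: (2) means that there are constants $C>0$ and $m_0$ such that for all $\ell,n\ge m_0$ one has $\big|\mathbb{E}|\mathscr{S}_{\ell,n}|_{\mathrm{rel}}-\Phi(-1)\big|\le C(\ell^{-1}+n^{-2/3})$. *)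

theory Defs
  imports "HOL-Probability.Probability" "Jordan_Normal_Form.Spectral_Radius"
begin

(* HOL-Analysis and Jordan_Normal_Form both define vectors and matrices. Everything below
   uses the dimension-carrying ones of Jordan_Normal_Form, since the size n varies inside
   the asymptotic statement. *)
no_notation Inner_Product.real_inner_class.inner (infix "\<bullet>" 70)

definition sym_mats :: "nat \<Rightarrow> real Matrix.mat set" where
  "sym_mats n = {A \<in> carrier_mat n n. transpose_mat A = A}"

definition psd_cone :: "nat \<Rightarrow> real Matrix.mat set" where
  "psd_cone n = {A \<in> sym_mats n. \<forall>v \<in> carrier_vec n. 0 \<le> v \<bullet> (A *\<^sub>v v)}"

text \<open>The Borel sigma-algebra of \<open>Sym(n, \<real>)\<close>, generated by the matrix entries.\<close>

definition sym_borel :: "nat \<Rightarrow> real Matrix.mat measure" where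
  "sym_borel n = vimage_algebra (sym_mats n)
     (\<lambda>A. \<lambda>ij \<in> {..<n} \<times> {..<n}. A $$ ij)
     (\<Pi>\<^sub>M ij \<in> {..<n} \<times> {..<n}. (borel :: real measure))"

text \<open>The law \<open>GOE(n)\<close>: the entries on and above the diagonal are independent centered
  Gaussians. Note that \<open>normal_density\<close> is parametrised by the standard deviation: variance
  1 on the diagonal, 1/2 off the diagonal.\<close>

definition GOE :: "nat \<Rightarrow> real Matrix.mat measure" where
  "GOE n = distr
     (\<Pi>\<^sub>M (i, j) \<in> {(i, j). i \<le> j \<and> j < n}.
        density lborel (normal_density 0 (if i = j then 1 else sqrt (1 / 2))))
     (sym_borel n)
     (\<lambda>q. Matrix.mat n n (\<lambda>(i, j). q (min i j, max i j)))"

definition independent_GOE ::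
  "'a measure \<Rightarrow> nat \<Rightarrow> nat \<Rightarrow> (nat \<Rightarrow> 'a \<Rightarrow> real Matrix.mat) \<Rightarrow> bool" where
  "independent_GOE M l n Q \<longleftrightarrow>
     prob_space M \<and>
     prob_space.indep_vars M (\<lambda>_. sym_borel n) Q {1..l} \<and>
     (\<forall>k \<in> {1..l}. distr M (sym_borel n) (Q k) = GOE n)"

definition min_eigenvalue :: "real Matrix.mat \<Rightarrow> real" where
  "min_eigenvalue A = Min (spectrum A)"

definition scaled_min_eigenvalue :: "nat \<Rightarrow> real Matrix.mat \<Rightarrow> real" where
  "scaled_min_eigenvalue n A = min_eigenvalue A / sqrt (2 * real n)"

text \<open>Points of \<open>\<real>\<^bsup>l+1\<^esup>\<close> are the extensional functions on \<open>{..l}\<close>.\<close>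

definition unit_sphere :: "nat \<Rightarrow> (nat \<Rightarrow> real) set" where
  "unit_sphere l = {x \<in> {..l} \<rightarrow>\<^sub>E UNIV. (\<Sum>i\<le>l. (x i)\<^sup>2) = 1}"

text \<open>The standard \<open>l\<close>-dimensional volume of a Borel subset \<open>S\<close> of the unit sphere in
  \<open>\<real>\<^bsup>l+1\<^esup>\<close>, defined from Lebesgue measure by \<open>l + 1\<close> times the volume of the solid cone
  over \<open>S\<close> with apex at the origin.\<close>

definition sphere_volume :: "nat \<Rightarrow> (nat \<Rightarrow> real) set \<Rightarrow> real" where
  "sphere_volume l S = real (l + 1) *
     measure (\<Pi>\<^sub>M i \<in> {..l}. lborel) {(\<lambda>i \<in> {..l}. r * x i) | r x. 0 \<le> r \<and> r \<le> 1 \<and> x \<in> S}"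

definition relative_volume :: "nat \<Rightarrow> (nat \<Rightarrow> real) set \<Rightarrow> real" where
  "relative_volume l S = sphere_volume l S / sphere_volume l (unit_sphere l)"

definition spherical_spectrahedron ::
  "nat \<Rightarrow> nat \<Rightarrow> (nat \<Rightarrow> real Matrix.mat) \<Rightarrow> (nat \<Rightarrow> real) set" where
  "spherical_spectrahedron l n Q = {x \<in> unit_sphere l.
     x 0 \<cdot>\<^sub>m 1\<^sub>m n
       + (1 / sqrt (2 * real n * real l)) \<cdot>\<^sub>m Matrix.mat n n (\<lambda>(i, j). \<Sum>k = 1..l. x k * (Q k $$ (i, j)))
     \<in> psd_cone n}"

definition expected_relative_volume ::
  "'a measure \<Rightarrow> nat \<Rightarrow> nat \<Rightarrow> (nat \<Rightarrow> 'a \<Rightarrow> real Matrix.mat) \<Rightarrow> real" where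
  "expected_relative_volume M l n Q =
     (\<integral>\<omega>. relative_volume l (spherical_spectrahedron l n (\<lambda>k. Q k \<omega>)) \<partial>M)"

definition student_t_density :: "nat \<Rightarrow> real \<Rightarrow> real" where
  "student_t_density l t =
     Gamma ((real l + 1) / 2) / (sqrt (real l * pi) * Gamma (real l / 2))
       * (1 + t\<^sup>2 / real l) powr (- ((real l + 1) / 2))"

definition student_t_cdf :: "nat \<Rightarrow> real \<Rightarrow> real" where
  "student_t_cdf l = cdf (density lborel (student_t_density l))"

definition std_normal_cdf :: "real \<Rightarrow> real" where
  "std_normal_cdf = cdf std_normal_distribution"

end

theory Submission
  imports Defs "HOL-Analysis.Function_Metric"
begin

text \<open>The proof separates the geometry of the sphere from the spectrum of the matrices.

  A spherical spectrahedron is the intersection of the sphere with a convex cone, and the relative volume of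
  such a set is the standard Gaussian measure of the cone (\<open>relative_volume_cone\<close>). Hence the
  expected relative volume is the probability that \<open>x\<^sub>0 1 + (2 n l)\<^sup>-\<^sup>1\<^sup>/\<^sup>2 (x\<^sub>1 Q\<^sub>1 + \<dots> + x\<^sub>l Q\<^sub>l)\<close> is positive
  semidefinite, where \<open>x\<close> is a standard Gaussian vector independent of the matrices. Given \<open>x\<close>, the sum
  \<open>x\<^sub>1 Q\<^sub>1 + \<dots> + x\<^sub>l Q\<^sub>l\<close> has the law of \<open>\<bar>x'\<bar> Q\<close> with \<open>x' = (x\<^sub>1, \<dots>, x\<^sub>l)\<close> and \<open>Q\<close> from the GOE
  (\<open>goe_linear_combination\<close>). So the event is \<open>x\<^sub>0 + \<bar>x'\<bar> \<mu> / sqrt l \<ge> 0\<close>, where \<open>\<mu>\<close> is the scaled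
  smallest eigenvalue of \<open>Q\<close>, and \<open>sqrt l x\<^sub>0 / \<bar>x'\<bar>\<close> has Student's distribution. This is the first part.

  For the second part Student's distribution function is kept in the form
  \<open>F\<^sub>l(s) = E \<Phi>(s R)\<close> with \<open>R = \<bar>x'\<bar> / sqrt l\<close> (\<open>student_t_cdf_mixture\<close>). As \<open>R\<close> is close to 1 with an
  error \<open>O(1 / l)\<close> in mean and in mean square, \<open>E \<Phi>(- R) = \<Phi>(- 1) + O(1 / l)\<close>, and it remains to show
  \<open>E \<Phi>(R \<mu>) = \<Phi>(- R) + O((R + R\<^sup>2) n\<^sup>-\<^sup>2\<^sup>/\<^sup>3)\<close> for a fixed number \<open>R\<close>. The smallest eigenvalue itself
  fluctuates by at most \<open>O(1)\<close>, and since the second derivative of \<open>\<Phi>\<close> is bounded, such fluctuations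
  contribute \<open>O(R\<^sup>2 / n)\<close> only. Thus only the mean position of the edge of the spectrum matters, and this is accessible without
  the joint density of the eigenvalues.

  One side (\<open>neg_min_form_upper\<close>) follows from Slepian's inequality: the quadratic form \<open>- \<langle>v, Q v\<rangle>\<close> plus an
  independent normal variable is dominated by the linear form \<open>sqrt 2 \<langle>v, g\<rangle>\<close>, whose supremum over the sphere is
  \<open>sqrt 2 \<bar>g\<bar>\<close>, with mean at most \<open>sqrt (2 n)\<close>. The other side (\<open>neg_min_form_lower\<close>) needs one
  good test vector. Splitting off one row after the other brings the form, along a suitable orthonormal
  system of length \<open>m\<close>, into tridiagonal form, with off-diagonal entries \<open>1 / sqrt 2\<close> times the norms of
  Gaussian vectors in dimensions \<open>n - 1, n - 2, \<dots>\<close>. A discrete sine of length \<open>m\<close> as coordinate vector reaches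
  \<open>sqrt (2 n) (1 - O(m / n + 1 / m\<^sup>2))\<close>, and \<open>m\<close> of order \<open>n\<^sup>1\<^sup>/\<^sup>3\<close> gives the exponent \<open>2 / 3\<close>.

  Slepian's inequality is proved by Lindeberg's replacement method (\<open>gumbel_comparison\<close>), applied to the
  distribution function of a maximum blurred by Gumbel noise. Because the inequality concerns only covariances, its case of equal
  covariances shows that the supremum over a set of vectors has the same law after a reflection of that
  set; in the recursion this takes the place of the orthogonal invariance of the GOE.\<close>

section \<open>The standard Gaussian measure on a finite product\<close>

abbreviation normal_law :: "real measure" where "normal_law \<equiv> std_normal_distribution"

definition gauss :: "'i set \<Rightarrow> ('i \<Rightarrow> real) measure" where
  "gauss I = PiM I (\<lambda>_. std_normal_distribution)"

lemma sets_gauss [measurable_cong, simp]: "sets (gauss I) = sets (PiM I (\<lambda>_. borel :: real measure))"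
  unfolding gauss_def by (rule sets_PiM_cong) auto

lemma space_gauss [simp]: "space (gauss I) = (I \<rightarrow>\<^sub>E UNIV)"
  by (simp add: gauss_def space_PiM)

lemma prob_space_normal_law: "prob_space normal_law"
  by (rule prob_space_normal_density) simp

interpretation normal_law: prob_space normal_law by (rule prob_space_normal_law)

interpretation normal_laws: product_sigma_finite "\<lambda>_. normal_law"
  by unfold_locales

lemma prob_space_gauss: "prob_space (gauss I)"
  unfolding gauss_def by (rule prob_space_PiM) (rule prob_space_normal_law)

lemma sigma_finite_gauss: "sigma_finite_measure (gauss I)"
  using prob_space_gauss prob_space_imp_sigma_finite by blast

lemma pair_sigma_finite_gauss: "pair_sigma_finite (gauss I) (gauss J)"
  by (simp add: pair_sigma_finite_def sigma_finite_gauss)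

lemma char_normal_law_affine:
  "char (distr normal_law borel (\<lambda>x. a * x)) t = exp (- (a * t)\<^sup>2 / 2)"
proof -
  have "char (distr normal_law borel (\<lambda>x. a * x)) t = char normal_law (a * t)"
    by (simp add: char_def integral_distr mult.commute mult.left_commute)
  then show ?thesis by (simp add: char_std_normal_distribution)
qed

text \<open>Characteristic functions also cover the degenerate cases \<open>a = 0\<close> and \<open>b = 0\<close>, in which a
  density does not exist.\<close>

lemma normal_law_stable:
  "distr (normal_law \<Otimes>\<^sub>M normal_law) borel (\<lambda>(x, y). a * x + b * y)
     = distr normal_law borel (\<lambda>x. sqrt (a\<^sup>2 + b\<^sup>2) * x)" (is "?L = ?R")
proof (rule Levy_uniqueness)
  interpret P: pair_prob_space normal_law normal_law ..
  show "real_distribution ?L"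
    by (rule P.real_distribution_distr) simp
  show "real_distribution ?R"
    by (rule normal_law.real_distribution_distr) simp
  show "char ?L = char ?R"
  proof
    fix t
    have int: "integrable normal_law (\<lambda>x. iexp (c * x))" for c :: real
      by (rule normal_law.integrable_const_bound[of _ 1]) auto
    have int2: "integrable (normal_law \<Otimes>\<^sub>M normal_law) (\<lambda>(x, y). iexp ((t * a) * x) * iexp ((t * b) * y))"
      by (rule P.integrable_const_bound[of _ 1]) (auto simp: norm_mult)
    have "char ?L t = (CLINT z|normal_law \<Otimes>\<^sub>M normal_law. (case z of (x, y) \<Rightarrow> iexp ((t * a) * x) * iexp ((t * b) * y)))"
      unfolding char_def
      by (subst integral_distr) (auto intro!: Bochner_Integration.integral_cong simp: exp_add[symmetric] algebra_simps split: prod.split)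
    also have "\<dots> = (CLINT x|normal_law. CLINT y|normal_law. iexp ((t * a) * x) * iexp ((t * b) * y))"
      using P.integral_fst'[OF int2] by simp
    also have "\<dots> = (CLINT x|normal_law. iexp ((t * a) * x)) * (CLINT y|normal_law. iexp ((t * b) * y))"
      by simp
    also have "\<dots> = char normal_law (t * a) * char normal_law (t * b)"
      by (simp add: char_def mult.commute)
    also have "\<dots> = of_real (exp (- (t * a)\<^sup>2 / 2) * exp (- (t * b)\<^sup>2 / 2))"
      by (simp add: char_std_normal_distribution)
    also have "exp (- (t * a)\<^sup>2 / 2) * exp (- (t * b)\<^sup>2 / 2) = exp (- (sqrt (a\<^sup>2 + b\<^sup>2) * t)\<^sup>2 / 2)"
      by (simp add: exp_add[symmetric] power_mult_distrib algebra_simps add_divide_distrib)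
    finally show "char ?L t = char ?R t"
      by (simp add: char_normal_law_affine)
  qed
qed

text \<open>Both measures are determined by their values on boxes, and there the product structure
  reduces the claim to one coordinate. This is the semigroup property that drives the
  comparison argument below, and it also gives the law of \<open>\<Sum>k. x k * Q k\<close> for independent
  Gaussian \<open>Q k\<close>.\<close>

lemma gauss_stable:
  assumes "finite I"
  shows "distr (gauss I \<Otimes>\<^sub>M gauss I) (PiM I (\<lambda>_. borel)) (\<lambda>(x, y). \<lambda>i\<in>I. a * x i + b * y i)
     = distr (gauss I) (PiM I (\<lambda>_. borel)) (\<lambda>x. \<lambda>i\<in>I. sqrt (a\<^sup>2 + b\<^sup>2) * x i)" (is "?L = ?R")
proof (rule measure_eqI_PiM_finite[OF assms])
  interpret P: pair_sigma_finite "gauss I" "gauss I" by (rule pair_sigma_finite_gauss)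
  interpret G: prob_space "gauss I" by (rule prob_space_gauss)
  interpret PP: pair_prob_space "gauss I" "gauss I" ..
  interpret N2: pair_prob_space normal_law normal_law ..
  show "sets ?L = sets (PiM I (\<lambda>_. borel))" "sets ?R = sets (PiM I (\<lambda>_. borel))" by auto
  have mL: "(\<lambda>(x, y). \<lambda>i\<in>I. a * x i + b * y i) \<in> gauss I \<Otimes>\<^sub>M gauss I \<rightarrow>\<^sub>M PiM I (\<lambda>_. borel :: real measure)"
    by measurable
  have mR: "(\<lambda>x. \<lambda>i\<in>I. sqrt (a\<^sup>2 + b\<^sup>2) * x i) \<in> gauss I \<rightarrow>\<^sub>M PiM I (\<lambda>_. borel :: real measure)"
    by measurable
  show "range (\<lambda>_::nat. I \<rightarrow>\<^sub>E (UNIV :: real set)) \<subseteq> prod_algebra I (\<lambda>_. borel)"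
    using assms by (auto simp: prod_algebra_eq_finite)
  show "(\<Union>i::nat. I \<rightarrow>\<^sub>E (UNIV::real set)) = space (PiM I (\<lambda>_. borel))"
    by (auto simp: space_PiM)
  have "prob_space ?L" by (rule PP.prob_space_distr[OF mL])
  then show "emeasure ?L (I \<rightarrow>\<^sub>E (UNIV :: real set)) \<noteq> \<infinity>" for i :: nat
    by (simp add: finite_measure.emeasure_finite prob_space_def)
  fix A assume A: "\<And>i. i \<in> I \<Longrightarrow> A i \<in> sets (borel :: real measure)"
  let ?f = "\<lambda>(x, y). a * x + b * y :: real"
  have "emeasure ?L (Pi\<^sub>E I A) = (\<integral>\<^sup>+z. indicator (Pi\<^sub>E I A) (case z of (x, y) \<Rightarrow> \<lambda>i\<in>I. a * x i + b * y i) \<partial>(gauss I \<Otimes>\<^sub>M gauss I))"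
    using A assms mL by (subst nn_integral_indicator[symmetric], simp, subst nn_integral_distr) (auto)
  also have "\<dots> = (\<integral>\<^sup>+y. \<integral>\<^sup>+x. indicator (Pi\<^sub>E I A) (\<lambda>i\<in>I. a * x i + b * y i) \<partial>gauss I \<partial>gauss I)"
    using A assms mL by (subst P.nn_integral_snd[symmetric]) auto
  also have "\<dots> = (\<integral>\<^sup>+y. \<integral>\<^sup>+x. (\<Prod>i\<in>I. indicator (A i) (a * x i + b * y i)) \<partial>gauss I \<partial>gauss I)"
    by (intro nn_integral_cong) (use assms in \<open>auto simp: indicator_def PiE_iff\<close>)
  also have "\<dots> = (\<integral>\<^sup>+y. (\<Prod>i\<in>I. \<integral>\<^sup>+x. indicator (A i) (a * x + b * y i) \<partial>normal_law) \<partial>gauss I)"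
    unfolding gauss_def using A assms
    by (intro nn_integral_cong normal_laws.product_nn_integral_prod) auto
  also have "\<dots> = (\<Prod>i\<in>I. \<integral>\<^sup>+y. \<integral>\<^sup>+x. indicator (A i) (a * x + b * y) \<partial>normal_law \<partial>normal_law)"
    unfolding gauss_def using A assms
    by (intro normal_laws.product_nn_integral_prod) auto
  also have "\<dots> = (\<Prod>i\<in>I. \<integral>\<^sup>+x. indicator (A i) (sqrt (a\<^sup>2 + b\<^sup>2) * x) \<partial>normal_law)"
  proof (rule prod.cong[OF refl])
    fix i assume i: "i \<in> I"
    have "(\<integral>\<^sup>+y. \<integral>\<^sup>+x. indicator (A i) (a * x + b * y) \<partial>normal_law \<partial>normal_law)
       = (\<integral>\<^sup>+z. indicator (A i) (?f z) \<partial>(normal_law \<Otimes>\<^sub>M normal_law))"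
      using A[OF i] by (subst N2.nn_integral_snd[symmetric]) auto
    also have "\<dots> = (\<integral>\<^sup>+z. indicator (A i) z \<partial>distr (normal_law \<Otimes>\<^sub>M normal_law) borel ?f)"
      using A[OF i] by (subst nn_integral_distr) auto
    also have "\<dots> = (\<integral>\<^sup>+x. indicator (A i) (sqrt (a\<^sup>2 + b\<^sup>2) * x) \<partial>normal_law)"
      unfolding normal_law_stable using A[OF i] by (subst nn_integral_distr) auto
    finally show "(\<integral>\<^sup>+y. \<integral>\<^sup>+x. indicator (A i) (a * x + b * y) \<partial>normal_law \<partial>normal_law)
       = (\<integral>\<^sup>+x. indicator (A i) (sqrt (a\<^sup>2 + b\<^sup>2) * x) \<partial>normal_law)" .
  qed
  also have "\<dots> = (\<integral>\<^sup>+x. (\<Prod>i\<in>I. indicator (A i) (sqrt (a\<^sup>2 + b\<^sup>2) * x i)) \<partial>gauss I)"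
    unfolding gauss_def using A assms
    by (intro normal_laws.product_nn_integral_prod[symmetric]) auto
  also have "\<dots> = (\<integral>\<^sup>+x. indicator (Pi\<^sub>E I A) (\<lambda>i\<in>I. sqrt (a\<^sup>2 + b\<^sup>2) * x i) \<partial>gauss I)"
    by (intro nn_integral_cong) (use assms in \<open>auto simp: indicator_def PiE_iff\<close>)
  also have "\<dots> = emeasure ?R (Pi\<^sub>E I A)"
    using A assms mR by (subst nn_integral_indicator[symmetric], simp, subst nn_integral_distr) (auto)
  finally show "emeasure ?L (Pi\<^sub>E I A) = emeasure ?R (Pi\<^sub>E I A)" .
qed

lemma gauss_prod:
  assumes "finite I" "\<And>i. i \<in> I \<Longrightarrow> integrable normal_law (f i)"
  shows "integrable (gauss I) (\<lambda>x. \<Prod>i\<in>I. f i (x i) :: real)"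
    and "(\<integral>x. (\<Prod>i\<in>I. f i (x i)) \<partial>gauss I) = (\<Prod>i\<in>I. integral\<^sup>L normal_law (f i))"
  unfolding gauss_def
  using normal_laws.product_integrable_prod[of I f] normal_laws.product_integral_prod[of I f] assms by auto

lemma normal_law_moments:
  "integrable normal_law (\<lambda>x. x ^ k)"
  "(\<integral>x. x \<partial>normal_law) = 0" "(\<integral>x. x\<^sup>2 \<partial>normal_law) = 1" "(\<integral>x. x^4 \<partial>normal_law) = 3"
  using integrable_std_normal_distribution_moment integral_std_normal_distribution_moment_odd[of 1]
    std_normal_distribution_even_moments(1)[of 1] std_normal_distribution_even_moments(1)[of 2]
  by (simp_all add: fact_numeral)

text \<open>The function \<open>x i ^ p * x j ^ q\<close> is a product of functions of single coordinates, whether or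
  not \<open>i\<close> and \<open>j\<close> coincide, and such products are integrated factor by factor.\<close>

lemma gauss_mixed_moment:
  assumes "finite I" "i \<in> I" "j \<in> I"
  shows "integrable (gauss I) (\<lambda>x. x i ^ p * x j ^ q)"
    and "(\<integral>x. x i ^ p * x j ^ q \<partial>gauss I) =
      (if i = j then \<integral>x. x ^ (p + q) \<partial>normal_law else (\<integral>x. x ^ p \<partial>normal_law) * (\<integral>x. x ^ q \<partial>normal_law))"
proof -
  define f :: "'a \<Rightarrow> real \<Rightarrow> real" where "f = (\<lambda>k x. (if k = i then x ^ p else 1) * (if k = j then x ^ q else 1))"
  have eq: "(\<Prod>k\<in>I. f k (x k)) = x i ^ p * x j ^ q" for x :: "'a \<Rightarrow> real"
    unfolding f_def prod.distrib using assms by (simp add: prod.delta)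
  have int: "integrable normal_law (f k)" for k
    unfolding f_def using normal_law_moments(1) by (cases "k = i"; cases "k = j") (auto simp: power_add[symmetric])
  show "integrable (gauss I) (\<lambda>x. x i ^ p * x j ^ q)"
    using gauss_prod(1)[OF assms(1), of f] int by (simp add: eq)
  have "(\<integral>x. x i ^ p * x j ^ q \<partial>gauss I) = (\<Prod>k\<in>I. integral\<^sup>L normal_law (f k))"
    using gauss_prod(2)[OF assms(1), of f] int by (simp add: eq)
  also have "\<dots> = (\<Prod>k\<in>I. (if k = i then integral\<^sup>L normal_law (f i) else 1) * (if k = j \<and> j \<noteq> i then integral\<^sup>L normal_law (f j) else 1))"
    by (rule prod.cong) (auto simp: f_def normal_law.prob_space[simplified])
  also have "\<dots> = integral\<^sup>L normal_law (f i) * (if j \<noteq> i then integral\<^sup>L normal_law (f j) else 1)"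
    unfolding prod.distrib using assms by (cases "i = j") (simp_all add: prod.delta)
  finally show "(\<integral>x. x i ^ p * x j ^ q \<partial>gauss I) =
      (if i = j then \<integral>x. x ^ (p + q) \<partial>normal_law else (\<integral>x. x ^ p \<partial>normal_law) * (\<integral>x. x ^ q \<partial>normal_law))"
    by (auto simp: f_def power_add)
qed

lemma gauss_coordinate:
  assumes "finite I" "i \<in> I"
  shows "integrable (gauss I) (\<lambda>x. x i ^ p)" "integrable (gauss I) (\<lambda>x. x i)" "(\<integral>x. x i \<partial>gauss I) = 0"
proof -
  show 1: "integrable (gauss I) (\<lambda>x. x i ^ p)" for p
    using gauss_mixed_moment(1)[OF assms(1) assms(2) assms(2), of p 0] by simp
  show "integrable (gauss I) (\<lambda>x. x i)" using 1[of 1] by simp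
  show "(\<integral>x. x i \<partial>gauss I) = 0"
    using gauss_mixed_moment(2)[OF assms(1) assms(2) assms(2), of 1 0] normal_law_moments by simp
qed

lemma gauss_covariance:
  assumes "finite I" "i \<in> I" "j \<in> I"
  shows "integrable (gauss I) (\<lambda>x. x i * x j)" "(\<integral>x. x i * x j \<partial>gauss I) = (if i = j then 1 else 0)"
  using gauss_mixed_moment[OF assms, of 1 1] normal_law_moments by (simp_all add: numeral_2_eq_2)

lemma gauss_fourth:
  assumes "finite I" "i \<in> I" "j \<in> I"
  shows "integrable (gauss I) (\<lambda>x. (x i)\<^sup>2 * (x j)\<^sup>2)"
    "(\<integral>x. (x i)\<^sup>2 * (x j)\<^sup>2 \<partial>gauss I) = 1 + (if i = j then 2 else 0)"
  using gauss_mixed_moment[OF assms, of 2 2] normal_law_moments by simp_all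

definition lin_form :: "'i set \<Rightarrow> ('i \<Rightarrow> real) \<Rightarrow> ('i \<Rightarrow> real) \<Rightarrow> real" where
  "lin_form I a x = (\<Sum>i\<in>I. a i * x i)"

lemma lin_form_measurable [measurable]: "lin_form I a \<in> borel_measurable (PiM I (\<lambda>_. borel))"
  unfolding lin_form_def by measurable

lemma lin_form_gauss:
  assumes I: "finite I"
  shows "integrable (gauss I) (lin_form I a)" "(\<integral>x. lin_form I a x \<partial>gauss I) = 0"
    "integrable (gauss I) (\<lambda>x. lin_form I a x * lin_form I b x)"
    "(\<integral>x. lin_form I a x * lin_form I b x \<partial>gauss I) = (\<Sum>i\<in>I. a i * b i)"
proof -
  note c = gauss_coordinate(2,3)[OF I] and cc = gauss_covariance[OF I]
  show "integrable (gauss I) (lin_form I a)"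
    unfolding lin_form_def[abs_def] using c by auto
  show "(\<integral>x. lin_form I a x \<partial>gauss I) = 0"
    unfolding lin_form_def using c by (subst Bochner_Integration.integral_sum) auto
  have eq: "lin_form I a x * lin_form I b x = (\<Sum>i\<in>I. \<Sum>j\<in>I. (a i * b j) * (x i * x j))" for x
    unfolding lin_form_def sum_product by (intro sum.cong refl) simp
  have int: "integrable (gauss I) (\<lambda>x. (a i * b j) * (x i * x j))" if "i \<in> I" "j \<in> I" for i j
    using cc(1)[OF that] by (rule integrable_mult_right)
  show "integrable (gauss I) (\<lambda>x. lin_form I a x * lin_form I b x)"
    unfolding eq using int by (intro Bochner_Integration.integrable_sum)
  have "(\<integral>x. lin_form I a x * lin_form I b x \<partial>gauss I) = (\<Sum>i\<in>I. \<Sum>j\<in>I. (a i * b j) * (if i = j then 1 else 0))"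
    unfolding eq using int cc by simp
  then show "(\<integral>x. lin_form I a x * lin_form I b x \<partial>gauss I) = (\<Sum>i\<in>I. a i * b i)"
    using I by (simp add: sum.delta if_distrib cong: if_cong)
qed

definition sqnorm :: "'i set \<Rightarrow> ('i \<Rightarrow> real) \<Rightarrow> real" where
  "sqnorm J x = (\<Sum>i\<in>J. (x i)\<^sup>2)"

lemma sqnorm_nonneg [simp]: "0 \<le> sqnorm J x" unfolding sqnorm_def by (simp add: sum_nonneg)

lemma sqnorm_measurable [measurable]:
  assumes "J \<subseteq> I" shows "sqnorm J \<in> borel_measurable (PiM I (\<lambda>_. borel))"
  unfolding sqnorm_def[abs_def] using assms
  by (intro borel_measurable_sum borel_measurable_power measurable_component_singleton) auto

lemma sqnorm_gauss:
  assumes I: "finite I" and J: "J \<subseteq> I"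
  shows "integrable (gauss I) (sqnorm J)" "(\<integral>x. sqnorm J x \<partial>gauss I) = card J"
    "integrable (gauss I) (\<lambda>x. (sqnorm J x)\<^sup>2)" "(\<integral>x. (sqnorm J x)\<^sup>2 \<partial>gauss I) = (card J)\<^sup>2 + 2 * card J"
proof -
  have fJ: "finite J" using assms finite_subset by blast
  have c: "integrable (gauss I) (\<lambda>x. (x i)\<^sup>2)" "(\<integral>x. (x i)\<^sup>2 \<partial>gauss I) = 1" if "i \<in> J" for i
    using gauss_covariance[OF I, of i i] that J by (auto simp: power2_eq_square)
  note cc = gauss_fourth[OF I]
  show "integrable (gauss I) (sqnorm J)"
    unfolding sqnorm_def[abs_def] using c by auto
  show "(\<integral>x. sqnorm J x \<partial>gauss I) = card J"
    unfolding sqnorm_def using c by (subst Bochner_Integration.integral_sum) auto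
  have eq: "(sqnorm J x)\<^sup>2 = (\<Sum>i\<in>J. \<Sum>j\<in>J. (x i)\<^sup>2 * (x j)\<^sup>2)" for x
    unfolding sqnorm_def power2_eq_square[of "sum _ _"] sum_product ..
  have int: "integrable (gauss I) (\<lambda>x. (x i)\<^sup>2 * (x j)\<^sup>2)" if "i \<in> J" "j \<in> J" for i j
    using cc(1) that J by auto
  show "integrable (gauss I) (\<lambda>x. (sqnorm J x)\<^sup>2)"
    unfolding eq using int by (intro Bochner_Integration.integrable_sum)
  have "(\<integral>x. (sqnorm J x)\<^sup>2 \<partial>gauss I) = (\<Sum>i\<in>J. \<Sum>j\<in>J. 1 + (if i = j then 2 else 0))"
    unfolding eq using int cc(2) subsetD[OF J] by simp
  also have "\<dots> = (card J)\<^sup>2 + 2 * card J"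
    using fJ by (simp add: sum.distrib power2_eq_square algebra_simps)
  finally show "(\<integral>x. (sqnorm J x)\<^sup>2 \<partial>gauss I) = (card J)\<^sup>2 + 2 * card J" .
qed

text \<open>With \<open>s = sqrt y\<close> the difference of the two sides is a nonnegative multiple of
  \<open>s * (s - 1)\<^sup>2 * (s + 2)\<close>. The parabola touches the square root at \<open>y = 1\<close>, so it turns the first two
  moments of \<open>y = sqnorm J x / card J\<close>, which is concentrated at 1, into a sharp lower bound for
  the mean of the norm.\<close>

lemma sqrt_ge_quadratic: "0 \<le> y \<Longrightarrow> y * (3 - y) / 2 \<le> sqrt (y::real)"
proof -
  assume y: "0 \<le> y"
  define s where "s = sqrt y"
  have s: "0 \<le> s" "y = s\<^sup>2" using y by (auto simp: s_def)
  have "0 \<le> s * ((s - 1)\<^sup>2 * (s + 2))" using s by auto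
  also have "\<dots> = 2 * s - s\<^sup>2 * (3 - s\<^sup>2)" by (simp add: power2_eq_square algebra_simps)
  finally have "y * (3 - y) / 2 \<le> s" unfolding s(2) by simp
  then show ?thesis unfolding s_def .
qed

text \<open>The norm of a standard Gaussian vector in dimension \<open>k\<close> has mean \<open>sqrt k\<close> up to a relative
  error \<open>1 / k\<close>. This precision is needed twice: for the error \<open>1 / l\<close> of the Student
  distribution, and for the off-diagonal entries of the tridiagonal form, where a relative error
  of order \<open>n powr (- 2 / 3)\<close> is the most that is tolerable.\<close>

lemma gauss_norm_mean:
  assumes I: "finite I" and J: "J \<subseteq> I" "J \<noteq> {}"
  defines "k \<equiv> real (card J)"
  shows "integrable (gauss I) (\<lambda>x. sqrt (sqnorm J x))"
    and "sqrt k * (1 - 1 / k) \<le> (\<integral>x. sqrt (sqnorm J x) \<partial>gauss I)"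
    and "(\<integral>x. sqrt (sqnorm J x) \<partial>gauss I) \<le> sqrt k"
proof -
  interpret prob_space "gauss I" by (rule prob_space_gauss)
  note s = sqnorm_gauss[OF I J(1)]
  have m: "sqnorm J \<in> borel_measurable (gauss I)" using J by simp
  have fJ: "finite J" using I J finite_subset by blast
  then have k: "k > 0" using J by (auto simp: k_def card_gt_0_iff)
  show int: "integrable (gauss I) (\<lambda>x. sqrt (sqnorm J x))"
  proof (rule Bochner_Integration.integrable_bound)
    show "integrable (gauss I) (\<lambda>x. 1 + sqnorm J x)" using s(1) by auto
    show "AE x in gauss I. norm (sqrt (sqnorm J x)) \<le> norm (1 + sqnorm J x)"
    proof (rule AE_I2)
      fix x
      have "sqrt (sqnorm J x) \<le> sqrt ((1 + sqnorm J x)\<^sup>2)"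
        by (rule real_sqrt_le_mono) (simp add: power2_eq_square algebra_simps)
      then show "norm (sqrt (sqnorm J x)) \<le> norm (1 + sqnorm J x)" by simp
    qed
  qed (use m in measurable)
  let ?E = "\<integral>x. sqrt (sqnorm J x) \<partial>gauss I"
  have "(\<integral>x. sqrt k * ((sqnorm J x / k) * (3 - sqnorm J x / k) / 2) \<partial>gauss I) \<le> ?E"
  proof (rule integral_mono[OF _ int])
    show "integrable (gauss I) (\<lambda>x. sqrt k * ((sqnorm J x / k) * (3 - sqnorm J x / k) / 2))"
      using s(1,3) by (simp add: algebra_simps power2_eq_square)
    fix x
    have "(sqnorm J x / k) * (3 - sqnorm J x / k) / 2 \<le> sqrt (sqnorm J x / k)"
      by (rule sqrt_ge_quadratic) (use k in auto)
    then show "sqrt k * ((sqnorm J x / k) * (3 - sqnorm J x / k) / 2) \<le> sqrt (sqnorm J x)"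
      using k by (simp add: real_sqrt_divide field_simps)
  qed
  also have "(\<integral>x. sqrt k * ((sqnorm J x / k) * (3 - sqnorm J x / k) / 2) \<partial>gauss I)
     = (\<integral>x. sqrt k * (3 / (2 * k) * sqnorm J x - 1 / (2 * k\<^sup>2) * (sqnorm J x)\<^sup>2) \<partial>gauss I)"
    using k by (intro Bochner_Integration.integral_cong) (auto simp: field_simps power2_eq_square)
  also have "\<dots> = sqrt k * (3 / (2 * k) * k - 1 / (2 * k\<^sup>2) * (k\<^sup>2 + 2 * k))"
    using s by (simp add: k_def)
  also have "\<dots> = sqrt k * (1 - 1 / k)"
    using k by (simp add: field_simps power2_eq_square)
  finally show "sqrt k * (1 - 1 / k) \<le> ?E" .
  have "?E \<le> (\<integral>x. (sqrt k + sqnorm J x / sqrt k) / 2 \<partial>gauss I)"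
  proof (rule integral_mono[OF int])
    show "integrable (gauss I) (\<lambda>x. (sqrt k + sqnorm J x / sqrt k) / 2)" using s(1) by auto
    fix x
    have "0 \<le> (sqrt k - sqrt (sqnorm J x))\<^sup>2" by simp
    also have "\<dots> = k + sqnorm J x - 2 * sqrt k * sqrt (sqnorm J x)"
      using k by (simp add: power2_diff)
    finally show "sqrt (sqnorm J x) \<le> (sqrt k + sqnorm J x / sqrt k) / 2"
      using k by (simp add: field_simps)
  qed
  also have "\<dots> = (sqrt k + k / sqrt k) / 2" using s prob_space by (simp add: k_def)
  also have "\<dots> = sqrt k" using k by (simp add: real_div_sqrt)
  finally show "?E \<le> sqrt k" .
qed

text \<open>The norm fluctuates by \<open>O(1)\<close> in every dimension, because its mean square is \<open>k\<close> and its mean is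
  at least \<open>sqrt k * (1 - 1 / k)\<close>.\<close>

lemma gauss_norm_variance:
  assumes I: "finite I" and J: "J \<subseteq> I" "J \<noteq> {}"
  defines "k \<equiv> real (card J)"
  shows "integrable (gauss I) (\<lambda>x. (sqrt (sqnorm J x) - c)\<^sup>2)"
    and "(\<integral>x. (sqrt (sqnorm J x) - sqrt k)\<^sup>2 \<partial>gauss I) \<le> 2"
    and "(\<integral>x. (sqrt (sqnorm J x) - (\<integral>x. sqrt (sqnorm J x) \<partial>gauss I))\<^sup>2 \<partial>gauss I) \<le> 2"
proof -
  interpret prob_space "gauss I" by (rule prob_space_gauss)
  let ?E = "\<integral>x. sqrt (sqnorm J x) \<partial>gauss I"
  note s = sqnorm_gauss(1,2)[OF I J(1)] and e = gauss_norm_mean[OF I J, folded k_def]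
  have "finite J" using I J finite_subset by blast
  then have k: "k \<ge> 1" using J by (auto simp: k_def Suc_le_eq card_gt_0_iff)
  have eq: "(sqrt (sqnorm J x) - c)\<^sup>2 = sqnorm J x - 2 * c * sqrt (sqnorm J x) + c\<^sup>2" for c x
    by (simp add: power2_diff)
  show "integrable (gauss I) (\<lambda>x. (sqrt (sqnorm J x) - c)\<^sup>2)"
    unfolding eq using s e by auto
  have E: "(\<integral>x. (sqrt (sqnorm J x) - c)\<^sup>2 \<partial>gauss I) = k - 2 * c * ?E + c\<^sup>2" for c
    unfolding eq using s e prob_space by (simp add: k_def)
  have kk: "sqrt k * (sqrt k * (1 - 1 / k)) = k - 1"
    using k by (simp add: mult.assoc[symmetric]) (simp add: field_simps)
  have "sqrt k * (sqrt k * (1 - 1 / k)) \<le> sqrt k * ?E"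
    using e(2) k by (intro mult_left_mono) auto
  then have ke: "k - 1 \<le> sqrt k * ?E" unfolding kk .
  then show 1: "(\<integral>x. (sqrt (sqnorm J x) - sqrt k)\<^sup>2 \<partial>gauss I) \<le> 2"
    unfolding E using k by simp
  have "0 \<le> (sqrt k - ?E)\<^sup>2" by simp
  also have "\<dots> = k - 2 * sqrt k * ?E + ?E\<^sup>2" using k by (simp add: power2_diff)
  finally have "k - 2 * ?E * ?E + ?E\<^sup>2 \<le> k - 2 * sqrt k * ?E + (sqrt k)\<^sup>2"
    using k by (simp add: power2_eq_square)
  then show "(\<integral>x. (sqrt (sqnorm J x) - ?E)\<^sup>2 \<partial>gauss I) \<le> 2"
    using 1 unfolding E by linarith
qed

section \<open>Slepian's inequality\<close>

text \<open>The distribution function of the maximum of the \<open>x s\<close>, blurred by independent Gumbel noise: if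
  the \<open>G s\<close> are independent with the distribution function \<open>\<lambda>t. exp (- exp (- t))\<close>, then \<open>gumbel S \<beta> c x\<close>
  is the probability that \<open>\<beta> * x s + G s \<le> c\<close> for all \<open>s \<in> S\<close>. Its mixed second derivatives
  are positive, which is what Slepian's inequality rests on, and its third derivatives are
  bounded, since they are polynomials in \<open>Z = (\<Sum>s\<in>S. exp (\<beta> * x s - c))\<close> multiplied by
  \<open>exp (- Z)\<close>.\<close>

definition gumbel :: "'s set \<Rightarrow> real \<Rightarrow> real \<Rightarrow> ('s \<Rightarrow> real) \<Rightarrow> real" where
  "gumbel S \<beta> c x = exp (- (\<Sum>s\<in>S. exp (\<beta> * x s - c)))"

lemma gumbel_bounds: "0 \<le> gumbel S \<beta> c x" "gumbel S \<beta> c x \<le> 1"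
  unfolding gumbel_def by (auto intro: sum_nonneg)

lemma gumbel_abs_le_1 [simp]: "\<bar>gumbel S \<beta> c x\<bar> \<le> 1"
  using gumbel_bounds[of S \<beta> c x] by simp

lemma gumbel_measurable [measurable (raw)]:
  assumes "\<And>s. s \<in> S \<Longrightarrow> f s \<in> borel_measurable M"
  shows "(\<lambda>x. gumbel S \<beta> c (\<lambda>s. f s x)) \<in> borel_measurable M"
  unfolding gumbel_def using assms
  by (intro measurable_compose[OF _ borel_measurable_exp] borel_measurable_uminus borel_measurable_sum
      borel_measurable_diff borel_measurable_times borel_measurable_const)

lemma power_le_fact_mult_exp: "0 \<le> x \<Longrightarrow> x ^ k * exp (- x) \<le> fact k" for x :: real
proof -
  assume x: "0 \<le> x"
  have "x ^ k /\<^sub>R fact k \<le> (\<Sum>n. x ^ n /\<^sub>R fact n)"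
    using sum_le_suminf[OF summable_exp_generic[of x], of "{k}"] x by simp
  then have "x ^ k \<le> fact k * exp x" by (simp add: exp_def field_simps)
  then show ?thesis by (simp add: exp_minus field_simps)
qed

text \<open>The bound on the remainder does not depend on the base point \<open>w\<close>, so that the estimate may be
  integrated over arbitrary base points.\<close>

lemma gumbel_taylor:
  fixes w x :: "'s \<Rightarrow> real" and c :: real
  assumes S: "finite S" and \<beta>: "0 \<le> \<beta>" and h: "0 < h" and M: "\<And>s. s \<in> S \<Longrightarrow> \<bar>x s\<bar> \<le> M" "0 \<le> M"
  defines "z \<equiv> \<lambda>s. exp (\<beta> * w s - c)"
  shows "\<bar>gumbel S \<beta> c (\<lambda>s. w s + h * x s) - gumbel S \<beta> c w *
     (1 - h * (\<Sum>s\<in>S. \<beta> * x s * z s) + h\<^sup>2 / 2 * ((\<Sum>s\<in>S. \<beta> * x s * z s)\<^sup>2 - (\<Sum>s\<in>S. (\<beta> * x s)\<^sup>2 * z s)))\<bar>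
     \<le> 13 / 6 * (\<beta> * M) ^ 3 * h ^ 3"
proof -
  define Z where "Z = (\<lambda>k t. \<Sum>s\<in>S. (\<beta> * x s) ^ k * exp (\<beta> * (w s + t * x s) - c))"
  have dZ: "(Z k has_real_derivative Z (Suc k) t) (at t)" for k t
    unfolding Z_def by (auto intro!: derivative_eq_intros sum.cong simp: algebra_simps)
  define F where "F = (\<lambda>t. exp (- Z 0 t))"
  have dF: "(F has_real_derivative - Z 1 t * F t) (at t)" for t
    unfolding F_def by (auto intro!: derivative_eq_intros dZ)
  define D where "D = (\<lambda>m::nat. if m = 0 then F else if m = 1 then (\<lambda>t. - Z 1 t * F t)
      else if m = 2 then (\<lambda>t. ((Z 1 t)\<^sup>2 - Z 2 t) * F t)
      else (\<lambda>t. (3 * (Z 1 t * Z 2 t) - Z 1 t ^ 3 - Z 3 t) * F t))"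
  have dD: "(D m has_real_derivative D (Suc m) t) (at t)" if "m < 3" for m t
  proof -
    consider "m = 0" | "m = 1" | "m = 2" using \<open>m < 3\<close> by linarith
    then show ?thesis
    proof cases
      case 1 then show ?thesis using dF by (simp add: D_def)
    next
      case 2 then show ?thesis
        by (auto simp: D_def numeral_2_eq_2 power2_eq_square algebra_simps intro!: derivative_eq_intros dF dZ)
    next
      case 3
      have "((\<lambda>t. ((Z 1 t)\<^sup>2 - Z 2 t) * F t) has_real_derivative
         (2 * Z 1 t * Z (Suc 1) t - Z (Suc 2) t) * F t + ((Z 1 t)\<^sup>2 - Z 2 t) * (- Z 1 t * F t)) (at t)"
        by (auto intro!: derivative_eq_intros dF dZ)
      moreover have "(2 * Z 1 t * Z (Suc 1) t - Z (Suc 2) t) * F t + ((Z 1 t)\<^sup>2 - Z 2 t) * (- Z 1 t * F t)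
        = (3 * (Z 1 t * Z 2 t) - Z 1 t ^ 3 - Z 3 t) * F t"
        by (simp add: power2_eq_square power3_eq_cube algebra_simps eval_nat_numeral)
      ultimately show ?thesis using 3 by (simp add: D_def)
    qed
  qed
  obtain t where t: "0 < t" "t < h" and T: "F h = (\<Sum>m<3. D m 0 / fact m * h ^ m) + D 3 t / fact 3 * h ^ 3"
    using Maclaurin[of h 3 D F] h dD by (auto simp: D_def)
  have Fh: "F h = gumbel S \<beta> c (\<lambda>s. w s + h * x s)"
    and F0: "F 0 = gumbel S \<beta> c w"
    by (simp_all add: F_def Z_def gumbel_def)
  have sum: "(\<Sum>m<3. D m 0 / fact m * h ^ m) = F 0 * (1 - h * Z 1 0 + h\<^sup>2 / 2 * ((Z 1 0)\<^sup>2 - Z 2 0))"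
    by (simp add: D_def numeral_3_eq_3 eval_nat_numeral fact_numeral field_simps)
  have Z10: "Z 1 0 = (\<Sum>s\<in>S. \<beta> * x s * z s)" "Z 2 0 = (\<Sum>s\<in>S. (\<beta> * x s)\<^sup>2 * z s)"
    by (simp_all add: Z_def z_def)
  have Zb: "\<bar>Z k t\<bar> \<le> (\<beta> * M) ^ k * Z 0 t" for k
  proof -
    have "\<bar>Z k t\<bar> \<le> (\<Sum>s\<in>S. \<bar>(\<beta> * x s) ^ k * exp (\<beta> * (w s + t * x s) - c)\<bar>)"
      unfolding Z_def by (rule sum_abs)
    also have "\<dots> \<le> (\<Sum>s\<in>S. (\<beta> * M) ^ k * exp (\<beta> * (w s + t * x s) - c))"
      using M \<beta> by (intro sum_mono) (auto simp: abs_mult power_abs power_mult_distrib intro!: mult_mono power_mono)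
    finally show ?thesis by (simp add: Z_def sum_distrib_left)
  qed
  let ?Z = "Z 0 t" and ?B = "\<beta> * M"
  have Z0: "0 \<le> ?Z" unfolding Z_def by (auto intro: sum_nonneg)
  have B0: "0 \<le> ?B" using \<beta> M by simp
  have "\<bar>3 * (Z 1 t * Z 2 t) - Z 1 t ^ 3 - Z 3 t\<bar> \<le> \<bar>Z 1 t\<bar> ^ 3 + 3 * (\<bar>Z 1 t\<bar> * \<bar>Z 2 t\<bar>) + \<bar>Z 3 t\<bar>"
  proof -
    have "\<bar>3 * (Z 1 t * Z 2 t) - Z 1 t ^ 3 - Z 3 t\<bar> \<le> \<bar>Z 1 t ^ 3\<bar> + \<bar>3 * (Z 1 t * Z 2 t)\<bar> + \<bar>Z 3 t\<bar>" by linarith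
    then show ?thesis by (simp add: abs_mult power_abs mult.assoc)
  qed
  also have "\<dots> \<le> (?B ^ 1 * ?Z) ^ 3 + 3 * ((?B ^ 1 * ?Z) * (?B ^ 2 * ?Z)) + ?B ^ 3 * ?Z"
    using Zb Z0 B0 by (intro add_mono power_mono mult_mono Zb order_refl) auto
  also have "\<dots> = ?B ^ 3 * (?Z ^ 3 + 3 * ?Z ^ 2 + ?Z ^ 1)"
    by (simp add: power2_eq_square power3_eq_cube algebra_simps)
  finally have "\<bar>D 3 t\<bar> \<le> ?B ^ 3 * (?Z ^ 3 + 3 * ?Z ^ 2 + ?Z ^ 1) * exp (- ?Z)"
    by (simp add: D_def abs_mult F_def mult_right_mono)
  also have "\<dots> = ?B ^ 3 * (?Z ^ 3 * exp (- ?Z) + 3 * (?Z ^ 2 * exp (- ?Z)) + ?Z ^ 1 * exp (- ?Z))"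
    by (simp add: algebra_simps)
  also have "\<dots> \<le> ?B ^ 3 * (fact 3 + 3 * fact 2 + fact 1)"
    using B0 Z0 by (intro mult_left_mono add_mono power_le_fact_mult_exp order_refl) auto
  also have "\<dots> = 13 * ?B ^ 3" by (simp add: fact_numeral)
  finally have D3: "\<bar>D 3 t\<bar> \<le> 13 * ?B ^ 3" .
  have "\<bar>F h - F 0 * (1 - h * Z 1 0 + h\<^sup>2 / 2 * ((Z 1 0)\<^sup>2 - Z 2 0))\<bar> = \<bar>D 3 t\<bar> / 6 * h ^ 3"
    unfolding T sum using h by (simp add: abs_mult fact_numeral)
  also have "\<dots> \<le> (13 * ?B ^ 3) / 6 * h ^ 3"
    using D3 h by (intro mult_right_mono divide_right_mono) auto
  finally show ?thesis unfolding Fh F0 Z10 by simp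
qed

lemma lin_form_bound: "finite I \<Longrightarrow> (\<Sum>i\<in>I. (a i)\<^sup>2) \<le> L \<Longrightarrow> \<bar>lin_form I a x\<bar> \<le> sqrt L * sqrt (sqnorm I x)"
proof -
  assume L: "(\<Sum>i\<in>I. (a i)\<^sup>2) \<le> L"
  have "\<bar>lin_form I a x\<bar> \<le> (\<Sum>i\<in>I. \<bar>a i\<bar> * \<bar>x i\<bar>)"
    unfolding lin_form_def abs_mult[symmetric] by (rule sum_abs)
  also have "\<dots> \<le> L2_set a I * L2_set x I" by (rule L2_set_mult_ineq)
  also have "\<dots> \<le> sqrt L * sqrt (sqnorm I x)"
    unfolding L2_set_def sqnorm_def using L by (intro mult_right_mono) (auto simp: sum_nonneg)
  finally show ?thesis .
qed

text \<open>A Gaussian increment of size \<open>h\<close> changes the mean of \<open>gumbel\<close> by an amount that depends only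
  on the covariances of the increment, up to \<open>O(h ^ 3)\<close>. The covariances of distinct indices enter
  with a positive sign.\<close>

lemma gumbel_one_step:
  fixes a :: "'s \<Rightarrow> 'i \<Rightarrow> real" and c :: real
  assumes I: "finite I" and S: "finite S" and \<beta>: "0 \<le> \<beta>" and h: "0 < h"
    and L: "\<And>s. s \<in> S \<Longrightarrow> (\<Sum>i\<in>I. (a s i)\<^sup>2) \<le> L" "0 \<le> L"
  defines "z \<equiv> \<lambda>w s. exp (\<beta> * w s - c)"
  defines "K \<equiv> 13 / 6 * (\<beta> * sqrt L) ^ 3 * (1 + (card I)\<^sup>2 + 2 * card I)"
  shows "\<bar>(\<integral>\<xi>. gumbel S \<beta> c (\<lambda>s. w s + h * lin_form I (a s) \<xi>) \<partial>gauss I) - gumbel S \<beta> c w *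
      (1 + (h * \<beta>)\<^sup>2 / 2 * ((\<Sum>s\<in>S. \<Sum>t\<in>S. z w s * z w t * (\<Sum>i\<in>I. a s i * a t i)) - (\<Sum>s\<in>S. z w s * (\<Sum>i\<in>I. (a s i)\<^sup>2))))\<bar>
     \<le> K * h ^ 3"
proof -
  interpret prob_space "gauss I" by (rule prob_space_gauss)
  note lf = lin_form_gauss[OF I]
  let ?X = "\<lambda>\<xi> s. lin_form I (a s) \<xi>" and ?z = "z w" and ?G = "gumbel S \<beta> c w"
  define T where "T = (\<lambda>\<xi>. ?G * (1 - h * (\<Sum>s\<in>S. \<beta> * ?z s * ?X \<xi> s) + h\<^sup>2 / 2 *
     ((\<Sum>s\<in>S. \<Sum>t\<in>S. (\<beta>\<^sup>2 * ?z s * ?z t) * (?X \<xi> s * ?X \<xi> t)) - (\<Sum>s\<in>S. (\<beta>\<^sup>2 * ?z s) * (?X \<xi> s * ?X \<xi> s)))))"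
  have T: "integrable (gauss I) T" unfolding T_def
    by (intro integrable_mult_right Bochner_Integration.integrable_add Bochner_Integration.integrable_diff
       Bochner_Integration.integrable_sum lf integrable_const)
  have "(\<integral>\<xi>. T \<xi> \<partial>gauss I) = ?G * (1 - h * (\<Sum>s\<in>S. \<beta> * ?z s * 0) + h\<^sup>2 / 2 *
     ((\<Sum>s\<in>S. \<Sum>t\<in>S. (\<beta>\<^sup>2 * ?z s * ?z t) * (\<Sum>i\<in>I. a s i * a t i)) - (\<Sum>s\<in>S. (\<beta>\<^sup>2 * ?z s) * (\<Sum>i\<in>I. a s i * a s i))))"
    unfolding T_def using prob_space by (simp add: lf Bochner_Integration.integrable_diff)
  also have "\<dots> = ?G * (1 + (h * \<beta>)\<^sup>2 / 2 * ((\<Sum>s\<in>S. \<Sum>t\<in>S. ?z s * ?z t * (\<Sum>i\<in>I. a s i * a t i)) - (\<Sum>s\<in>S. ?z s * (\<Sum>i\<in>I. (a s i)\<^sup>2))))"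
    by (simp add: power_mult_distrib sum_distrib_left right_diff_distrib power2_eq_square mult_ac)
  finally have ET: "(\<integral>\<xi>. T \<xi> \<partial>gauss I) = \<dots>" .
  have Gi: "integrable (gauss I) (\<lambda>\<xi>. gumbel S \<beta> c (\<lambda>s. w s + h * ?X \<xi> s))"
    by (rule integrable_const_bound[of _ 1]) (auto intro!: gumbel_measurable)
  let ?K = "13 / 6 * (\<beta> * sqrt L) ^ 3"
  have "\<bar>(\<integral>\<xi>. gumbel S \<beta> c (\<lambda>s. w s + h * ?X \<xi> s) \<partial>gauss I) - (\<integral>\<xi>. T \<xi> \<partial>gauss I)\<bar>
     = \<bar>\<integral>\<xi>. gumbel S \<beta> c (\<lambda>s. w s + h * ?X \<xi> s) - T \<xi> \<partial>gauss I\<bar>"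
    using Gi T by simp
  also have "\<dots> \<le> (\<integral>\<xi>. \<bar>gumbel S \<beta> c (\<lambda>s. w s + h * ?X \<xi> s) - T \<xi>\<bar> \<partial>gauss I)"
    by (rule integral_abs_bound)
  also have "\<dots> \<le> (\<integral>\<xi>. ?K * h ^ 3 * (1 + (sqnorm I \<xi>)\<^sup>2) \<partial>gauss I)"
  proof (rule integral_mono)
    show "integrable (gauss I) (\<lambda>\<xi>. ?K * h ^ 3 * (1 + (sqnorm I \<xi>)\<^sup>2))"
      using sqnorm_gauss(3)[OF I order_refl] by auto
    show "integrable (gauss I) (\<lambda>\<xi>. \<bar>gumbel S \<beta> c (\<lambda>s. w s + h * ?X \<xi> s) - T \<xi>\<bar>)" using Gi T by auto
    fix \<xi>
    let ?r = "sqrt (sqnorm I \<xi>)"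
    have "T \<xi> = ?G * (1 - h * (\<Sum>s\<in>S. \<beta> * ?X \<xi> s * ?z s) + h\<^sup>2 / 2 * ((\<Sum>s\<in>S. \<beta> * ?X \<xi> s * ?z s)\<^sup>2 - (\<Sum>s\<in>S. (\<beta> * ?X \<xi> s)\<^sup>2 * ?z s)))"
      unfolding T_def power2_eq_square[of "sum _ _"] sum_product by (simp add: power2_eq_square mult_ac)
    then have "\<bar>gumbel S \<beta> c (\<lambda>s. w s + h * ?X \<xi> s) - T \<xi>\<bar> \<le> 13 / 6 * (\<beta> * (sqrt L * ?r)) ^ 3 * h ^ 3"
      using gumbel_taylor[OF S \<beta> h, of "?X \<xi>" "sqrt L * ?r" c w] lin_form_bound[OF I L(1)] L(2) by (simp add: z_def)
    also have "\<dots> = ?K * h ^ 3 * ?r ^ 3" by (simp add: power_mult_distrib)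
    also have "\<dots> \<le> ?K * h ^ 3 * (1 + (sqnorm I \<xi>)\<^sup>2)"
    proof (rule mult_left_mono)
      have r: "0 \<le> ?r" by simp
      have "?r ^ 3 \<le> 1 + ?r ^ 4"
      proof (cases "?r \<le> 1")
        case True then have "?r ^ 3 \<le> 1" using r by (simp add: power_le_one)
        then show ?thesis by (smt (verit) r zero_le_power)
      next
        case False then have "?r ^ 3 \<le> ?r ^ 4" by (intro power_increasing) auto
        then show ?thesis by simp
      qed
      also have "?r ^ 4 = (?r\<^sup>2)\<^sup>2" by (simp only: power4_eq_xxxx power2_eq_square mult.assoc)
      also have "?r\<^sup>2 = sqnorm I \<xi>" by simp
      finally show "?r ^ 3 \<le> 1 + (sqnorm I \<xi>)\<^sup>2" .
      show "0 \<le> ?K * h ^ 3" using \<beta> h L(2) by simp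
    qed
    finally show "\<bar>gumbel S \<beta> c (\<lambda>s. w s + h * ?X \<xi> s) - T \<xi>\<bar> \<le> ?K * h ^ 3 * (1 + (sqnorm I \<xi>)\<^sup>2)" .
  qed
  also have "\<dots> = K * h ^ 3"
    using sqnorm_gauss(3,4)[OF I order_refl] prob_space by (simp add: K_def algebra_simps)
  finally show ?thesis unfolding ET .
qed

text \<open>The Gaussian semigroup with the covariances of the family \<open>a\<close>, at time \<open>r\<close>.\<close>

definition gumbel_smoothing :: "'i set \<Rightarrow> ('s \<Rightarrow> 'i \<Rightarrow> real) \<Rightarrow> 's set \<Rightarrow> real \<Rightarrow> real \<Rightarrow> real \<Rightarrow> ('s \<Rightarrow> real) \<Rightarrow> real" where
  "gumbel_smoothing I a S \<beta> c r w = (\<integral>\<xi>. gumbel S \<beta> c (\<lambda>s. w s + sqrt r * lin_form I (a s) \<xi>) \<partial>gauss I)"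

lemma gumbel_smoothing_measurable [measurable (raw)]:
  assumes "\<And>s. s \<in> S \<Longrightarrow> f s \<in> borel_measurable M"
  shows "(\<lambda>x. gumbel_smoothing I a S \<beta> c r (\<lambda>s. f s x)) \<in> borel_measurable M"
proof -
  interpret sigma_finite_measure "gauss I" by (rule sigma_finite_gauss)
  have "(\<lambda>(x, \<xi>). gumbel S \<beta> c (\<lambda>s. f s x + sqrt r * lin_form I (a s) \<xi>)) \<in> borel_measurable (M \<Otimes>\<^sub>M gauss I)"
    unfolding split_beta' using assms
    by (intro gumbel_measurable borel_measurable_add borel_measurable_times borel_measurable_const measurable_compose[OF measurable_fst] measurable_compose[OF measurable_snd])
      (auto intro!: lin_form_measurable)
  then show ?thesis unfolding gumbel_smoothing_def by (rule borel_measurable_lebesgue_integral)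
qed

lemma gumbel_smoothing_bounds: "norm (gumbel_smoothing I a S \<beta> c r w) \<le> 1"
proof -
  interpret prob_space "gauss I" by (rule prob_space_gauss)
  have "norm (gumbel_smoothing I a S \<beta> c r w) \<le> (\<integral>\<xi>. norm (gumbel S \<beta> c (\<lambda>s. w s + sqrt r * lin_form I (a s) \<xi>)) \<partial>gauss I)"
    unfolding gumbel_smoothing_def by (rule integral_norm_bound)
  also have "\<dots> \<le> 1"
    by (rule integral_le_const) (auto intro!: integrable_const_bound[of _ 1] gumbel_measurable)
  finally show ?thesis .
qed

text \<open>The semigroups of two families commute, by Fubini's theorem.\<close>

lemma gumbel_smoothing_commute:
  "(\<integral>\<xi>. gumbel_smoothing J b S \<beta> c q (\<lambda>s. w s + sqrt r * lin_form I (a s) \<xi>) \<partial>gauss I)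
    = (\<integral>\<eta>. gumbel_smoothing I a S \<beta> c r (\<lambda>s. w s + sqrt q * lin_form J (b s) \<eta>) \<partial>gauss J)"
proof -
  interpret pair_sigma_finite "gauss I" "gauss J" by (rule pair_sigma_finite_gauss)
  interpret pair_prob_space "gauss I" "gauss J"
    by (simp add: pair_prob_space_def prob_space_gauss pair_sigma_finite_gauss)
  have "integrable (gauss I \<Otimes>\<^sub>M gauss J) (\<lambda>(\<xi>, \<eta>). gumbel S \<beta> c (\<lambda>s. w s + sqrt r * lin_form I (a s) \<xi> + sqrt q * lin_form J (b s) \<eta>))"
    unfolding split_beta'
    by (rule integrable_const_bound[of _ 1])
      (auto intro!: gumbel_measurable borel_measurable_add borel_measurable_times measurable_compose[OF measurable_fst] measurable_compose[OF measurable_snd] lin_form_measurable)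
  from Fubini_integral[OF this] show ?thesis
    unfolding gumbel_smoothing_def by (simp add: add_ac)
qed

lemma lin_form_restrict [simp]: "lin_form I a (restrict x I) = lin_form I a x"
  unfolding lin_form_def by (rule sum.cong) auto

text \<open>The semigroup property is the stability of the Gaussian measure.\<close>

lemma gumbel_smoothing_add:
  assumes I: "finite I" and "0 \<le> r" "0 \<le> q"
  shows "gumbel_smoothing I a S \<beta> c (r + q) w = (\<integral>\<xi>. gumbel_smoothing I a S \<beta> c q (\<lambda>s. w s + sqrt r * lin_form I (a s) \<xi>) \<partial>gauss I)"
proof -
  interpret pair_sigma_finite "gauss I" "gauss I" by (rule pair_sigma_finite_gauss)
  interpret pair_prob_space "gauss I" "gauss I"
    by (simp add: pair_prob_space_def prob_space_gauss pair_sigma_finite_gauss)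
  define H where "H = (\<lambda>\<xi>. gumbel S \<beta> c (\<lambda>s. w s + lin_form I (a s) \<xi>))"
  have H: "H \<in> borel_measurable (PiM I (\<lambda>_. borel))"
    unfolding H_def by (intro gumbel_measurable) measurable
  have lin: "lin_form I a (\<lambda>i\<in>I. u * x i + v * y i) = u * lin_form I a x + v * lin_form I a y" for a u v x y
    unfolding lin_form_def by (simp add: algebra_simps sum.distrib sum_distrib_left)
  have lin1: "lin_form I a (\<lambda>i\<in>I. u * x i) = u * lin_form I a x" for a u x
    unfolding lin_form_def by (simp add: algebra_simps sum_distrib_left)
  have "gumbel_smoothing I a S \<beta> c (r + q) w = (\<integral>\<xi>. H (\<lambda>i\<in>I. sqrt ((sqrt r)\<^sup>2 + (sqrt q)\<^sup>2) * \<xi> i) \<partial>gauss I)"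
    using assms by (simp add: gumbel_smoothing_def H_def lin1 del: lin_form_restrict restrict_apply)
  also have "\<dots> = (\<integral>\<xi>. H \<xi> \<partial>distr (gauss I) (PiM I (\<lambda>_. borel)) (\<lambda>\<xi>. \<lambda>i\<in>I. sqrt ((sqrt r)\<^sup>2 + (sqrt q)\<^sup>2) * \<xi> i))"
    using H by (subst integral_distr) auto
  also have "\<dots> = (\<integral>z. H (case z of (x, y) \<Rightarrow> \<lambda>i\<in>I. sqrt r * x i + sqrt q * y i) \<partial>(gauss I \<Otimes>\<^sub>M gauss I))"
    unfolding gauss_stable[OF I, symmetric] using H by (subst integral_distr) auto
  also have "\<dots> = (\<integral>(x, y). gumbel S \<beta> c (\<lambda>s. w s + sqrt r * lin_form I (a s) x + sqrt q * lin_form I (a s) y) \<partial>(gauss I \<Otimes>\<^sub>M gauss I))"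
    by (intro Bochner_Integration.integral_cong refl) (simp add: H_def lin add_ac split: prod.split del: lin_form_restrict)
  also have "\<dots> = (\<integral>x. \<integral>y. gumbel S \<beta> c (\<lambda>s. w s + sqrt r * lin_form I (a s) x + sqrt q * lin_form I (a s) y) \<partial>gauss I \<partial>gauss I)"
  proof -
    have int: "integrable (gauss I \<Otimes>\<^sub>M gauss I) (\<lambda>(\<xi>, \<eta>). gumbel S \<beta> c (\<lambda>s. w s + sqrt r * lin_form I (a s) \<xi> + sqrt q * lin_form I (a s) \<eta>))"
      unfolding split_beta'
      by (rule integrable_const_bound[of _ 1])
        (auto intro!: gumbel_measurable borel_measurable_add borel_measurable_times measurable_compose[OF measurable_fst] measurable_compose[OF measurable_snd] lin_form_measurable)
    show ?thesis using integral_fst'[OF int] by simp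
  qed
  finally show ?thesis unfolding gumbel_smoothing_def .
qed

text \<open>Lindeberg's replacement argument. The unit of time is divided into steps of length \<open>\<epsilon>\<close>, and the
  increments of the family \<open>b\<close> are exchanged one at a time for increments of \<open>a\<close>. One exchange
  increases the mean up to an error \<open>O(\<epsilon> powr (3 / 2))\<close>, by the expansion above and the
  assumption on the covariances. As the two semigroups commute, the \<open>1 / \<epsilon>\<close> exchanges add up to
  an error \<open>O(sqrt \<epsilon>)\<close>.\<close>

lemma gumbel_comparison:
  fixes a :: "'s \<Rightarrow> 'i \<Rightarrow> real" and b :: "'s \<Rightarrow> 'j \<Rightarrow> real"
  assumes I: "finite I" and J: "finite J" and S: "finite S" and \<beta>: "0 \<le> \<beta>"
    and var: "\<And>s. s \<in> S \<Longrightarrow> (\<Sum>i\<in>I. (a s i)\<^sup>2) = (\<Sum>j\<in>J. (b s j)\<^sup>2)"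
    and cov: "\<And>s t. s \<in> S \<Longrightarrow> t \<in> S \<Longrightarrow> (\<Sum>j\<in>J. b s j * b t j) \<le> (\<Sum>i\<in>I. a s i * a t i)"
  shows "(\<integral>\<eta>. gumbel S \<beta> c (\<lambda>s. lin_form J (b s) \<eta>) \<partial>gauss J) \<le> (\<integral>\<xi>. gumbel S \<beta> c (\<lambda>s. lin_form I (a s) \<xi>) \<partial>gauss I)"
proof -
  interpret GI: prob_space "gauss I" by (rule prob_space_gauss)
  interpret GJ: prob_space "gauss J" by (rule prob_space_gauss)
  let ?A = "gumbel_smoothing I a S \<beta> c" and ?B = "gumbel_smoothing J b S \<beta> c"
  define L where "L = (\<Sum>s\<in>S. \<Sum>i\<in>I. (a s i)\<^sup>2)"
  have L0: "0 \<le> L" unfolding L_def by (auto intro!: sum_nonneg)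
  have LI: "(\<Sum>i\<in>I. (a s i)\<^sup>2) \<le> L" if "s \<in> S" for s
    unfolding L_def using that S by (intro member_le_sum) (auto intro!: sum_nonneg)
  have LJ: "(\<Sum>j\<in>J. (b s j)\<^sup>2) \<le> L" if "s \<in> S" for s
    using LI[OF that] var[OF that] by simp
  define K where "K = 13 / 6 * (\<beta> * sqrt L) ^ 3 * (1 + (card I)\<^sup>2 + 2 * card I) + 13 / 6 * (\<beta> * sqrt L) ^ 3 * (1 + (card J)\<^sup>2 + 2 * card J)"
  have step: "?B \<epsilon> w - K * sqrt \<epsilon> ^ 3 \<le> ?A \<epsilon> w" if \<epsilon>: "0 < \<epsilon>" for \<epsilon> w
  proof -
    let ?z = "\<lambda>s. exp (\<beta> * w s - c)"
    let ?q = "\<lambda>V. gumbel S \<beta> c w * (1 + (sqrt \<epsilon> * \<beta>)\<^sup>2 / 2 * ((\<Sum>s\<in>S. \<Sum>t\<in>S. ?z s * ?z t * V s t) - (\<Sum>s\<in>S. ?z s * (\<Sum>i\<in>I. (a s i)\<^sup>2))))"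
    have h: "0 < sqrt \<epsilon>" using \<epsilon> by simp
    have 1: "\<bar>?A \<epsilon> w - ?q (\<lambda>s t. \<Sum>i\<in>I. a s i * a t i)\<bar> \<le> 13 / 6 * (\<beta> * sqrt L) ^ 3 * (1 + (card I)\<^sup>2 + 2 * card I) * sqrt \<epsilon> ^ 3"
      unfolding gumbel_smoothing_def by (rule gumbel_one_step[OF I S \<beta> h LI L0])
    have 2: "\<bar>?B \<epsilon> w - ?q (\<lambda>s t. \<Sum>j\<in>J. b s j * b t j)\<bar> \<le> 13 / 6 * (\<beta> * sqrt L) ^ 3 * (1 + (card J)\<^sup>2 + 2 * card J) * sqrt \<epsilon> ^ 3"
      using gumbel_one_step[OF J S \<beta> h LJ L0, where c = c and w = w] unfolding gumbel_smoothing_def by (simp add: var)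
    have 3: "?q (\<lambda>s t. \<Sum>j\<in>J. b s j * b t j) \<le> ?q (\<lambda>s t. \<Sum>i\<in>I. a s i * a t i)"
      using cov gumbel_bounds(1)[of S \<beta> c w] by (intro mult_left_mono add_left_mono diff_right_mono sum_mono) auto
    show ?thesis using abs_le_D2[OF 1] abs_le_D1[OF 2] 3 unfolding K_def distrib_right by linarith
  qed
  have iI: "integrable (gauss I) (\<lambda>\<xi>. gumbel_smoothing J b S \<beta> c q (\<lambda>s. w s + sqrt r * lin_form I (a s) \<xi>))" for q r w
    by (rule GI.integrable_const_bound[of _ 1]) (auto intro!: gumbel_smoothing_measurable gumbel_smoothing_bounds[unfolded real_norm_def])
  have iI': "integrable (gauss I) (\<lambda>\<xi>. gumbel_smoothing I a S \<beta> c q (\<lambda>s. w s + sqrt r * lin_form I (a s) \<xi>))" for q r w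
    by (rule GI.integrable_const_bound[of _ 1]) (auto intro!: gumbel_smoothing_measurable gumbel_smoothing_bounds[unfolded real_norm_def])
  have iJ: "integrable (gauss J) (\<lambda>\<xi>. gumbel_smoothing J b S \<beta> c q (\<lambda>s. w s + sqrt r * lin_form J (b s) \<xi>))" for q r w
    by (rule GJ.integrable_const_bound[of _ 1]) (auto intro!: gumbel_smoothing_measurable gumbel_smoothing_bounds[unfolded real_norm_def])
  have iJ': "integrable (gauss J) (\<lambda>\<xi>. gumbel_smoothing I a S \<beta> c q (\<lambda>s. w s + sqrt r * lin_form J (b s) \<xi>))" for q r w
    by (rule GJ.integrable_const_bound[of _ 1]) (auto intro!: gumbel_smoothing_measurable gumbel_smoothing_bounds[unfolded real_norm_def])
  have steps: "?B (real k * \<epsilon>) w - real k * (K * sqrt \<epsilon> ^ 3) \<le> ?A (real k * \<epsilon>) w" if \<epsilon>: "0 < \<epsilon>" for \<epsilon> w k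
  proof (induction k arbitrary: w)
    case 0
    have "?A 0 w = gumbel S \<beta> c w" "?B 0 w = gumbel S \<beta> c w"
      using GI.prob_space GJ.prob_space by (simp_all add: gumbel_smoothing_def)
    then show ?case by simp
  next
    case (Suc k)
    let ?r = "real k * \<epsilon>" and ?d = "K * sqrt \<epsilon> ^ 3"
    have r: "0 \<le> ?r" "0 \<le> \<epsilon>" "real (Suc k) * \<epsilon> = \<epsilon> + ?r" "real (Suc k) * \<epsilon> = ?r + \<epsilon>" using \<epsilon> by (auto simp: algebra_simps)
    have "?B (real (Suc k) * \<epsilon>) w - ?d = (\<integral>\<eta>. ?B \<epsilon> (\<lambda>s. w s + sqrt ?r * lin_form J (b s) \<eta>) - ?d \<partial>gauss J)"
      unfolding r(4) gumbel_smoothing_add[OF J r(1,2)] using iJ GJ.prob_space by simp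
    also have "\<dots> \<le> (\<integral>\<eta>. ?A \<epsilon> (\<lambda>s. w s + sqrt ?r * lin_form J (b s) \<eta>) \<partial>gauss J)"
      using iJ iJ' step[OF \<epsilon>] by (intro integral_mono) auto
    also have "\<dots> = (\<integral>\<xi>. ?B ?r (\<lambda>s. w s + sqrt \<epsilon> * lin_form I (a s) \<xi>) \<partial>gauss I)"
      by (rule gumbel_smoothing_commute[symmetric])
    finally have "?B (real (Suc k) * \<epsilon>) w - real (Suc k) * ?d \<le> (\<integral>\<xi>. ?B ?r (\<lambda>s. w s + sqrt \<epsilon> * lin_form I (a s) \<xi>) - real k * ?d \<partial>gauss I)"
      using iI GI.prob_space by (simp add: algebra_simps)
    also have "\<dots> \<le> (\<integral>\<xi>. ?A ?r (\<lambda>s. w s + sqrt \<epsilon> * lin_form I (a s) \<xi>) \<partial>gauss I)"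
      using iI iI' Suc.IH by (intro integral_mono) auto
    also have "\<dots> = ?A (real (Suc k) * \<epsilon>) w"
      unfolding r(3) gumbel_smoothing_add[OF I r(2,1)] ..
    finally show ?case .
  qed
  have "?B 1 w - ?A 1 w \<le> K / sqrt (real (Suc m))" for m w
  proof -
    have "?B 1 w - real (Suc m) * (K * sqrt (1 / Suc m) ^ 3) \<le> ?A 1 w"
      using steps[of "1 / Suc m" "Suc m" w] by simp
    moreover have "real (Suc m) * (K * sqrt (1 / Suc m) ^ 3) = K / sqrt (real (Suc m))"
    proof -
      define n where "n = real (Suc m)"
      have n: "0 < n" by (simp add: n_def)
      have "sqrt (1 / n) ^ 3 = 1 / (n * sqrt n)"
        using n by (simp add: real_sqrt_divide power3_eq_cube)
      then have "n * (K * sqrt (1 / n) ^ 3) = K / sqrt n" using n by simp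
      then show ?thesis unfolding n_def .
    qed
    ultimately show ?thesis by linarith
  qed
  moreover have "(\<lambda>m. K / sqrt (real (Suc m))) \<longlonglongrightarrow> 0" by real_asymp
  ultimately have "?B 1 w - ?A 1 w \<le> 0" for w
    by (intro LIMSEQ_le_const[of "\<lambda>m. K / sqrt (real (Suc m))"]) auto
  from this[of "\<lambda>_. 0"] show ?thesis by (simp add: gumbel_smoothing_def)
qed

text \<open>The threshold exceeds \<open>m * y\<close> by \<open>sqrt m\<close>, which is negligible against \<open>m * (x s - y)\<close> but
  diverges; hence the limit is 1 even where some \<open>x s\<close> equals \<open>y\<close>.\<close>

lemma gumbel_limit:
  assumes S: "finite S"
  shows "(\<lambda>m. gumbel S (real m) (real m * y + sqrt (real m)) x) \<longlonglongrightarrow> (if \<forall>s\<in>S. x s \<le> y then 1 else 0)"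
proof (cases "\<forall>s\<in>S. x s \<le> y")
  case True
  have "(\<lambda>m. exp (real m * x s - (real m * y + sqrt (real m)))) \<longlonglongrightarrow> 0" if "s \<in> S" for s
  proof (rule Lim_null_comparison)
    show "\<forall>\<^sub>F m in sequentially. norm (exp (real m * x s - (real m * y + sqrt (real m)))) \<le> exp (- sqrt (real m))"
      using True that by (intro always_eventually allI) (auto intro!: mult_left_mono)
    show "(\<lambda>m. exp (- sqrt (real m))) \<longlonglongrightarrow> 0" by real_asymp
  qed
  then have "(\<lambda>m. exp (- (\<Sum>s\<in>S. exp (real m * x s - (real m * y + sqrt (real m)))))) \<longlonglongrightarrow> exp (- (\<Sum>s\<in>S. 0))"
    by (intro tendsto_intros)
  then show ?thesis using True by (simp add: gumbel_def)
next
  case False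
  then obtain s where s: "s \<in> S" "x s > y" by auto
  define d where "d = x s - y"
  have d: "d > 0" using s by (simp add: d_def)
  have "(\<lambda>m. gumbel S (real m) (real m * y + sqrt (real m)) x) \<longlonglongrightarrow> 0"
  proof (rule Lim_null_comparison)
    show "\<forall>\<^sub>F m in sequentially. norm (gumbel S (real m) (real m * y + sqrt (real m)) x) \<le> exp (- exp (real m * d - sqrt (real m)))"
    proof (intro always_eventually allI)
      fix m
      have eq: "real m * d - sqrt (real m) = real m * x s - (real m * y + sqrt (real m))"
        by (simp add: d_def algebra_simps)
      have "exp (real m * d - sqrt (real m)) \<le> (\<Sum>s\<in>S. exp (real m * x s - (real m * y + sqrt (real m))))"
        unfolding eq using s S by (intro member_le_sum) auto
      then show "norm (gumbel S (real m) (real m * y + sqrt (real m)) x) \<le> exp (- exp (real m * d - sqrt (real m)))"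
        by (simp add: gumbel_def)
    qed
    show "(\<lambda>m. exp (- exp (real m * d - sqrt (real m)))) \<longlonglongrightarrow> 0" using d by real_asymp
  qed
  moreover have "(if \<forall>s\<in>S. x s \<le> y then 1 else 0) = (0 :: real)" using False by auto
  ultimately show ?thesis by (simp only:)
qed

lemma slepian_finite:
  fixes a :: "'s \<Rightarrow> 'i \<Rightarrow> real" and b :: "'s \<Rightarrow> 'j \<Rightarrow> real"
  assumes I: "finite I" and J: "finite J" and S: "finite S"
    and var: "\<And>s. s \<in> S \<Longrightarrow> (\<Sum>i\<in>I. (a s i)\<^sup>2) = (\<Sum>j\<in>J. (b s j)\<^sup>2)"
    and cov: "\<And>s t. s \<in> S \<Longrightarrow> t \<in> S \<Longrightarrow> (\<Sum>j\<in>J. b s j * b t j) \<le> (\<Sum>i\<in>I. a s i * a t i)"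
  shows "measure (gauss J) {\<eta> \<in> space (gauss J). \<forall>s\<in>S. lin_form J (b s) \<eta> \<le> y} \<le> measure (gauss I) {\<xi> \<in> space (gauss I). \<forall>s\<in>S. lin_form I (a s) \<xi> \<le> y}"
proof -
  have lim: "(\<lambda>m. \<integral>\<xi>. gumbel S (real m) (real m * y + sqrt (real m)) (\<lambda>s. lin_form I (a s) \<xi>) \<partial>gauss I)
     \<longlonglongrightarrow> measure (gauss I) {\<xi> \<in> space (gauss I). \<forall>s\<in>S. lin_form I (a s) \<xi> \<le> y}" if "finite I" for I :: "'k set" and a :: "'s \<Rightarrow> 'k \<Rightarrow> real"
  proof -
    interpret prob_space "gauss I" by (rule prob_space_gauss)
    let ?E = "{\<xi> \<in> space (gauss I). \<forall>s\<in>S. lin_form I (a s) \<xi> \<le> y}"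
    have E: "?E \<in> sets (gauss I)" using S by measurable
    have "(\<lambda>m. \<integral>\<xi>. gumbel S (real m) (real m * y + sqrt (real m)) (\<lambda>s. lin_form I (a s) \<xi>) \<partial>gauss I)
     \<longlonglongrightarrow> (\<integral>\<xi>. (if \<forall>s\<in>S. lin_form I (a s) \<xi> \<le> y then 1 else 0 :: real) \<partial>gauss I)"
      using gumbel_limit[OF S] S
      by (intro integral_dominated_convergence[where w = "\<lambda>_. 1"]) (auto intro!: gumbel_measurable)
    also have "(\<integral>\<xi>. (if \<forall>s\<in>S. lin_form I (a s) \<xi> \<le> y then 1 else 0 :: real) \<partial>gauss I) = (\<integral>\<xi>. indicator ?E \<xi> \<partial>gauss I)"
      by (intro Bochner_Integration.integral_cong) (auto simp: indicator_def)
    also have "\<dots> = measure (gauss I) (?E \<inter> space (gauss I))"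
      by (rule Bochner_Integration.integral_indicator)
    also have "?E \<inter> space (gauss I) = ?E" by auto
    finally show ?thesis .
  qed
  show ?thesis
    by (rule LIMSEQ_le[OF lim[OF J] lim[OF I]]) (use gumbel_comparison[OF I J S _ var cov] in auto)
qed

text \<open>Slepian's inequality for countable families. Equal covariances allow the inequality in both
  directions, so that the law of the supremum depends on the covariances only; this replaces
  the rotation invariance of the GOE in the recursion for the lower bound.\<close>

lemma slepian:
  fixes a :: "'s \<Rightarrow> 'i \<Rightarrow> real" and b :: "'s \<Rightarrow> 'j \<Rightarrow> real"
  assumes I: "finite I" and J: "finite J" and S: "countable S"
    and var: "\<And>s. s \<in> S \<Longrightarrow> (\<Sum>i\<in>I. (a s i)\<^sup>2) = (\<Sum>j\<in>J. (b s j)\<^sup>2)"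
    and cov: "\<And>s t. s \<in> S \<Longrightarrow> t \<in> S \<Longrightarrow> (\<Sum>j\<in>J. b s j * b t j) \<le> (\<Sum>i\<in>I. a s i * a t i)"
  shows "measure (gauss J) {\<eta> \<in> space (gauss J). \<forall>s\<in>S. lin_form J (b s) \<eta> \<le> y} \<le> measure (gauss I) {\<xi> \<in> space (gauss I). \<forall>s\<in>S. lin_form I (a s) \<xi> \<le> y}"
proof (cases "S = {}")
  case True
  then show ?thesis using prob_space.prob_space[OF prob_space_gauss, of I] prob_space.prob_space[OF prob_space_gauss, of J] by simp
next
  case False
  define T where "T = (\<lambda>n. from_nat_into S ` {..n::nat})"
  have TS: "T n \<subseteq> S" "finite (T n)" for n using from_nat_into[OF False] unfolding T_def by blast+
  have ST: "S = (\<Union>n. T n)"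
  proof -
    have "(\<Union>n. T n) = range (from_nat_into S)" by (auto simp: T_def)
    then show ?thesis using range_from_nat_into[OF False S] by simp
  qed
  have lim: "(\<lambda>n. measure (gauss I) {\<xi> \<in> space (gauss I). \<forall>s\<in>T n. lin_form I (a s) \<xi> \<le> y}) \<longlonglongrightarrow> measure (gauss I) {\<xi> \<in> space (gauss I). \<forall>s\<in>S. lin_form I (a s) \<xi> \<le> y}"
     if "finite I" for I :: "'k set" and a :: "'s \<Rightarrow> 'k \<Rightarrow> real"
  proof -
    interpret prob_space "gauss I" by (rule prob_space_gauss)
    let ?E = "\<lambda>n. {\<xi> \<in> space (gauss I). \<forall>s\<in>T n. lin_form I (a s) \<xi> \<le> y}"
    have "?E n \<in> sets (gauss I)" for n using TS(2)[of n] by measurable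
    then have "range ?E \<subseteq> sets (gauss I)" by blast
    moreover have "decseq ?E" unfolding decseq_def T_def by fastforce
    ultimately have "(\<lambda>n. measure (gauss I) (?E n)) \<longlonglongrightarrow> measure (gauss I) (\<Inter>n. ?E n)"
      by (rule finite_Lim_measure_decseq)
    also have "(\<Inter>n. ?E n) = {\<xi> \<in> space (gauss I). \<forall>s\<in>S. lin_form I (a s) \<xi> \<le> y}"
      unfolding ST by auto
    finally show ?thesis .
  qed
  show ?thesis
  proof (rule LIMSEQ_le[OF lim[OF J] lim[OF I]], intro exI[of _ 0] allI impI)
    fix n
    show "measure (gauss J) {\<eta> \<in> space (gauss J). \<forall>s\<in>T n. lin_form J (b s) \<eta> \<le> y}
         \<le> measure (gauss I) {\<xi> \<in> space (gauss I). \<forall>s\<in>T n. lin_form I (a s) \<xi> \<le> y}"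
      using TS(1)[of n] by (intro slepian_finite[OF I J TS(2)] var cov) auto
  qed
qed

section \<open>The normal distribution function\<close>

interpretation normal_law: real_distribution normal_law by (rule real_dist_normal_dist)

lemma normal_law_cdf_increment: "x \<le> y \<Longrightarrow> cdf normal_law y - cdf normal_law x = measure normal_law {x<..y}"
  using normal_law.cdf_diff_eq[of x y] by (cases "x = y") auto

lemma normal_law_singleton: "measure normal_law {x} = 0"
proof -
  have "emeasure normal_law {x} = (\<integral>\<^sup>+t. ennreal (std_normal_density t) * indicator {x} t \<partial>lborel)"
    by (rule emeasure_density) auto
  also have "\<dots> = 0"
  proof -
    have "AE t in lborel. ennreal (std_normal_density t) * indicator {x} t = 0"
      using AE_lborel_singleton[of x] by eventually_elim simp
    then show ?thesis by (subst nn_integral_0_iff_AE) auto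
  qed
  finally show ?thesis by (simp add: measure_def)
qed

lemma std_normal_cdf_atMost: "std_normal_cdf x = measure normal_law {..x}"
  by (simp add: std_normal_cdf_def cdf_def)

lemma std_normal_cdf_lessThan: "std_normal_cdf x = measure normal_law {..<x}"
proof -
  have "{..x} = {..<x} \<union> {x}" by auto
  then have "measure normal_law {..x} = measure normal_law {..<x} + measure normal_law {x}"
    using normal_law.finite_measure_Union[of "{..<x}" "{x}"] by simp
  then show ?thesis by (simp add: std_normal_cdf_atMost normal_law_singleton)
qed

lemma std_normal_cdf_bounds: "0 \<le> std_normal_cdf x" "std_normal_cdf x \<le> 1"
  by (simp_all add: std_normal_cdf_atMost)

lemma std_normal_cdf_abs_le [simp]: "\<bar>std_normal_cdf x\<bar> \<le> 1"
  using std_normal_cdf_bounds[of x] by simp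

lemma std_normal_cdf_mono: "x \<le> y \<Longrightarrow> std_normal_cdf x \<le> std_normal_cdf y"
  unfolding std_normal_cdf_atMost by (rule normal_law.finite_measure_mono) auto

lemma std_normal_cdf_measurable [measurable]: "std_normal_cdf \<in> borel_measurable borel"
  by (rule borel_measurable_mono) (auto simp: mono_def std_normal_cdf_mono)

lemma normal_law_uminus: "distr normal_law borel uminus = normal_law"
proof (rule measure_eqI)
  fix A assume "A \<in> sets (distr normal_law borel uminus)"
  then have A: "A \<in> sets borel" by simp
  have "emeasure (distr normal_law borel uminus) A = (\<integral>\<^sup>+x. indicator A (- x) \<partial>normal_law)"
    using A by (subst nn_integral_indicator[symmetric], simp, subst nn_integral_distr) auto
  also have "\<dots> = (\<integral>\<^sup>+x. ennreal (std_normal_density x) * indicator A (- x) \<partial>lborel)"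
    using A by (subst nn_integral_density) auto
  also have "\<dots> = (\<integral>\<^sup>+x. ennreal (std_normal_density x) * indicator A x \<partial>lborel)"
    using A by (subst nn_integral_real_affine[of _ "-1" 0]) (auto simp: normal_density_def)
  also have "\<dots> = emeasure normal_law A" using A by (subst emeasure_density) auto
  finally show "emeasure (distr normal_law borel uminus) A = emeasure normal_law A" .
qed simp

lemma std_normal_cdf_uminus: "std_normal_cdf (- x) = 1 - std_normal_cdf x"
proof -
  have "std_normal_cdf (- x) = measure (distr normal_law borel uminus) {..- x}"
    by (simp add: std_normal_cdf_atMost normal_law_uminus)
  also have "\<dots> = measure normal_law (uminus -` {..- x} \<inter> space normal_law)"
    by (rule measure_distr) auto
  also have "uminus -` {..- x} \<inter> space normal_law = space normal_law - {..<x}" by auto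
  also have "measure normal_law \<dots> = 1 - std_normal_cdf x"
    by (subst normal_law.prob_compl) (auto simp: std_normal_cdf_lessThan)
  finally show ?thesis .
qed

lemma std_normal_density_le1: "std_normal_density x \<le> 1"
proof -
  have "1 * 1 \<le> 2 * pi" using pi_gt3 by (intro mult_mono) auto
  then have "1 \<le> sqrt (2 * pi)" by simp
  then have "1 / sqrt (2 * pi) * exp (- x\<^sup>2 / 2) \<le> 1 * 1" by (intro mult_mono) auto
  then show ?thesis by (simp add: std_normal_density_def)
qed

lemma std_normal_density_lipschitz: "\<bar>std_normal_density y - std_normal_density x\<bar> \<le> \<bar>y - x\<bar>"
proof -
  have der: "(std_normal_density has_real_derivative - t * std_normal_density t) (at t)" for t
  proof -
    have "((\<lambda>x. exp (- x\<^sup>2 / 2)) has_real_derivative - t * exp (- t\<^sup>2 / 2)) (at t)"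
      by (auto intro!: derivative_eq_intros)
    from DERIV_cmult[OF this, of "1 / sqrt (2 * pi)"] show ?thesis
      unfolding std_normal_density_def[abs_def] by (simp only: mult_ac)
  qed
  have b: "\<bar>- t * std_normal_density t\<bar> \<le> 1" for t
  proof -
    have "\<bar>t\<bar> \<le> 1 + t\<^sup>2 / 2" using sum_squares_bound[of 1 "\<bar>t\<bar>"] zero_le_power2[of "\<bar>t\<bar> - 1"] by (simp add: power2_diff)
    also have "\<dots> \<le> exp (t\<^sup>2 / 2)" by (rule exp_ge_add_one_self)
    finally have e: "\<bar>t\<bar> * exp (- t\<^sup>2 / 2) \<le> 1" by (simp add: exp_minus field_simps)
    have "1 * 1 \<le> 2 * pi" using pi_gt3 by (intro mult_mono) auto
    then have "1 / sqrt (2 * pi) * (\<bar>t\<bar> * exp (- t\<^sup>2 / 2)) \<le> 1 * 1" using e by (intro mult_mono) auto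
    then show ?thesis by (simp add: std_normal_density_def abs_mult)
  qed
  have "norm (std_normal_density y - std_normal_density x) \<le> 1 * norm (y - x)"
    by (rule field_differentiable_bound[of UNIV _ "\<lambda>t. - t * std_normal_density t"])
       (use der b in auto)
  then show ?thesis by simp
qed

lemma std_normal_cdf_increment:
  assumes "x \<le> y"
  shows "\<bar>std_normal_cdf y - std_normal_cdf x - std_normal_density z * (y - x)\<bar> \<le> (y - x) * max \<bar>y - z\<bar> \<bar>x - z\<bar>"
proof -
  define d where "d = max \<bar>y - z\<bar> \<bar>x - z\<bar>"
  let ?A = "{x<..y}"
  have "std_normal_cdf y - std_normal_cdf x = measure normal_law ?A"
    using normal_law_cdf_increment[OF assms] by (simp add: std_normal_cdf_def)
  also have "\<dots> = (\<integral>t. indicator ?A t \<partial>normal_law)" by simp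
  also have "\<dots> = (\<integral>t. std_normal_density t * indicator ?A t \<partial>lborel)"
    by (subst integral_density) auto
  finally have eq: "std_normal_cdf y - std_normal_cdf x = (\<integral>t. std_normal_density t * indicator ?A t \<partial>lborel)" .
  have fin: "emeasure lborel ?A < \<infinity>" using assms by simp
  have int: "integrable lborel (\<lambda>t. std_normal_density t * indicator ?A t :: real)"
    using integrable_real_mult_indicator[of "{x<..y}" lborel std_normal_density] by simp
  have intc: "integrable lborel (\<lambda>t. c * indicator ?A t :: real)" for c using assms by auto
  have ind: "(\<integral>t. c * indicator ?A t \<partial>lborel) = c * (y - x)" for c :: real
    using assms by (simp add: measure_def)
  have b: "\<bar>std_normal_density t - std_normal_density z\<bar> \<le> d" if "t \<in> ?A" for t
    using std_normal_density_lipschitz[of t z] that by (auto simp: d_def)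
  have lb: "std_normal_density z - d \<le> std_normal_density t" "std_normal_density t \<le> std_normal_density z + d" if "t \<in> ?A" for t
    using b[OF that] by linarith+
  have "(\<integral>t. (std_normal_density z - d) * indicator ?A t \<partial>lborel) \<le> (\<integral>t. std_normal_density t * indicator ?A t \<partial>lborel)"
    by (rule integral_mono[OF intc int]) (use lb in \<open>auto simp: indicator_def\<close>)
  moreover have "(\<integral>t. std_normal_density t * indicator ?A t \<partial>lborel) \<le> (\<integral>t. (std_normal_density z + d) * indicator ?A t \<partial>lborel)"
    by (rule integral_mono[OF int intc]) (use lb in \<open>auto simp: indicator_def\<close>)
  ultimately show ?thesis unfolding ind eq[symmetric] abs_le_iff d_def[symmetric] by (simp add: algebra_simps)
qed

text \<open>The second derivative of \<open>std_normal_cdf\<close> is bounded by 1. Therefore fluctuations of size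
  \<open>\<delta>\<close> around the mean of a random variable change the mean of \<open>std_normal_cdf\<close> by at most \<open>\<delta>\<^sup>2\<close>.\<close>

lemma std_normal_cdf_taylor:
  "\<bar>std_normal_cdf y - std_normal_cdf x - std_normal_density x * (y - x)\<bar> \<le> (y - x)\<^sup>2"
proof (cases "x \<le> y")
  case True
  then show ?thesis using std_normal_cdf_increment[OF True, of x] by (simp add: power2_eq_square)
next
  case False
  then have "\<bar>std_normal_cdf x - std_normal_cdf y - std_normal_density x * (x - y)\<bar> \<le> (x - y) * (x - y)"
    using std_normal_cdf_increment[of y x x] by simp
  then show ?thesis by (simp add: power2_eq_square algebra_simps abs_le_iff)
qed

lemma std_normal_cdf_lipschitz:
  assumes "x \<le> y" shows "std_normal_cdf y - std_normal_cdf x \<le> y - x"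
proof -
  have "std_normal_cdf y - std_normal_cdf x = measure normal_law {x<..y}"
    using normal_law_cdf_increment[OF assms] by (simp add: std_normal_cdf_def)
  also have "\<dots> = (\<integral>t. indicator {x<..y} t \<partial>normal_law)" by simp
  also have "\<dots> = (\<integral>t. std_normal_density t * indicator {x<..y} t \<partial>lborel)"
    by (subst integral_density) auto
  also have "\<dots> \<le> (\<integral>t. indicator {x<..y} t \<partial>lborel)"
  proof (rule integral_mono)
    show "integrable lborel (\<lambda>t. std_normal_density t * indicator {x<..y} t :: real)"
      using integrable_real_mult_indicator[of "{x<..y}" lborel std_normal_density] by simp
    show "integrable lborel (indicator {x<..y} :: real \<Rightarrow> real)" using assms by simp
  qed (use assms std_normal_density_le1 in \<open>auto simp: indicator_def\<close>)
  also have "\<dots> = y - x" using assms by (simp add: measure_def)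
  finally show ?thesis .
qed

lemma integrable_std_normal_cdf:
  assumes "prob_space M" "f \<in> borel_measurable M"
  shows "integrable M (\<lambda>x. std_normal_cdf (f x))"
proof -
  interpret prob_space M by fact
  show ?thesis using assms(2) by (intro integrable_const_bound[of _ 1]) auto
qed

lemma expectation_std_normal_cdf:
  assumes M: "prob_space M" and U: "U \<in> borel_measurable M" and r: "0 < r"
  shows "(\<integral>x. std_normal_cdf (c + r * U x) \<partial>M) = (\<integral>t. 1 - measure M {x \<in> space M. U x \<le> (t - c) / r} \<partial>normal_law)"
proof -
  interpret M: prob_space M by fact
  interpret P: pair_prob_space M normal_law ..
  define f where "f = (\<lambda>x t. indicator {..<c + r * U x} t :: real)"
  have mf: "(\<lambda>(x, t). f x t) \<in> borel_measurable (M \<Otimes>\<^sub>M normal_law)"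
  proof -
    have "{z \<in> space (M \<Otimes>\<^sub>M normal_law). snd z < c + r * U (fst z)} \<in> sets (M \<Otimes>\<^sub>M normal_law)"
      using U by measurable
    then have "(indicator {z \<in> space (M \<Otimes>\<^sub>M normal_law). snd z < c + r * U (fst z)} :: _ \<Rightarrow> real) \<in> borel_measurable (M \<Otimes>\<^sub>M normal_law)"
      by (rule borel_measurable_indicator)
    then show ?thesis
      by (rule measurable_cong[THEN iffD1, rotated]) (auto simp: f_def indicator_def space_pair_measure)
  qed
  have int: "integrable (M \<Otimes>\<^sub>M normal_law) (\<lambda>(x, t). f x t)"
    by (rule P.integrable_const_bound[of _ 1]) (use mf in \<open>auto simp: f_def indicator_def\<close>)
  have "(\<integral>x. std_normal_cdf (c + r * U x) \<partial>M) = (\<integral>x. \<integral>t. f x t \<partial>normal_law \<partial>M)"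
    by (simp add: f_def std_normal_cdf_lessThan)
  also have "\<dots> = (\<integral>t. \<integral>x. f x t \<partial>M \<partial>normal_law)"
    by (rule P.Fubini_integral[OF int, symmetric])
  also have "\<dots> = (\<integral>t. 1 - measure M {x \<in> space M. U x \<le> (t - c) / r} \<partial>normal_law)"
  proof (rule Bochner_Integration.integral_cong[OF refl])
    fix t
    let ?E = "{x \<in> space M. U x \<le> (t - c) / r}"
    have E: "?E \<in> sets M" using U by measurable
    have "(\<integral>x. f x t \<partial>M) = (\<integral>x. indicator (space M - ?E) x \<partial>M)"
      using r by (intro Bochner_Integration.integral_cong) (auto simp: f_def indicator_def field_simps)
    also have "\<dots> = measure M ((space M - ?E) \<inter> space M)" by (rule Bochner_Integration.integral_indicator)
    also have "(space M - ?E) \<inter> space M = space M - ?E" by auto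
    also have "measure M \<dots> = 1 - measure M ?E" using E by (rule M.prob_compl)
    finally show "(\<integral>x. f x t \<partial>M) = 1 - measure M ?E" .
  qed
  finally show ?thesis .
qed

text \<open>Writing \<open>std_normal_cdf (c + r * U)\<close> as the probability that a normal variable lies below
  \<open>c + r * U\<close> expresses its mean through the distribution function of \<open>U\<close>. The representation with a
  strict inequality matches the events \<open>U \<le> s\<close> without an approximation from below.\<close>

lemma stochastic_dominance:
  assumes M: "prob_space M" and U: "U \<in> borel_measurable M"
    and N: "prob_space N" and V: "V \<in> borel_measurable N" and r: "0 \<le> r"
    and dom: "\<And>s. measure N {x \<in> space N. V x \<le> s} \<le> measure M {x \<in> space M. U x \<le> s}"
  shows "(\<integral>x. std_normal_cdf (c + r * U x) \<partial>M) \<le> (\<integral>x. std_normal_cdf (c + r * V x) \<partial>N)"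
proof (cases "r = 0")
  case True
  then show ?thesis using prob_space.prob_space[OF M] prob_space.prob_space[OF N] by simp
next
  case False
  then have r: "0 < r" using r by simp
  have int: "integrable normal_law (\<lambda>t. 1 - measure M {x \<in> space M. U x \<le> (t - c) / r})"
    if M: "prob_space M" and U: "U \<in> borel_measurable M" for M :: "'x measure" and U
  proof -
    interpret M: prob_space M by fact
    show ?thesis
    proof (rule normal_law.integrable_const_bound[of _ 1])
      have E: "{x \<in> space M. U x \<le> s} \<in> sets M" for s using U by measurable
      have "mono (\<lambda>s. measure M {x \<in> space M. U x \<le> s})"
        by (intro monoI M.finite_measure_mono E) auto
      then have m: "(\<lambda>s. measure M {x \<in> space M. U x \<le> s}) \<in> borel_measurable borel"
        by (rule borel_measurable_mono)
      have "(\<lambda>t. (t - c) / r) \<in> normal_law \<rightarrow>\<^sub>M borel" by simp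
      from measurable_compose[OF this m]
      show "(\<lambda>t. 1 - measure M {x \<in> space M. U x \<le> (t - c) / r}) \<in> borel_measurable normal_law"
        by (intro borel_measurable_diff borel_measurable_const)
    qed simp
  qed
  show ?thesis
    unfolding expectation_std_normal_cdf[OF M U r] expectation_std_normal_cdf[OF N V r]
    by (rule integral_mono[OF int[OF M U] int[OF N V]]) (use dom in auto)
qed

section \<open>Suprema of Gaussian families\<close>

text \<open>A family \<open>v \<mapsto> lin_form I (a v)\<close> of linear functions of a Gaussian vector, indexed by a set \<open>W\<close> of
  vectors. Continuity in \<open>v\<close> makes the supremum over \<open>W\<close> equal to the supremum over a
  countable subset, and the bounded variances make it finite.\<close>

definition gauss_family :: "'i set \<Rightarrow> ((nat \<Rightarrow> real) \<Rightarrow> 'i \<Rightarrow> real) \<Rightarrow> (nat \<Rightarrow> real) set \<Rightarrow> bool" where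
  "gauss_family I a W \<longleftrightarrow> finite I \<and> W \<noteq> {} \<and> (\<forall>i\<in>I. continuous_on UNIV (\<lambda>v. a v i)) \<and>
     (\<exists>L. \<forall>v\<in>W. (\<Sum>i\<in>I. (a v i)\<^sup>2) \<le> L)"

definition sup_form :: "'i set \<Rightarrow> ((nat \<Rightarrow> real) \<Rightarrow> 'i \<Rightarrow> real) \<Rightarrow> (nat \<Rightarrow> real) set \<Rightarrow> ('i \<Rightarrow> real) \<Rightarrow> real" where
  "sup_form I a W x = (SUP v\<in>W. lin_form I (a v) x)"

lemma sup_form_le_iff:
  assumes "gauss_family I a W"
  shows "sup_form I a W x \<le> y \<longleftrightarrow> (\<forall>v\<in>W. lin_form I (a v) x \<le> y)"
proof -
  obtain L where L: "\<And>v. v \<in> W \<Longrightarrow> (\<Sum>i\<in>I. (a v i)\<^sup>2) \<le> L" and I: "finite I" and W: "W \<noteq> {}"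
    using assms by (auto simp: gauss_family_def)
  have "bdd_above ((\<lambda>v. lin_form I (a v) x) ` W)"
    using lin_form_bound[OF I L, of _ x] by (intro bdd_aboveI2[of _ _ "sqrt L * sqrt (sqnorm I x)"]) (auto simp: abs_le_iff)
  then show ?thesis unfolding sup_form_def using W by (simp add: cSUP_le_iff)
qed

lemma sup_form_upper: "gauss_family I a W \<Longrightarrow> v \<in> W \<Longrightarrow> lin_form I (a v) x \<le> sup_form I a W x"
  using sup_form_le_iff[of I a W x "sup_form I a W x"] by simp

lemma countable_subfamily:
  obtains D where "countable D" "D \<subseteq> (W :: (nat \<Rightarrow> real) set)" "W \<subseteq> closure D"
  by (metis separable)

text \<open>The set of \<open>v\<close> satisfying the inequality is closed, so it contains \<open>W\<close> as soon as it contains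
  a dense subset.\<close>

lemma gauss_family_countable:
  fixes D :: "(nat \<Rightarrow> real) set"
  assumes fam: "gauss_family I a W" and D: "D \<subseteq> W" "W \<subseteq> closure D"
  shows "(\<forall>v\<in>W. lin_form I (a v) x \<le> y) \<longleftrightarrow> (\<forall>v\<in>D. lin_form I (a v) x \<le> y)"
proof
  assume *: "\<forall>v\<in>D. lin_form I (a v) x \<le> y"
  have "continuous_on UNIV (\<lambda>v. lin_form I (a v) x)"
    unfolding lin_form_def using fam by (intro continuous_intros) (auto simp: gauss_family_def)
  then have "closed {v. lin_form I (a v) x \<le> y}"
    by (intro closed_Collect_le continuous_intros)
  then have "closure D \<subseteq> {v. lin_form I (a v) x \<le> y}"
    using * by (intro closure_minimal) auto
  then show "\<forall>v\<in>W. lin_form I (a v) x \<le> y" using D by auto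
qed (use D in auto)

lemma sup_form_measurable:
  assumes "gauss_family I a W"
  shows "sup_form I a W \<in> borel_measurable (PiM I (\<lambda>_. borel))"
proof -
  obtain D where D: "countable D" "D \<subseteq> W" "W \<subseteq> closure D" by (rule countable_subfamily)
  have "{x \<in> space (PiM I (\<lambda>_. borel)). sup_form I a W x \<le> y} = {x \<in> space (PiM I (\<lambda>_. borel)). \<forall>v\<in>D. lin_form I (a v) x \<le> y}" for y
    using gauss_family_countable[OF assms D(2,3)] sup_form_le_iff[OF assms] by auto
  moreover have "{x \<in> space (PiM I (\<lambda>_. borel)). \<forall>v\<in>D. lin_form I (a v) x \<le> y} \<in> sets (PiM I (\<lambda>_. borel))" for y
    using D(1) by measurable
  ultimately show ?thesis by (simp add: borel_measurable_iff_le)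
qed

lemma sup_form_dominance:
  assumes a: "gauss_family I a W" and b: "gauss_family J b W"
    and var: "\<And>s. s \<in> W \<Longrightarrow> (\<Sum>i\<in>I. (a s i)\<^sup>2) = (\<Sum>j\<in>J. (b s j)\<^sup>2)"
    and cov: "\<And>s t. s \<in> W \<Longrightarrow> t \<in> W \<Longrightarrow> (\<Sum>j\<in>J. b s j * b t j) \<le> (\<Sum>i\<in>I. a s i * a t i)"
    and r: "0 \<le> r"
  shows "(\<integral>x. std_normal_cdf (c + r * sup_form I a W x) \<partial>gauss I) \<le> (\<integral>x. std_normal_cdf (c + r * sup_form J b W x) \<partial>gauss J)"
proof (rule stochastic_dominance[OF prob_space_gauss _ prob_space_gauss _ r])
  show "sup_form I a W \<in> borel_measurable (gauss I)" "sup_form J b W \<in> borel_measurable (gauss J)"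
    using sup_form_measurable[OF a] sup_form_measurable[OF b] by simp_all
  fix s
  obtain D where D: "countable D" "D \<subseteq> W" "W \<subseteq> closure D" by (rule countable_subfamily)
  have I: "finite I" and J: "finite J" using a b by (auto simp: gauss_family_def)
  have "measure (gauss J) {\<eta> \<in> space (gauss J). \<forall>v\<in>D. lin_form J (b v) \<eta> \<le> s} \<le> measure (gauss I) {\<xi> \<in> space (gauss I). \<forall>v\<in>D. lin_form I (a v) \<xi> \<le> s}"
    using D(2) by (intro slepian[OF I J D(1)] var cov) auto
  then show "measure (gauss J) {x \<in> space (gauss J). sup_form J b W x \<le> s} \<le> measure (gauss I) {x \<in> space (gauss I). sup_form I a W x \<le> s}"
    by (simp only: sup_form_le_iff[OF a] sup_form_le_iff[OF b] gauss_family_countable[OF a D(2,3)] gauss_family_countable[OF b D(2,3)])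
qed

section \<open>Upper bound for the edge of the spectrum\<close>

definition upper_pairs :: "nat \<Rightarrow> (nat \<times> nat) set" where
  "upper_pairs n = {(i, j). i \<le> j \<and> j < n}"

lemma upper_pairs_Suc: "upper_pairs (Suc n) = upper_pairs n \<union> (\<lambda>i. (i, n)) ` {..n}"
  by (auto simp: upper_pairs_def less_Suc_eq)

lemma upper_pairs_0 [simp]: "upper_pairs 0 = {}" by (auto simp: upper_pairs_def)

lemma finite_upper_pairs [simp]: "finite (upper_pairs n)"
  by (induction n) (auto simp: upper_pairs_Suc)

lemma sum_upper_pairs_Suc:
  "(\<Sum>p\<in>upper_pairs (Suc n). f p) = (\<Sum>p\<in>upper_pairs n. f p) + (\<Sum>i\<le>n. f (i, n))"
proof -
  have "upper_pairs n \<inter> (\<lambda>i. (i, n)) ` {..n} = {}" by (auto simp: upper_pairs_def)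
  then have "(\<Sum>p\<in>upper_pairs (Suc n). f p) = (\<Sum>p\<in>upper_pairs n. f p) + (\<Sum>p\<in>(\<lambda>i. (i, n)) ` {..n}. f p)"
    unfolding upper_pairs_Suc by (intro sum.union_disjoint) auto
  then show ?thesis by (subst (asm) sum.reindex) (auto simp: inj_on_def)
qed

text \<open>The law \<open>GOE\<close> is given by the entries on and above the diagonal, so that quadratic forms are
  needed as sums over these positions.\<close>

lemma sum_symmetric_upper_pairs:
  fixes f :: "nat \<Rightarrow> nat \<Rightarrow> real"
  assumes "\<And>i j. f i j = f j i"
  shows "(\<Sum>i<n. \<Sum>j<n. f i j) = (\<Sum>(i, j)\<in>upper_pairs n. if i = j then f i j else 2 * f i j)"
proof (induction n)
  case (Suc n)
  have "(\<Sum>i<Suc n. \<Sum>j<Suc n. f i j) = (\<Sum>i<n. \<Sum>j<n. f i j) + 2 * (\<Sum>i<n. f i n) + f n n"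
    using assms by (simp add: sum.distrib)
  moreover have "(\<Sum>i\<le>n. if i = n then f i n else 2 * f i n) = 2 * (\<Sum>i<n. f i n) + f n n"
    by (simp add: lessThan_Suc_atMost[symmetric] sum_distrib_left)
  ultimately show ?case using Suc by (simp add: sum_upper_pairs_Suc)
qed simp

text \<open>The coefficients of the quadratic form \<open>v \<mapsto> \<langle>v, Q v\<rangle>\<close> of a GOE matrix \<open>Q\<close> with respect to
  independent standard normal variables: an off-diagonal entry has standard deviation
  \<open>sqrt (1 / 2)\<close> and occurs twice, which gives the factor \<open>sqrt 2\<close>.\<close>

definition qcoef :: "(nat \<Rightarrow> real) \<Rightarrow> nat \<times> nat \<Rightarrow> real" where
  "qcoef v = (\<lambda>(i, j). if i = j then v i * v j else sqrt 2 * (v i * v j))"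

definition dot :: "nat \<Rightarrow> (nat \<Rightarrow> real) \<Rightarrow> (nat \<Rightarrow> real) \<Rightarrow> real" where
  "dot n u v = (\<Sum>i<n. u i * v i)"

text \<open>The covariance of the quadratic form at \<open>u\<close> and \<open>v\<close>. It depends on the inner product only,
  which expresses the orthogonal invariance of the GOE.\<close>

lemma qcoef_gram: "(\<Sum>p\<in>upper_pairs n. qcoef u p * qcoef v p) = (dot n u v)\<^sup>2"
proof -
  have "(dot n u v)\<^sup>2 = (\<Sum>i<n. \<Sum>j<n. (u i * v i) * (u j * v j))"
    unfolding dot_def power2_eq_square sum_product ..
  also have "\<dots> = (\<Sum>(i, j)\<in>upper_pairs n. if i = j then (u i * v i) * (u j * v j) else 2 * ((u i * v i) * (u j * v j)))"
    by (rule sum_symmetric_upper_pairs) simp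
  also have "\<dots> = (\<Sum>p\<in>upper_pairs n. qcoef u p * qcoef v p)"
    by (intro sum.cong refl) (auto simp: qcoef_def)
  finally show ?thesis ..
qed

lemma qcoef_gram_diag: "(\<Sum>p\<in>upper_pairs n. (qcoef v p)\<^sup>2) = (dot n v v)\<^sup>2"
  using qcoef_gram[of v v n] by (simp add: power2_eq_square)

lemma continuous_qcoef [continuous_intros]:
  "(\<And>i. continuous_on A (\<lambda>v. f v i)) \<Longrightarrow> continuous_on A (\<lambda>v. qcoef (f v) p)"
  by (cases p; cases "fst p = snd p") (auto simp: qcoef_def intro!: continuous_intros)

definition sphere_vecs :: "nat \<Rightarrow> (nat \<Rightarrow> real) set" where
  "sphere_vecs n = {v. dot n v v = 1}"

lemma dot_Cauchy_Schwarz: "\<bar>dot n u v\<bar> \<le> sqrt (dot n u u) * sqrt (dot n v v)"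
proof -
  have "\<bar>dot n u v\<bar> \<le> (\<Sum>i<n. \<bar>u i\<bar> * \<bar>v i\<bar>)"
    unfolding dot_def abs_mult[symmetric] by (rule sum_abs)
  also have "\<dots> \<le> L2_set u {..<n} * L2_set v {..<n}" by (rule L2_set_mult_ineq)
  finally show ?thesis by (simp add: L2_set_def dot_def power2_eq_square)
qed

lemma sphere_vecs_nonempty: "1 \<le> n \<Longrightarrow> sphere_vecs n \<noteq> {}"
proof -
  assume n: "1 \<le> n"
  have "dot n (\<lambda>i. if i = 0 then 1 else 0) (\<lambda>i. if i = 0 then 1 else 0) = 1"
    using n by (simp add: dot_def if_distrib cong: if_cong)
  then show ?thesis by (auto simp: sphere_vecs_def)
qed

text \<open>Minus the smallest eigenvalue of the matrix with coordinates \<open>\<xi>\<close>, as a supremum, because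
  the comparison inequalities concern suprema.\<close>

definition neg_min_form :: "nat \<Rightarrow> (nat \<times> nat \<Rightarrow> real) \<Rightarrow> real" where
  "neg_min_form n = sup_form (upper_pairs n) (\<lambda>v p. - qcoef v p) (sphere_vecs n)"

lemma gauss_family_neg: "1 \<le> n \<Longrightarrow> gauss_family (upper_pairs n) (\<lambda>v p. - qcoef v p) (sphere_vecs n)"
  unfolding gauss_family_def
  using sphere_vecs_nonempty
  by (auto intro!: continuous_intros exI[of _ 1] continuous_on_product_coordinates simp: qcoef_gram_diag sphere_vecs_def)

lemma gauss_integral_insert:
  assumes I: "finite I" "i \<notin> I" and f: "integrable (gauss (insert i I)) (f :: _ \<Rightarrow> real)"
  shows "(\<integral>x. f x \<partial>gauss (insert i I)) = (\<integral>x. \<integral>z. f (x(i := z)) \<partial>normal_law \<partial>gauss I)"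
  unfolding gauss_def
  by (rule normal_laws.product_integral_insert[OF I]) (use f in \<open>simp add: gauss_def\<close>)

text \<open>The process \<open>- \<langle>v, Q v\<rangle> + z\<close> on the unit sphere, with an independent standard normal \<open>z\<close>, is compared
  with \<open>sqrt 2 * \<langle>v, g\<rangle>\<close> for a Gaussian vector \<open>g\<close>. Both have variance 2, and the covariances satisfy
  \<open>\<langle>u, v\<rangle>\<^sup>2 + 1 \<ge> 2 * \<langle>u, v\<rangle>\<close>. The supremum of the second process is \<open>sqrt 2\<close> times the norm of \<open>g\<close>, whose
  mean is at most \<open>sqrt (2 * n)\<close>. The variable \<open>z\<close> and the fluctuations of the norm are of order 1
  and contribute \<open>O(r\<^sup>2)\<close> only.\<close>

theorem neg_min_form_upper:
  assumes n: "1 \<le> n" and r: "0 \<le> r"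
  shows "(\<integral>\<xi>. std_normal_cdf (r * neg_min_form n \<xi>) \<partial>gauss (upper_pairs n)) \<le> std_normal_cdf (r * sqrt (2 * real n)) + 5 * r\<^sup>2"
proof -
  let ?U = "upper_pairs n" and ?W = "sphere_vecs n" and ?e = "(n, n)" and ?T = "neg_min_form n"
  let ?I = "insert ?e ?U" and ?J = "{..<n}"
  interpret GU: prob_space "gauss ?U" by (rule prob_space_gauss)
  interpret GI: prob_space "gauss ?I" by (rule prob_space_gauss)
  interpret GJ: prob_space "gauss ?J" by (rule prob_space_gauss)
  have e: "?e \<notin> ?U" by (auto simp: upper_pairs_def)
  define a where "a = (\<lambda>v p. if p = ?e then 1 else - qcoef v p)"
  define b where "b = (\<lambda>(v :: nat \<Rightarrow> real) j. sqrt 2 * v j)"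
  have gram_a: "(\<Sum>p\<in>?I. a u p * a v p) = 1 + (dot n u v)\<^sup>2" for u v
  proof -
    have "(\<Sum>p\<in>?U. a u p * a v p) = (\<Sum>p\<in>?U. qcoef u p * qcoef v p)"
      using e by (intro sum.cong) (auto simp: a_def)
    then show ?thesis using e by (simp add: qcoef_gram a_def)
  qed
  have gram_b: "(\<Sum>j\<in>?J. b u j * b v j) = 2 * dot n u v" for u v
    by (simp add: b_def dot_def sum_distrib_left mult_ac)
  have var_a: "(\<Sum>p\<in>?I. (a v p)\<^sup>2) = 2" and var_b: "(\<Sum>j\<in>?J. (b v j)\<^sup>2) = 2" if "v \<in> ?W" for v
    using gram_a[of v v] gram_b[of v v] that by (simp_all add: power2_eq_square sphere_vecs_def)
  have fam_a: "gauss_family ?I a ?W"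
    unfolding gauss_family_def
  proof (intro conjI ballI exI[of _ 2])
    show "continuous_on UNIV (\<lambda>v. a v p)" for p
      by (cases "p = ?e") (auto simp: a_def intro!: continuous_intros continuous_on_product_coordinates)
  qed (use sphere_vecs_nonempty[OF n] var_a in auto)
  have fam_b: "gauss_family ?J b ?W"
    unfolding gauss_family_def using sphere_vecs_nonempty[OF n] var_b
    by (auto intro!: continuous_intros exI[of _ 2] continuous_on_product_coordinates simp: b_def)
  have dom: "(\<integral>x. std_normal_cdf (0 + r * sup_form ?I a ?W x) \<partial>gauss ?I) \<le> (\<integral>x. std_normal_cdf (0 + r * sup_form ?J b ?W x) \<partial>gauss ?J)"
  proof (rule sup_form_dominance[OF fam_a fam_b _ _ r])
    fix u v assume uv: "u \<in> ?W" "v \<in> ?W"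
    show "(\<Sum>j\<in>?J. b u j * b v j) \<le> (\<Sum>p\<in>?I. a u p * a v p)"
      unfolding gram_a gram_b using zero_le_power2[of "1 - dot n u v"] by (simp add: power2_diff)
  qed (simp add: var_a var_b)
  have Tm: "?T \<in> borel_measurable (gauss ?U)"
    unfolding neg_min_form_def using sup_form_measurable[OF gauss_family_neg[OF n]] by simp
  \<comment> \<open>The position \<open>(n, n)\<close> lies outside \<open>upper_pairs n\<close> and serves as the index of the additional variable \<open>z\<close>.\<close>
  have supa: "sup_form ?I a ?W (x(?e := z)) = ?T x + z" for x z
  proof -
    have "lin_form ?I (a v) (x(?e := z)) = lin_form ?U (\<lambda>p. - qcoef v p) x + z" for v
      unfolding lin_form_def using e by (auto simp: a_def intro!: sum.cong)
    then have "sup_form ?I a ?W (x(?e := z)) \<le> y \<longleftrightarrow> ?T x \<le> y - z" for y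
      unfolding neg_min_form_def sup_form_le_iff[OF fam_a] sup_form_le_iff[OF gauss_family_neg[OF n]]
      by (auto simp: algebra_simps)
    from this[of "?T x + z"] this[of "sup_form ?I a ?W (x(?e := z))"] show ?thesis by auto
  qed
  have int: "integrable (gauss ?I) (\<lambda>x. std_normal_cdf (r * sup_form ?I a ?W x))"
    using sup_form_measurable[OF fam_a] by (intro integrable_std_normal_cdf prob_space_gauss) simp
  have step: "std_normal_cdf (r * ?T x) - r\<^sup>2 \<le> (\<integral>z. std_normal_cdf (r * (?T x + z)) \<partial>normal_law)" for x
  proof -
    let ?t = "r * ?T x"
    have "(\<integral>z. std_normal_cdf ?t + std_normal_density ?t * (r * z) - r\<^sup>2 * z\<^sup>2 \<partial>normal_law) \<le> (\<integral>z. std_normal_cdf (r * (?T x + z)) \<partial>normal_law)"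
    proof (rule integral_mono)
      show "integrable normal_law (\<lambda>z. std_normal_cdf ?t + std_normal_density ?t * (r * z) - r\<^sup>2 * z\<^sup>2)"
        using normal_law_moments(1)[of 1] normal_law_moments(1)[of 2] by auto
      show "integrable normal_law (\<lambda>z. std_normal_cdf (r * (?T x + z)))"
        by (rule integrable_std_normal_cdf[OF prob_space_normal_law]) simp
      fix z
      show "std_normal_cdf ?t + std_normal_density ?t * (r * z) - r\<^sup>2 * z\<^sup>2 \<le> std_normal_cdf (r * (?T x + z))"
        using std_normal_cdf_taylor[of "r * (?T x + z)" ?t] by (simp add: abs_le_iff algebra_simps power_mult_distrib)
    qed
    also have "(\<integral>z. std_normal_cdf ?t + std_normal_density ?t * (r * z) - r\<^sup>2 * z\<^sup>2 \<partial>normal_law) = std_normal_cdf ?t - r\<^sup>2"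
      using normal_law_moments(1)[of 1] normal_law_moments(1)[of 2] normal_law_moments(2,3) normal_law.prob_space by simp
    finally show ?thesis .
  qed
  have intT: "integrable (gauss ?U) (\<lambda>x. std_normal_cdf (r * ?T x))"
    using Tm by (intro integrable_std_normal_cdf prob_space_gauss) simp
  have intz: "integrable (gauss ?U) (\<lambda>x. \<integral>z. std_normal_cdf (r * (?T x + z)) \<partial>normal_law)"
  proof (rule GU.integrable_const_bound[of _ 1])
    have "(\<lambda>(x, z). std_normal_cdf (r * (?T x + z))) \<in> borel_measurable (gauss ?U \<Otimes>\<^sub>M normal_law)"
      using Tm by measurable
    then show "(\<lambda>x. \<integral>z. std_normal_cdf (r * (?T x + z)) \<partial>normal_law) \<in> borel_measurable (gauss ?U)"
      by (rule normal_law.borel_measurable_lebesgue_integral)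
    have "\<bar>\<integral>z. std_normal_cdf (r * (?T x + z)) \<partial>normal_law\<bar> \<le> 1" for x
    proof -
      have i: "integrable normal_law (\<lambda>z. std_normal_cdf (r * (?T x + z)))"
        by (rule integrable_std_normal_cdf[OF prob_space_normal_law]) simp
      have "(\<integral>z. std_normal_cdf (r * (?T x + z)) \<partial>normal_law) \<le> 1"
        by (rule normal_law.integral_le_const[OF i]) (simp add: std_normal_cdf_bounds)
      moreover have "0 \<le> (\<integral>z. std_normal_cdf (r * (?T x + z)) \<partial>normal_law)"
        by (rule Bochner_Integration.integral_nonneg) (simp add: std_normal_cdf_bounds)
      ultimately show ?thesis by simp
    qed
    then show "AE x in gauss ?U. norm (\<integral>z. std_normal_cdf (r * (?T x + z)) \<partial>normal_law) \<le> 1" by simp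
  qed
  have "(\<integral>x. std_normal_cdf (r * ?T x) \<partial>gauss ?U) - r\<^sup>2 = (\<integral>x. std_normal_cdf (r * ?T x) - r\<^sup>2 \<partial>gauss ?U)"
    using intT GU.prob_space by simp
  also have "\<dots> \<le> (\<integral>x. \<integral>z. std_normal_cdf (r * (?T x + z)) \<partial>normal_law \<partial>gauss ?U)"
    using intT intz step by (intro integral_mono) auto
  also have "\<dots> = (\<integral>x. std_normal_cdf (r * sup_form ?I a ?W x) \<partial>gauss ?I)"
    by (subst gauss_integral_insert[OF _ e int]) (simp_all add: supa)
  also have "\<dots> \<le> (\<integral>x. std_normal_cdf (r * sup_form ?J b ?W x) \<partial>gauss ?J)"
    using dom by simp
  also have "\<dots> \<le> (\<integral>x. std_normal_cdf (r * sqrt (2 * real n)) + std_normal_density (r * sqrt (2 * real n)) * (r * sqrt 2) * (sqrt (sqnorm ?J x) - sqrt n)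
       + 2 * r\<^sup>2 * (sqrt (sqnorm ?J x) - sqrt n)\<^sup>2 \<partial>gauss ?J)" (is "_ \<le> (\<integral>x. ?R x \<partial>gauss ?J)")
  proof (rule integral_mono)
    show "integrable (gauss ?J) (\<lambda>x. std_normal_cdf (r * sup_form ?J b ?W x))"
      using sup_form_measurable[OF fam_b] by (intro integrable_std_normal_cdf prob_space_gauss) simp
    have J: "?J \<noteq> {}" using n by (simp add: lessThan_empty_iff)
    show "integrable (gauss ?J) ?R"
      using gauss_norm_mean(1)[OF _ order_refl J] gauss_norm_variance(1)[OF _ order_refl J] by auto
    fix x
    let ?y = "sqrt (sqnorm ?J x)"
    have "sup_form ?J b ?W x \<le> sqrt 2 * ?y"
      unfolding sup_form_le_iff[OF fam_b]
    proof
      fix v assume "v \<in> ?W"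
      then have "lin_form ?J (b v) x \<le> sqrt 2 * sqrt (sqnorm ?J x)"
        using lin_form_bound[of ?J "b v" 2 x] var_b[of v] by (simp add: abs_le_iff)
      then show "lin_form ?J (b v) x \<le> sqrt 2 * ?y" .
    qed
    then have "std_normal_cdf (r * sup_form ?J b ?W x) \<le> std_normal_cdf (r * (sqrt 2 * ?y))"
      using r by (intro std_normal_cdf_mono mult_left_mono)
    also have "\<dots> \<le> ?R x"
    proof -
      let ?h = "?y - sqrt n"
      have "r * (sqrt 2 * ?y) - r * sqrt (2 * real n) = r * sqrt 2 * ?h"
        by (simp add: real_sqrt_mult algebra_simps)
      moreover have "(r * sqrt 2 * ?h)\<^sup>2 = 2 * r\<^sup>2 * ?h\<^sup>2" by (simp add: power_mult_distrib)
      ultimately show ?thesis using std_normal_cdf_taylor[of "r * (sqrt 2 * ?y)" "r * sqrt (2 * real n)"]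
        by (simp add: abs_le_iff mult.assoc)
    qed
    finally show "std_normal_cdf (r * sup_form ?J b ?W x) \<le> ?R x" .
  qed
  also have "\<dots> = std_normal_cdf (r * sqrt (2 * real n)) + std_normal_density (r * sqrt (2 * real n)) * (r * sqrt 2) * ((\<integral>x. sqrt (sqnorm ?J x) \<partial>gauss ?J) - sqrt n)
       + 2 * r\<^sup>2 * (\<integral>x. (sqrt (sqnorm ?J x) - sqrt n)\<^sup>2 \<partial>gauss ?J)"
  proof -
    have J: "?J \<noteq> {}" using n by (simp add: lessThan_empty_iff)
    show ?thesis
      using gauss_norm_mean(1)[OF _ order_refl J] gauss_norm_variance(1)[OF _ order_refl J] GJ.prob_space by simp
  qed
  also have "\<dots> \<le> std_normal_cdf (r * sqrt (2 * real n)) + 0 + 2 * r\<^sup>2 * 2"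
  proof (intro add_mono mult_left_mono order_refl mult_nonneg_nonpos)
    have J: "?J \<noteq> {}" using n by (simp add: lessThan_empty_iff)
    show "(\<integral>x. sqrt (sqnorm ?J x) \<partial>gauss ?J) - sqrt n \<le> 0"
      using gauss_norm_mean(3)[OF _ order_refl J] by simp
    show "(\<integral>x. (sqrt (sqnorm ?J x) - sqrt n)\<^sup>2 \<partial>gauss ?J) \<le> 2"
      using gauss_norm_variance(2)[OF _ order_refl J] by simp
  qed (use r in auto)
  finally show ?thesis by simp
qed

section \<open>Tridiagonalization along one test vector\<close>

lemma dot_diff_left: "dot n (\<lambda>i. x i - y i) z = dot n x z - dot n y z"
  by (simp add: dot_def algebra_simps sum_subtractf)
lemma dot_scale_left: "dot n (\<lambda>i. c * x i) z = c * dot n x z"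
  by (simp add: dot_def algebra_simps sum_distrib_left)
lemma dot_commute: "dot n x y = dot n y x"
  by (simp add: dot_def mult.commute)

lemma dot_nonneg: "0 \<le> dot n x x" by (simp add: dot_def sum_nonneg)

text \<open>The reflection that exchanges \<open>u\<close> and the last unit vector \<open>e\<close>. If \<open>u = e\<close>, then \<open>h = 0\<close> and the
  coefficient \<open>c = 2 / 0 = 0\<close> gives the identity.\<close>

lemma householder:
  assumes u: "dot (Suc n) u u = 1"
  shows "\<exists>H. (\<forall>x y. dot (Suc n) (H x) (H y) = dot (Suc n) x y) \<and> (\<forall>x. dot (Suc n) (H x) u = x n)
    \<and> (\<forall>i. continuous_on UNIV (\<lambda>x. H x i))"
proof -
  define e where "e = (\<lambda>i. if i = n then 1 else 0 :: real)"
  define h where "h = (\<lambda>i. e i - u i)"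
  let ?d = "dot (Suc n)"
  define c where "c = 2 / ?d h h"
  define H where "H = (\<lambda>x i. x i - (c * ?d h x) * h i)"
  have xe: "?d x e = x n" for x by (simp add: dot_def e_def if_distrib cong: if_cong)
  have c: "c = 0 \<or> c * ?d h h = 2" by (auto simp: c_def)
  have Hd: "?d (H x) y = ?d x y - c * ?d h x * ?d h y" for x y
    unfolding H_def dot_diff_left dot_scale_left ..
  have 1: "?d (H x) (H y) = ?d x y" for x y
  proof -
    have "?d (H x) (H y) = ?d x (H y) - c * ?d h x * ?d h (H y)" by (rule Hd)
    also have "?d x (H y) = ?d x y - c * ?d h y * ?d h x"
      using Hd[of y x] by (simp add: dot_commute)
    also have "?d h (H y) = ?d h y - c * ?d h y * ?d h h"
      using Hd[of y h] by (simp add: dot_commute)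
    finally have "?d (H x) (H y) = ?d x y + c * (?d h x * ?d h y) * (c * ?d h h - 2)"
      by (simp add: algebra_simps)
    then show ?thesis using c by auto
  qed
  have 2: "?d (H x) u = x n" for x
  proof -
    have hu: "?d h u = ?d u e - 1" unfolding h_def dot_diff_left using u by (simp add: dot_commute)
    have hh: "?d h h = - 2 * ?d h u"
    proof -
      have "?d h h = ?d e h - ?d u h" unfolding h_def dot_diff_left ..
      also have "?d e h = ?d h e" by (rule dot_commute)
      also have "?d h e = ?d e e - ?d u e" unfolding h_def dot_diff_left ..
      also have "?d e e = 1" unfolding xe by (simp add: e_def)
      finally show ?thesis using hu by (simp add: dot_commute)
    qed
    have hx: "?d h x = x n - ?d x u" unfolding h_def dot_diff_left using xe[of x] by (simp add: dot_commute)
    show ?thesis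
    proof (cases "?d h h = 0")
      case True
      then have "\<bar>?d h x\<bar> \<le> 0" using dot_Cauchy_Schwarz[of "Suc n" h x] by simp
      then show ?thesis using hx True by (simp add: Hd c_def)
    next
      case False
      then have "c * ?d h u = -1" using hh by (simp add: c_def)
      then show ?thesis unfolding Hd using hx by (metis (no_types, lifting) add_diff_cancel_left' mult.commute mult.left_commute mult_minus1_right diff_add_cancel diff_minus_eq_add)
    qed
  qed
  have 3: "continuous_on UNIV (\<lambda>x. H x i)" for i
    unfolding H_def dot_def by (intro continuous_intros continuous_on_product_coordinates)
  show ?thesis using 1 2 3 by blast
qed

definition slice :: "nat \<Rightarrow> real \<Rightarrow> real \<Rightarrow> (nat \<Rightarrow> real) set" where
  "slice n v \<rho> = {w. dot (Suc n) w w = \<rho> \<and> w n = v}"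

definition slice_sup :: "nat \<Rightarrow> real \<Rightarrow> real \<Rightarrow> (nat \<times> nat \<Rightarrow> real) \<Rightarrow> real" where
  "slice_sup n v \<rho> = sup_form (upper_pairs (Suc n)) qcoef (slice n v \<rho>)"

lemma gauss_family_isometry:
  assumes "slice n v \<rho> \<noteq> {}" and H: "\<And>x y. dot (Suc n) (H x) (H y) = dot (Suc n) x y" "\<And>i. continuous_on UNIV (\<lambda>x. H x i)"
  shows "gauss_family (upper_pairs (Suc n)) (\<lambda>w. qcoef (H w)) (slice n v \<rho>)"
  unfolding gauss_family_def using assms
  by (auto intro!: continuous_intros exI[of _ "\<rho>\<^sup>2"] simp: qcoef_gram_diag slice_def)

lemma gauss_family_slice: "slice n v \<rho> \<noteq> {} \<Longrightarrow> gauss_family (upper_pairs (Suc n)) qcoef (slice n v \<rho>)"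
  using gauss_family_isometry[of n v \<rho> "\<lambda>x. x"] by (simp add: continuous_on_product_coordinates)

lemma slice_nonempty_0: "slice n v (v\<^sup>2) \<noteq> {}"
proof -
  have "(\<lambda>i. if i = n then v else 0) \<in> slice n v (v\<^sup>2)"
    by (simp add: slice_def dot_def power2_eq_square if_distrib cong: if_cong)
  then show ?thesis by auto
qed

lemma slice_nonempty:
  assumes "v\<^sup>2 \<le> \<rho>" shows "slice (Suc n) v \<rho> \<noteq> {}"
proof -
  define w where "w = (\<lambda>i. if i = Suc n then v else if i = n then sqrt (\<rho> - v\<^sup>2) else 0)"
  have "(\<Sum>i<n. w i * w i) = 0" by (intro sum.neutral) (auto simp: w_def)
  moreover have "w n * w n = \<rho> - v\<^sup>2" "w (Suc n) = v" using assms by (auto simp: w_def)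
  ultimately have "w \<in> slice (Suc n) v \<rho>"
    by (simp add: slice_def dot_def power2_eq_square)
  then show ?thesis by auto
qed

lemma gauss_integral_union:
  fixes f :: "('i \<Rightarrow> real) \<Rightarrow> real"
  assumes I: "finite I" "finite J" "I \<inter> J = {}"
    and f: "f \<in> borel_measurable (PiM (I \<union> J) (\<lambda>_. borel))" "\<And>x. \<bar>f x\<bar> \<le> 1"
  shows "(\<integral>x. f x \<partial>gauss (I \<union> J)) = (\<integral>y. \<integral>x. f (merge I J (y, x)) \<partial>gauss J \<partial>gauss I)"
    and "integrable (gauss I) (\<lambda>y. \<integral>x. f (merge I J (y, x)) \<partial>gauss J)"
    and "integrable (gauss J) (\<lambda>x. f (merge I J (y, x)))"
proof -
  interpret U: prob_space "gauss (I \<union> J)" by (rule prob_space_gauss)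
  interpret GI: prob_space "gauss I" by (rule prob_space_gauss)
  interpret GJ: prob_space "gauss J" by (rule prob_space_gauss)
  have int: "integrable (gauss (I \<union> J)) f"
    using f by (intro U.integrable_const_bound[of _ 1]) auto
  show "(\<integral>x. f x \<partial>gauss (I \<union> J)) = (\<integral>y. \<integral>x. f (merge I J (y, x)) \<partial>gauss J \<partial>gauss I)"
    unfolding gauss_def by (rule normal_laws.product_integral_fold) (use I int in \<open>auto simp: gauss_def\<close>)
  have m: "(\<lambda>z. f (merge I J z)) \<in> borel_measurable (gauss I \<Otimes>\<^sub>M gauss J)"
    using measurable_compose[OF measurable_merge f(1)] by (simp cong: measurable_cong_sets)
  then have m': "(\<lambda>(y, x). f (merge I J (y, x))) \<in> borel_measurable (gauss I \<Otimes>\<^sub>M gauss J)"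
    by (simp add: split_def)
  have mJ: "(\<lambda>x. f (merge I J (y, x))) \<in> borel_measurable (gauss J)" for y
  proof (cases "y \<in> space (gauss I)")
    case True
    then show ?thesis using measurable_Pair2[OF m] by simp
  next
    case False
    have "f (merge I J (y, x)) = f (merge I J (restrict y I, x))" for x by simp
    moreover have "restrict y I \<in> space (gauss I)" by simp
    ultimately show ?thesis using measurable_Pair2[OF m, of "restrict y I"] by simp
  qed
  show iJ: "integrable (gauss J) (\<lambda>x. f (merge I J (y, x)))" for y
    using mJ f(2) by (intro GJ.integrable_const_bound[of _ 1]) auto
  have "\<bar>\<integral>x. f (merge I J (y, x)) \<partial>gauss J\<bar> \<le> 1" for y
  proof -
    have "\<bar>\<integral>x. f (merge I J (y, x)) \<partial>gauss J\<bar> \<le> (\<integral>x. \<bar>f (merge I J (y, x))\<bar> \<partial>gauss J)" by (rule integral_abs_bound)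
    also have "\<dots> \<le> 1" using iJ f(2) by (intro GJ.integral_le_const) auto
    finally show ?thesis .
  qed
  then show "integrable (gauss I) (\<lambda>y. \<integral>x. f (merge I J (y, x)) \<partial>gauss J)"
    using GJ.borel_measurable_lebesgue_integral[OF m'] by (intro GI.integrable_const_bound[of _ 1]) auto
qed

abbreviation last_col :: "nat \<Rightarrow> (nat \<times> nat) set" where "last_col n \<equiv> (\<lambda>i. (i, n)) ` {..n}"
abbreviation last_col0 :: "nat \<Rightarrow> (nat \<times> nat) set" where "last_col0 n \<equiv> (\<lambda>i. (i, n)) ` {..<n}"

text \<open>One step of the tridiagonalization. The last column of the matrix consists of the diagonal entry
  and of a vector \<open>b\<close>. The test vector is \<open>v0\<close> in the last coordinate, completed by \<open>H w\<close>, where the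
  reflection \<open>H\<close> maps the last unit vector of the smaller space to the direction of \<open>b\<close>. Then the inner
  product of \<open>b\<close> with \<open>H w\<close> is \<open>v1\<close> times the norm of \<open>b\<close>, for every \<open>w\<close> with last coordinate
  \<open>v1\<close>. For \<open>b = 0\<close> any direction serves.\<close>

lemma slice_sup_split:
  assumes \<rho>: "\<rho> = v0\<^sup>2 + \<rho>'" and ne: "slice n v1 \<rho>' \<noteq> {}"
  shows "\<exists>H. (\<forall>x y. dot (Suc n) (H x) (H y) = dot (Suc n) x y) \<and> (\<forall>i. continuous_on UNIV (\<lambda>x. H x i)) \<and>
    (\<forall>x. v0\<^sup>2 * y (Suc n, Suc n) + sqrt 2 * v0 * v1 * sqrt (sqnorm (last_col0 (Suc n)) y)
        + sup_form (upper_pairs (Suc n)) (\<lambda>w. qcoef (H w)) (slice n v1 \<rho>') x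
      \<le> slice_sup (Suc n) v0 \<rho> (merge (last_col (Suc n)) (upper_pairs (Suc n)) (y, x)))"
proof -
  let ?N = "Suc n"
  define b where "b = (\<lambda>i. y (i, ?N))"
  define q where "q = sqrt (sqnorm (last_col0 ?N) y)"
  have q2: "q\<^sup>2 = dot ?N b b"
    unfolding q_def sqnorm_def dot_def b_def
    by (subst sum.reindex) (auto simp: inj_on_def power2_eq_square sum_nonneg)
  have q0: "0 \<le> q" by (simp add: q_def)
  define u where "u = (if q = 0 then (\<lambda>i. if i = n then 1 else 0) else (\<lambda>i. (1 / q) * b i))"
  have uu: "dot ?N u u = 1"
  proof (cases "q = 0")
    case True then show ?thesis by (simp add: u_def dot_def if_distrib cong: if_cong)
  next
    case False
    then have u: "u = (\<lambda>i. (1 / q) * b i)" by (simp add: u_def)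
    have "dot ?N u u = (1 / q) * dot ?N b u" by (subst (1) u) (rule dot_scale_left)
    also have "dot ?N b u = dot ?N u b" by (rule dot_commute)
    also have "dot ?N u b = (1 / q) * q\<^sup>2" unfolding u q2 by (rule dot_scale_left)
    finally show ?thesis using False by (simp add: power2_eq_square)
  qed
  obtain H where H: "\<And>x y. dot ?N (H x) (H y) = dot ?N x y" "\<And>x. dot ?N (H x) u = x n" "\<And>i. continuous_on UNIV (\<lambda>x. H x i)"
    using householder[OF uu] by auto
  have Hb: "dot ?N (H w) b = q * w n" for w
  proof (cases "q = 0")
    case True
    then have "dot ?N b b = 0" using q2 by simp
    then have "\<bar>dot ?N (H w) b\<bar> \<le> 0" using dot_Cauchy_Schwarz[of ?N "H w" b] by simp
    then show ?thesis using True by simp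
  next
    case False
    then have u: "u = (\<lambda>i. (1 / q) * b i)" by (simp add: u_def)
    have "dot ?N (H w) u = dot ?N u (H w)" by (rule dot_commute)
    also have "\<dots> = (1 / q) * dot ?N b (H w)" unfolding u by (rule dot_scale_left)
    also have "dot ?N b (H w) = dot ?N (H w) b" by (rule dot_commute)
    finally have "dot ?N (H w) u = (1 / q) * dot ?N (H w) b" .
    then show ?thesis using H(2)[of w] False by (simp add: field_simps)
  qed
  have fam: "gauss_family (upper_pairs ?N) (\<lambda>w. qcoef (H w)) (slice n v1 \<rho>')"
    by (rule gauss_family_isometry[OF ne H(1,3)])
  have "v1\<^sup>2 \<le> \<rho>'"
  proof -
    obtain w where "w \<in> slice n v1 \<rho>'" using ne by auto
    then have "\<rho>' = (\<Sum>i<n. w i * w i) + v1\<^sup>2" by (auto simp: slice_def dot_def power2_eq_square)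
    then show ?thesis by (simp add: sum_nonneg)
  qed
  then have "v0\<^sup>2 \<le> \<rho>" using \<rho> zero_le_power2[of v1] by linarith
  then have fam': "gauss_family (upper_pairs (Suc ?N)) qcoef (slice ?N v0 \<rho>)"
    by (intro gauss_family_slice slice_nonempty)
  show ?thesis
  proof (intro exI[of _ H] conjI allI H(1,3))
    fix x
    let ?m = "merge (last_col ?N) (upper_pairs ?N) (y, x)"
    have "lin_form (upper_pairs ?N) (qcoef (H w)) x \<le> slice_sup ?N v0 \<rho> ?m - v0\<^sup>2 * y (?N, ?N) - sqrt 2 * v0 * v1 * q"
      if w: "w \<in> slice n v1 \<rho>'" for w
    proof -
      define w' where "w' = (H w)(?N := v0)"
      have "dot ?N w' w' = dot ?N (H w) (H w)" unfolding dot_def by (intro sum.cong) (auto simp: w'_def)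
      moreover have "dot (Suc ?N) w' w' = dot ?N w' w' + w' ?N * w' ?N" unfolding dot_def by (rule sum.lessThan_Suc)
      moreover have "w' ?N = v0" by (simp add: w'_def)
      moreover have "dot ?N (H w) (H w) = \<rho>'" using w unfolding H(1) slice_def by simp
      ultimately have "dot (Suc ?N) w' w' = \<rho>' + v0\<^sup>2" by (simp add: power2_eq_square)
      then have w'W: "w' \<in> slice ?N v0 \<rho>" using \<rho> by (simp add: slice_def w'_def)
      have 1: "(\<Sum>p\<in>upper_pairs ?N. qcoef w' p * ?m p) = lin_form (upper_pairs ?N) (qcoef (H w)) x"
        unfolding lin_form_def
      proof (intro sum.cong refl)
        fix p assume p: "p \<in> upper_pairs ?N"
        then have "p \<notin> last_col ?N" by (auto simp: upper_pairs_def)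
        moreover have "qcoef w' p = qcoef (H w) p" using p by (auto simp: upper_pairs_def qcoef_def w'_def)
        ultimately show "qcoef w' p * ?m p = qcoef (H w) p * x p" using p by (simp add: merge_def)
      qed
      have "(\<Sum>i\<le>?N. qcoef w' (i, ?N) * ?m (i, ?N)) = (\<Sum>i\<le>?N. qcoef w' (i, ?N) * y (i, ?N))"
        by (intro sum.cong) (auto simp: merge_def)
      also have "\<dots> = (\<Sum>i<?N. sqrt 2 * v0 * (H w i * b i)) + v0\<^sup>2 * y (?N, ?N)"
      proof -
        have "(\<Sum>i\<le>?N. qcoef w' (i, ?N) * y (i, ?N)) = (\<Sum>i<?N. qcoef w' (i, ?N) * y (i, ?N)) + qcoef w' (?N, ?N) * y (?N, ?N)"
          unfolding lessThan_Suc_atMost[symmetric] by (rule sum.lessThan_Suc)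
        moreover have "(\<Sum>i<?N. qcoef w' (i, ?N) * y (i, ?N)) = (\<Sum>i<?N. sqrt 2 * v0 * (H w i * b i))"
          by (intro sum.cong) (auto simp: qcoef_def w'_def b_def)
        ultimately show ?thesis by (simp add: qcoef_def w'_def power2_eq_square)
      qed
      also have "(\<Sum>i<?N. sqrt 2 * v0 * (H w i * b i)) = sqrt 2 * v0 * (q * v1)"
        using Hb[of w] w by (simp only: sum_distrib_left[symmetric] dot_def[symmetric]) (simp add: slice_def)
      finally have "lin_form (upper_pairs (Suc ?N)) (qcoef w') ?m = lin_form (upper_pairs ?N) (qcoef (H w)) x + sqrt 2 * v0 * (q * v1) + v0\<^sup>2 * y (?N, ?N)"
        unfolding lin_form_def[of "upper_pairs (Suc ?N)"] sum_upper_pairs_Suc[of _ ?N] 1 by simp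
      moreover have "lin_form (upper_pairs (Suc ?N)) (qcoef w') ?m \<le> slice_sup ?N v0 \<rho> ?m"
        unfolding slice_sup_def by (rule sup_form_upper[OF fam' w'W])
      ultimately show ?thesis by (simp add: mult_ac)
    qed
    then have "sup_form (upper_pairs ?N) (\<lambda>w. qcoef (H w)) (slice n v1 \<rho>') x \<le> slice_sup ?N v0 \<rho> ?m - v0\<^sup>2 * y (?N, ?N) - sqrt 2 * v0 * v1 * q"
      unfolding sup_form_le_iff[OF fam] by blast
    then show "v0\<^sup>2 * y (?N, ?N) + sqrt 2 * v0 * v1 * sqrt (sqnorm (last_col0 ?N) y) + sup_form (upper_pairs ?N) (\<lambda>w. qcoef (H w)) (slice n v1 \<rho>') x \<le> slice_sup ?N v0 \<rho> ?m"
      unfolding q_def by linarith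
  qed
qed

text \<open>Expansion to second order at the mean of \<open>A\<close>: the linear term integrates to 0.\<close>

lemma std_normal_cdf_expectation_ge:
  assumes M: "prob_space M" and A: "integrable M A" "integrable M (\<lambda>x. (A x - integral\<^sup>L M A)\<^sup>2)"
    and V: "(\<integral>x. (A x - integral\<^sup>L M A)\<^sup>2 \<partial>M) \<le> V" and mu: "\<mu> \<le> integral\<^sup>L M A" and r: "0 \<le> r"
  shows "std_normal_cdf (c + r * \<mu>) - r\<^sup>2 * V \<le> (\<integral>x. std_normal_cdf (c + r * A x) \<partial>M)"
proof -
  interpret prob_space M by fact
  let ?m = "integral\<^sup>L M A"
  let ?t = "c + r * ?m"
  have Am: "A \<in> borel_measurable M" using A(1) by simp
  have "std_normal_cdf (c + r * \<mu>) - r\<^sup>2 * V \<le> std_normal_cdf ?t - r\<^sup>2 * (\<integral>x. (A x - ?m)\<^sup>2 \<partial>M)"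
    using std_normal_cdf_mono[of "c + r * \<mu>" ?t] mu r V by (intro diff_mono) (auto intro!: mult_left_mono)
  also have "\<dots> = (\<integral>x. std_normal_cdf ?t + std_normal_density ?t * (r * (A x - ?m)) - r\<^sup>2 * (A x - ?m)\<^sup>2 \<partial>M)"
    using A prob_space by simp
  also have "\<dots> \<le> (\<integral>x. std_normal_cdf (c + r * A x) \<partial>M)"
  proof (rule integral_mono)
    show "integrable M (\<lambda>x. std_normal_cdf ?t + std_normal_density ?t * (r * (A x - ?m)) - r\<^sup>2 * (A x - ?m)\<^sup>2)"
      using A by auto
    show "integrable M (\<lambda>x. std_normal_cdf (c + r * A x))"
      by (rule integrable_std_normal_cdf[OF M]) (use Am in measurable)
    fix x
    have "c + r * A x - ?t = r * (A x - ?m)" by (simp add: algebra_simps)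
    then show "std_normal_cdf ?t + std_normal_density ?t * (r * (A x - ?m)) - r\<^sup>2 * (A x - ?m)\<^sup>2 \<le> std_normal_cdf (c + r * A x)"
      using std_normal_cdf_taylor[of "c + r * A x" ?t] by (simp add: abs_le_iff power_mult_distrib)
  qed
  finally show ?thesis .
qed

lemma gauss_column:
  fixes \<alpha> \<beta> :: real
  assumes C: "finite C" "p \<in> C" and J: "J \<subseteq> C" "J \<noteq> {}"
  defines "k \<equiv> real (card J)"
  defines "A \<equiv> \<lambda>y. \<alpha> * y p + \<beta> * sqrt (sqnorm J y)"
  shows "integrable (gauss C) A" "integrable (gauss C) (\<lambda>x. (A x - integral\<^sup>L (gauss C) A)\<^sup>2)"
    "(\<integral>x. (A x - integral\<^sup>L (gauss C) A)\<^sup>2 \<partial>gauss C) \<le> 2 * \<alpha>\<^sup>2 + 4 * \<beta>\<^sup>2"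
    "0 \<le> \<beta> \<Longrightarrow> \<beta> * (sqrt k * (1 - 1 / k)) \<le> integral\<^sup>L (gauss C) A"
proof -
  let ?G = "gauss C" and ?n = "\<lambda>y. sqrt (sqnorm J y)"
  let ?e = "integral\<^sup>L ?G ?n"
  note c = gauss_coordinate(2,3)[OF C] gauss_coordinate(1)[OF C, of 2] and cv = gauss_covariance(2)[OF C(1) C(2) C(2)]
  note nm = gauss_norm_mean[OF C(1) J] and nv = gauss_norm_variance[OF C(1) J]
  show intA: "integrable ?G A" unfolding A_def using c nm by auto
  have EA: "integral\<^sup>L ?G A = \<beta> * ?e" unfolding A_def using c nm by simp
  show "0 \<le> \<beta> \<Longrightarrow> \<beta> * (sqrt k * (1 - 1 / k)) \<le> integral\<^sup>L ?G A"
    unfolding EA k_def by (rule mult_left_mono[OF nm(2)])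
  let ?B = "\<lambda>y. 2 * \<alpha>\<^sup>2 * (y p)\<^sup>2 + 2 * \<beta>\<^sup>2 * (?n y - ?e)\<^sup>2"
  have B: "integrable ?G ?B" using c(3) nv(1) by auto
  have le: "(A y - integral\<^sup>L ?G A)\<^sup>2 \<le> ?B y" for y
  proof -
    have "A y - integral\<^sup>L ?G A = \<alpha> * y p + \<beta> * (?n y - ?e)" unfolding EA by (simp add: A_def algebra_simps)
    moreover have "(s + t)\<^sup>2 \<le> 2 * s\<^sup>2 + 2 * t\<^sup>2" for s t :: real
      using zero_le_power2[of "s - t"] by (simp add: power2_diff power2_sum)
    ultimately show ?thesis by (metis (no_types, lifting) power_mult_distrib mult.assoc)
  qed
  show int2: "integrable ?G (\<lambda>x. (A x - integral\<^sup>L ?G A)\<^sup>2)"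
    by (rule Bochner_Integration.integrable_bound[OF B])
       (use intA le in \<open>auto intro!: AE_I2 intro: order_trans\<close>)
  have "(\<integral>x. (A x - integral\<^sup>L ?G A)\<^sup>2 \<partial>?G) \<le> (\<integral>x. ?B x \<partial>?G)"
    using int2 B le by (intro integral_mono) auto
  also have "\<dots> = 2 * \<alpha>\<^sup>2 * (\<integral>y. (y p)\<^sup>2 \<partial>?G) + 2 * \<beta>\<^sup>2 * (\<integral>y. (?n y - ?e)\<^sup>2 \<partial>?G)"
    using c(3) nv(1) by simp
  also have "\<dots> \<le> 2 * \<alpha>\<^sup>2 * 1 + 2 * \<beta>\<^sup>2 * 2"
    using nv(3) cv by (intro add_mono mult_left_mono) (auto simp: power2_eq_square)
  finally show "(\<integral>x. (A x - integral\<^sup>L ?G A)\<^sup>2 \<partial>?G) \<le> 2 * \<alpha>\<^sup>2 + 4 * \<beta>\<^sup>2" by simp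
qed

text \<open>Induction on the number of nonzero coordinates of the test vector. Given the last column, the
  remaining supremum runs over the images \<open>H w\<close> of a slice; as \<open>H\<close> is an isometry, Slepian's inequality
  replaces it by the supremum over the slice itself, whose law does not depend on the column.
  This is where the induction hypothesis applies, with \<open>c\<close> shifted by the contribution of the
  column; then the column is integrated out. Each step adds \<open>sqrt 2 * v i * v (Suc i)\<close> times the mean of the norm
  of a Gaussian vector, and an error given by the variance of the column term.\<close>

lemma slice_sup_lower:
  assumes r: "0 \<le> r" and n0: "1 \<le> n0" and \<kappa>: "\<And>k. n0 \<le> k \<Longrightarrow> \<kappa> \<le> sqrt (real k) * (1 - 1 / real k)"
  shows "n0 + m \<le> Suc n \<Longrightarrow> (\<And>i. 0 \<le> v i) \<Longrightarrow>
    std_normal_cdf (c + r * (sqrt 2 * \<kappa> * (\<Sum>i<m. v i * v (Suc i))))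
      - r\<^sup>2 * (2 * (\<Sum>i\<le>m. v i ^ 4) + 8 * (\<Sum>i<m. (v i)\<^sup>2 * (v (Suc i))\<^sup>2))
    \<le> (\<integral>\<xi>. std_normal_cdf (c + r * slice_sup n (v 0) (\<Sum>i\<le>m. (v i)\<^sup>2) \<xi>) \<partial>gauss (upper_pairs (Suc n)))"
proof (induction m arbitrary: n v c)
  case 0
  let ?U = "upper_pairs (Suc n)" and ?e = "(n, n)"
  interpret prob_space "gauss ?U" by (rule prob_space_gauss)
  have e: "?e \<in> ?U" by (simp add: upper_pairs_def)
  have fam: "gauss_family ?U qcoef (slice n (v 0) ((v 0)\<^sup>2))"
    by (rule gauss_family_slice[OF slice_nonempty_0])
  define A where "A = (\<lambda>\<xi> :: nat \<times> nat \<Rightarrow> real. (v 0)\<^sup>2 * \<xi> ?e)"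
  note c = gauss_coordinate(2,3)[OF _ e] gauss_coordinate(1)[OF _ e, of 2] and cv = gauss_covariance(2)[OF _ e e]
  have EA: "integral\<^sup>L (gauss ?U) A = 0" unfolding A_def using c by simp
  have sq: "(A \<xi> - 0)\<^sup>2 = v 0 ^ 4 * (\<xi> ?e)\<^sup>2" for \<xi>
    by (simp add: A_def power_mult_distrib)
  have "std_normal_cdf (c + r * 0) - r\<^sup>2 * (2 * v 0 ^ 4) \<le> (\<integral>\<xi>. std_normal_cdf (c + r * A \<xi>) \<partial>gauss ?U)"
  proof (rule std_normal_cdf_expectation_ge[OF prob_space_gauss _ _ _ _ r])
    show "integrable (gauss ?U) A" unfolding A_def using c by auto
    show "integrable (gauss ?U) (\<lambda>x. (A x - integral\<^sup>L (gauss ?U) A)\<^sup>2)"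
      unfolding EA sq using c by auto
    show "(\<integral>x. (A x - integral\<^sup>L (gauss ?U) A)\<^sup>2 \<partial>gauss ?U) \<le> 2 * v 0 ^ 4"
      unfolding EA sq using cv by (simp add: power2_eq_square)
  qed (simp add: EA)
  also have "\<dots> \<le> (\<integral>\<xi>. std_normal_cdf (c + r * slice_sup n (v 0) ((v 0)\<^sup>2) \<xi>) \<partial>gauss ?U)"
  proof (rule integral_mono)
    show "integrable (gauss ?U) (\<lambda>\<xi>. std_normal_cdf (c + r * slice_sup n (v 0) ((v 0)\<^sup>2) \<xi>))"
      unfolding slice_sup_def using sup_form_measurable[OF fam] by (intro integrable_std_normal_cdf prob_space_gauss) simp
    show "integrable (gauss ?U) (\<lambda>\<xi>. std_normal_cdf (c + r * A \<xi>))"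
      unfolding A_def using c(1) by (intro integrable_std_normal_cdf prob_space_gauss) auto
    fix \<xi>
    define w where "w = (\<lambda>i. if i = n then v 0 else 0)"
    have "w \<in> slice n (v 0) ((v 0)\<^sup>2)"
      by (simp add: w_def slice_def dot_def power2_eq_square if_distrib cong: if_cong)
    then have "lin_form ?U (qcoef w) \<xi> \<le> slice_sup n (v 0) ((v 0)\<^sup>2) \<xi>"
      unfolding slice_sup_def by (rule sup_form_upper[OF fam])
    moreover have "lin_form ?U (qcoef w) \<xi> = A \<xi>"
    proof -
      have "lin_form ?U (qcoef w) \<xi> = (\<Sum>p\<in>?U. if p = ?e then A \<xi> else 0)"
        unfolding lin_form_def by (intro sum.cong) (auto simp: qcoef_def w_def A_def power2_eq_square split: if_splits)
      then show ?thesis using e by simp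
    qed
    ultimately show "std_normal_cdf (c + r * A \<xi>) \<le> std_normal_cdf (c + r * slice_sup n (v 0) ((v 0)\<^sup>2) \<xi>)"
      using r by (intro std_normal_cdf_mono add_left_mono mult_left_mono) auto
  qed
  finally show ?case by simp
next
  case (Suc m)
  obtain n' where n: "n = Suc n'" using Suc.prems n0 by (cases n) auto
  let ?U = "upper_pairs n" and ?C = "last_col n" and ?J = "last_col0 n"
  let ?v' = "\<lambda>i. v (Suc i)"
  define \<rho>' where "\<rho>' = (\<Sum>i\<le>m. (?v' i)\<^sup>2)"
  define \<rho> where "\<rho> = (\<Sum>i\<le>Suc m. (v i)\<^sup>2)"
  have \<rho>: "\<rho> = (v 0)\<^sup>2 + \<rho>'" unfolding \<rho>_def \<rho>'_def by (rule sum.atMost_Suc_shift)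
  have ne: "slice n' (?v' 0) \<rho>' \<noteq> {}"
  proof (cases m)
    case 0 then show ?thesis using slice_nonempty_0[of n' "?v' 0"] by (simp add: \<rho>'_def)
  next
    case (Suc m')
    have "(?v' 0)\<^sup>2 \<le> \<rho>'" unfolding \<rho>'_def by (rule member_le_sum) auto
    moreover obtain n'' where "n' = Suc n''" using Suc.prems n n0 Suc by (cases n') auto
    ultimately show ?thesis using slice_nonempty by simp
  qed
  have v0le: "(v 0)\<^sup>2 \<le> \<rho>" unfolding \<rho> \<rho>'_def by (simp add: sum_nonneg)
  have fam: "gauss_family (upper_pairs (Suc n)) qcoef (slice n (v 0) \<rho>)"
    unfolding n using v0le by (intro gauss_family_slice slice_nonempty)
  have disj: "?C \<inter> ?U = {}" by (auto simp: upper_pairs_def)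
  define f where "f = (\<lambda>\<xi>. std_normal_cdf (c + r * slice_sup n (v 0) \<rho> \<xi>))"
  have fm: "f \<in> borel_measurable (PiM (?C \<union> ?U) (\<lambda>_. borel))"
    unfolding f_def slice_sup_def using sup_form_measurable[OF fam] by (simp add: upper_pairs_Suc Un_commute)
  have fb: "\<bar>f x\<bar> \<le> 1" for x by (simp add: f_def)
  note split = gauss_integral_union[OF _ finite_upper_pairs disj fm fb]
  define L' where "L' = sqrt 2 * \<kappa> * (\<Sum>i<m. ?v' i * ?v' (Suc i))"
  define K' where "K' = 2 * (\<Sum>i\<le>m. ?v' i ^ 4) + 8 * (\<Sum>i<m. (?v' i)\<^sup>2 * (?v' (Suc i))\<^sup>2)"
  define A where "A = (\<lambda>y. (v 0)\<^sup>2 * y (n, n) + (sqrt 2 * v 0 * v 1) * sqrt (sqnorm ?J y))"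
  have J: "?J \<subseteq> ?C" "?J \<noteq> {}" and nC: "(n, n) \<in> ?C" and cJ: "card ?J = n"
    using n by (auto simp: card_image inj_on_def)
  have vnn: "0 \<le> v i" for i by (rule Suc.prems(2))
  have \<beta>: "0 \<le> sqrt 2 * v 0 * v 1" using vnn by simp
  have finC: "finite ?C" by simp
  note column = gauss_column[OF finC nC J, where \<alpha> = "(v 0)\<^sup>2" and \<beta> = "sqrt 2 * v 0 * v 1", unfolded cJ]
  have col: "integrable (gauss ?C) A" "integrable (gauss ?C) (\<lambda>y. (A y - integral\<^sup>L (gauss ?C) A)\<^sup>2)"
    "(\<integral>y. (A y - integral\<^sup>L (gauss ?C) A)\<^sup>2 \<partial>gauss ?C) \<le> 2 * ((v 0)\<^sup>2)\<^sup>2 + 4 * (sqrt 2 * v 0 * v 1)\<^sup>2"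
    "sqrt 2 * v 0 * v 1 * (sqrt n * (1 - 1 / n)) \<le> integral\<^sup>L (gauss ?C) A"
    unfolding A_def by (rule column(1), rule column(2), rule column(3), rule column(4)[OF \<beta>])
  have inner: "std_normal_cdf ((c + r * L') + r * A y) - r\<^sup>2 * K' \<le> (\<integral>x. f (merge ?C ?U (y, x)) \<partial>gauss ?U)" for y
  proof -
    obtain H where H: "\<And>x y. dot (Suc n') (H x) (H y) = dot (Suc n') x y" "\<And>i. continuous_on UNIV (\<lambda>x. H x i)"
      and Hle: "\<And>x. A y + sup_form (upper_pairs (Suc n')) (\<lambda>w. qcoef (H w)) (slice n' (v 1) \<rho>') x
         \<le> slice_sup n (v 0) \<rho> (merge ?C ?U (y, x))"
      using slice_sup_split[OF \<rho>, of n' "v 1" y] ne unfolding A_def n by (auto simp: mult.assoc)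
    have fam1: "gauss_family (upper_pairs (Suc n')) qcoef (slice n' (v 1) \<rho>')"
      using ne by (intro gauss_family_slice) simp
    have fam2: "gauss_family (upper_pairs (Suc n')) (\<lambda>w. qcoef (H w)) (slice n' (v 1) \<rho>')"
      using ne by (intro gauss_family_isometry H) simp
    have "std_normal_cdf ((c + r * A y) + r * L') - r\<^sup>2 * K'
      \<le> (\<integral>\<xi>. std_normal_cdf ((c + r * A y) + r * slice_sup n' (v 1) \<rho>' \<xi>) \<partial>gauss (upper_pairs (Suc n')))"
      using Suc.IH[of n' ?v' "c + r * A y"] Suc.prems n by (simp add: L'_def K'_def \<rho>'_def)
    also have "\<dots> \<le> (\<integral>\<xi>. std_normal_cdf ((c + r * A y) + r * sup_form (upper_pairs (Suc n')) (\<lambda>w. qcoef (H w)) (slice n' (v 1) \<rho>') \<xi>) \<partial>gauss (upper_pairs (Suc n')))"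
      unfolding slice_sup_def by (rule sup_form_dominance[OF fam1 fam2 _ _ r]) (simp_all add: qcoef_gram qcoef_gram_diag H)
    also have "\<dots> \<le> (\<integral>x. f (merge ?C ?U (y, x)) \<partial>gauss ?U)"
      unfolding n[symmetric]
    proof (rule integral_mono)
      show "integrable (gauss ?U) (\<lambda>\<xi>. std_normal_cdf ((c + r * A y) + r * sup_form ?U (\<lambda>w. qcoef (H w)) (slice n' (v 1) \<rho>') \<xi>))"
        using sup_form_measurable[OF fam2] n by (intro integrable_std_normal_cdf prob_space_gauss) simp
      show "integrable (gauss ?U) (\<lambda>x. f (merge ?C ?U (y, x)))" by (rule split(3)) simp
      fix x
      show "std_normal_cdf ((c + r * A y) + r * sup_form ?U (\<lambda>w. qcoef (H w)) (slice n' (v 1) \<rho>') x) \<le> f (merge ?C ?U (y, x))"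
        unfolding f_def using mult_left_mono[OF Hle[of x] r] n by (intro std_normal_cdf_mono) (simp add: algebra_simps)
    qed
    finally show ?thesis by (simp add: algebra_simps)
  qed
  interpret GC: prob_space "gauss ?C" by (rule prob_space_gauss)
  have \<mu>: "sqrt 2 * v 0 * v 1 * \<kappa> \<le> integral\<^sup>L (gauss ?C) A"
  proof -
    have "sqrt 2 * v 0 * v 1 * \<kappa> \<le> sqrt 2 * v 0 * v 1 * (sqrt n * (1 - 1 / n))"
      using vnn Suc.prems(1) by (intro mult_left_mono \<kappa>) auto
    also have "\<dots> \<le> integral\<^sup>L (gauss ?C) A" by (rule col(4))
    finally show ?thesis .
  qed
  have intA: "integrable (gauss ?C) (\<lambda>y. std_normal_cdf ((c + r * L') + r * A y))"
  proof (rule integrable_std_normal_cdf[OF prob_space_gauss])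
    have "A \<in> borel_measurable (gauss ?C)" using col(1) by simp
    then show "(\<lambda>y. (c + r * L') + r * A y) \<in> borel_measurable (gauss ?C)" by measurable
  qed
  have "std_normal_cdf ((c + r * L') + r * (sqrt 2 * v 0 * v 1 * \<kappa>)) - r\<^sup>2 * (2 * ((v 0)\<^sup>2)\<^sup>2 + 4 * (sqrt 2 * v 0 * v 1)\<^sup>2)
     \<le> (\<integral>y. std_normal_cdf ((c + r * L') + r * A y) \<partial>gauss ?C)"
    by (rule std_normal_cdf_expectation_ge[OF prob_space_gauss col(1-3) \<mu> r])
  then have "std_normal_cdf ((c + r * L') + r * (sqrt 2 * v 0 * v 1 * \<kappa>)) - r\<^sup>2 * (2 * ((v 0)\<^sup>2)\<^sup>2 + 4 * (sqrt 2 * v 0 * v 1)\<^sup>2) - r\<^sup>2 * K'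
     \<le> (\<integral>y. std_normal_cdf ((c + r * L') + r * A y) - r\<^sup>2 * K' \<partial>gauss ?C)"
    using intA GC.prob_space by simp
  also have "\<dots> \<le> (\<integral>y. \<integral>x. f (merge ?C ?U (y, x)) \<partial>gauss ?U \<partial>gauss ?C)"
    using intA inner split(2) by (intro integral_mono) auto
  also have "\<dots> = (\<integral>x. f x \<partial>gauss (upper_pairs (Suc n)))"
    using split(1) by (simp add: upper_pairs_Suc Un_commute)
  finally have *: "std_normal_cdf ((c + r * L') + r * (sqrt 2 * v 0 * v 1 * \<kappa>)) - r\<^sup>2 * (2 * ((v 0)\<^sup>2)\<^sup>2 + 4 * (sqrt 2 * v 0 * v 1)\<^sup>2) - r\<^sup>2 * K'
    \<le> (\<integral>x. f x \<partial>gauss (upper_pairs (Suc n)))" .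
  have e1: "(c + r * L') + r * (sqrt 2 * v 0 * v 1 * \<kappa>) = c + r * (sqrt 2 * \<kappa> * (\<Sum>i<Suc m. v i * v (Suc i)))"
    unfolding L'_def sum.lessThan_Suc_shift by (simp add: algebra_simps)
  have e2: "(2 * ((v 0)\<^sup>2)\<^sup>2 + 4 * (sqrt 2 * v 0 * v 1)\<^sup>2) + K' = 2 * (\<Sum>i\<le>Suc m. v i ^ 4) + 8 * (\<Sum>i<Suc m. (v i)\<^sup>2 * (v (Suc i))\<^sup>2)"
    unfolding K'_def sum.lessThan_Suc_shift sum.atMost_Suc_shift by (simp add: power_mult_distrib power_mult[symmetric])
  show ?case
    using * unfolding f_def \<rho>_def e1 diff_diff_eq distrib_left[symmetric] e2 .
qed

section \<open>Lower bound for the edge of the spectrum\<close>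

lemma sin_three_term: "sin (real (k + 2) * \<theta>) + sin (real k * \<theta>) = 2 * cos \<theta> * sin (real (k + 1) * \<theta>)"
proof -
  have "real (k + 2) * \<theta> = real (k + 1) * \<theta> + \<theta>" "real k * \<theta> = real (k + 1) * \<theta> - \<theta>" by (simp_all add: algebra_simps)
  then show ?thesis by (simp only: sin_add sin_diff) (simp add: algebra_simps)
qed

text \<open>The vector \<open>s\<close> is an eigenvector, with eigenvalue \<open>2 * cos \<theta>\<close>, of the adjacency matrix of a path,
  apart from the boundary term, which vanishes for \<open>\<theta> = pi / (m + 2)\<close>.\<close>

lemma sin_neighbour_sum:
  fixes \<theta> :: real
  defines "s \<equiv> \<lambda>i. sin (real (Suc i) * \<theta>)"
  shows "2 * (\<Sum>i<m. s i * s (Suc i)) + s m * s (Suc m) = 2 * cos \<theta> * (\<Sum>i\<le>m. (s i)\<^sup>2)"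
proof (induction m)
  case 0
  have "s (Suc 0) = 2 * cos \<theta> * s 0" using sin_three_term[of 0 \<theta>] by (simp add: s_def)
  then show ?case by (simp add: power2_eq_square)
next
  case (Suc m)
  have "s (Suc (Suc m)) = 2 * cos \<theta> * s (Suc m) - s m" using sin_three_term[of "Suc m" \<theta>] by (simp add: s_def)
  then have "s (Suc m) * s (Suc (Suc m)) = s (Suc m) * (2 * cos \<theta> * s (Suc m)) - s m * s (Suc m)"
    by (simp only: right_diff_distrib mult.commute[of "s m"])
  then show ?case using Suc by (simp add: power2_eq_square algebra_simps)
qed

lemma sine_vector:
  "\<exists>v :: nat \<Rightarrow> real. (\<forall>i\<le>m. 0 \<le> v i) \<and> (\<Sum>i\<le>m. (v i)\<^sup>2) = 1 \<and>
    (\<Sum>i<m. v i * v (Suc i)) = cos (pi / real (m + 2))"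
proof -
  define \<theta> where "\<theta> = pi / real (m + 2)"
  define s where "s = (\<lambda>i. sin (real (Suc i) * \<theta>))"
  define S where "S = (\<Sum>i\<le>m. (s i)\<^sup>2)"
  have pos: "0 < s i" if "i \<le> m" for i
  proof -
    have "real (Suc i) / real (m + 2) < 1" using that by simp
    from mult_strict_left_mono[OF this pi_gt_zero] have "real (Suc i) * \<theta> < pi" unfolding \<theta>_def by (simp add: mult.commute)
    moreover have "0 < real (Suc i) * \<theta>" unfolding \<theta>_def by simp
    ultimately show ?thesis unfolding s_def by (rule sin_gt_zero[rotated])
  qed
  have S: "0 < S" unfolding S_def using pos[of 0] by (intro sum_pos2[of _ 0]) auto
  have "real (m + 2) \<noteq> 0" by simp
  then have "real (m + 2) * \<theta> = pi" unfolding \<theta>_def by (simp del: of_nat_add)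
  moreover have "Suc (Suc m) = m + 2" by simp
  ultimately have "s (Suc m) = 0" unfolding s_def by (simp only: sin_pi)
  have key: "(\<Sum>i<m. s i * s (Suc i)) = cos \<theta> * S"
  proof -
    have "2 * (\<Sum>i<m. s i * s (Suc i)) + s m * s (Suc m) = 2 * cos \<theta> * (\<Sum>i\<le>m. (s i)\<^sup>2)"
      unfolding s_def by (rule sin_neighbour_sum)
    then show ?thesis using \<open>s (Suc m) = 0\<close> by (simp add: S_def)
  qed
  define v where "v = (\<lambda>i. s i / sqrt S)"
  show ?thesis
  proof (intro exI[of _ v] conjI allI impI)
    show "0 \<le> v i" if "i \<le> m" for i using pos[OF that] S by (simp add: v_def)
    have "(v i)\<^sup>2 = (s i)\<^sup>2 / S" for i using S by (simp add: v_def power_divide)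
    then have "(\<Sum>i\<le>m. (v i)\<^sup>2) = S / S" by (simp add: sum_divide_distrib[symmetric] S_def[symmetric])
    then show "(\<Sum>i\<le>m. (v i)\<^sup>2) = 1" using S by simp
    have "(\<Sum>i<m. v i * v (Suc i)) = (\<Sum>i<m. s i * s (Suc i)) / S"
      using S by (simp add: v_def sum_divide_distrib)
    then show "(\<Sum>i<m. v i * v (Suc i)) = cos (pi / real (m + 2))" using key S by (simp add: \<theta>_def)
  qed
qed

lemma sum_square_le_one:
  fixes v :: "nat \<Rightarrow> real"
  assumes "(\<Sum>i\<le>m. (v i)\<^sup>2) = 1"
  shows "(\<Sum>i\<le>m. v i ^ 4) \<le> 1" "(\<Sum>i<m. (v i)\<^sup>2 * (v (Suc i))\<^sup>2) \<le> 1"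
proof -
  have le1: "(v i)\<^sup>2 \<le> 1" if "i \<le> m" for i
    unfolding assms[symmetric] using that by (intro member_le_sum) auto
  have "(\<Sum>i\<le>m. v i ^ 4) \<le> (\<Sum>i\<le>m. (v i)\<^sup>2)"
  proof (rule sum_mono)
    fix i assume "i \<in> {..m}"
    then have "(v i)\<^sup>2 * (v i)\<^sup>2 \<le> (v i)\<^sup>2 * 1" using le1 by (intro mult_left_mono) auto
    then show "v i ^ 4 \<le> (v i)\<^sup>2" by (simp add: power2_eq_square power4_eq_xxxx mult.assoc)
  qed
  then show "(\<Sum>i\<le>m. v i ^ 4) \<le> 1" by (simp add: assms)
  have "(\<Sum>i<m. (v i)\<^sup>2 * (v (Suc i))\<^sup>2) \<le> (\<Sum>i<m. (v i)\<^sup>2)"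
  proof (rule sum_mono)
    fix i assume "i \<in> {..<m}"
    then have "(v i)\<^sup>2 * (v (Suc i))\<^sup>2 \<le> (v i)\<^sup>2 * 1" using le1 by (intro mult_left_mono) auto
    then show "(v i)\<^sup>2 * (v (Suc i))\<^sup>2 \<le> (v i)\<^sup>2" by simp
  qed
  also have "\<dots> \<le> (\<Sum>i\<le>m. (v i)\<^sup>2)" by (intro sum_mono2) auto
  finally show "(\<Sum>i<m. (v i)\<^sup>2 * (v (Suc i))\<^sup>2) \<le> 1" by (simp add: assms)
qed

lemma sqrt_minus_inverse_mono:
  assumes "1 \<le> a" "a \<le> (b::real)" shows "sqrt a * (1 - 1 / a) \<le> sqrt b * (1 - 1 / b)"
  using assms by (intro mult_mono diff_mono divide_left_mono) auto

lemma cos_ge_quadratic: "1 - x\<^sup>2 / 2 \<le> cos (x::real)"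
proof -
  have "(sin (x / 2))\<^sup>2 \<le> (x / 2)\<^sup>2"
    using abs_sin_x_le_abs_x[of "x / 2"] by (simp only: abs_le_square_iff)
  then show ?thesis using cos_double_sin[of "x / 2"] by (simp add: power_divide)
qed

text \<open>The three losses come from the decrease of the norms over \<open>m\<close> steps, from the error
  \<open>1 / k\<close> in the mean of the norms, and from \<open>1 - cos (pi / (m + 2))\<close>.\<close>

lemma neg_min_form_lower_length:
  assumes r: "0 \<le> r" and m: "1 \<le> m" "2 * m \<le> N"
  shows "std_normal_cdf (r * sqrt (2 * real N) * (1 - m / N - 2 / N - 5 / (real m)\<^sup>2)) - 10 * r\<^sup>2
    \<le> (\<integral>\<xi>. std_normal_cdf (r * neg_min_form N \<xi>) \<partial>gauss (upper_pairs N))"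
proof -
  obtain n where N: "N = Suc n" using m by (cases N) auto
  obtain v0 :: "nat \<Rightarrow> real" where v0: "\<And>i. i \<le> m \<Longrightarrow> 0 \<le> v0 i" "(\<Sum>i\<le>m. (v0 i)\<^sup>2) = 1"
    "(\<Sum>i<m. v0 i * v0 (Suc i)) = cos (pi / real (m + 2))" using sine_vector[of m] by auto
  define v where "v = (\<lambda>i. if i \<le> m then v0 i else 0)"
  have "(\<Sum>i\<le>m. (v i)\<^sup>2) = (\<Sum>i\<le>m. (v0 i)\<^sup>2)" "(\<Sum>i<m. v i * v (Suc i)) = (\<Sum>i<m. v0 i * v0 (Suc i))"
    by (auto simp: v_def intro!: sum.cong)
  then have v: "\<And>i. 0 \<le> v i" "(\<Sum>i\<le>m. (v i)\<^sup>2) = 1" "(\<Sum>i<m. v i * v (Suc i)) = cos (pi / real (m + 2))"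
    using v0 by (auto simp: v_def)
  define n0 where "n0 = N - m"
  define \<kappa> where "\<kappa> = sqrt n0 * (1 - 1 / n0)"
  have n0: "1 \<le> n0" "n0 + m \<le> Suc n" using m N by (auto simp: n0_def)
  have \<kappa>: "\<kappa> \<le> sqrt (real k) * (1 - 1 / real k)" if "n0 \<le> k" for k
    unfolding \<kappa>_def using that n0 by (intro sqrt_minus_inverse_mono) auto
  have \<kappa>0: "0 \<le> \<kappa>" unfolding \<kappa>_def using n0 by simp
  let ?U = "upper_pairs N"
  have "(v 0)\<^sup>2 \<le> 1" unfolding v(2)[symmetric] by (intro member_le_sum) auto
  then have sne: "slice n (v 0) 1 \<noteq> {}"
    using slice_nonempty m N by (cases n) auto
  have fam1: "gauss_family ?U qcoef (slice n (v 0) 1)" unfolding N by (rule gauss_family_slice[OF sne])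
  have fam2: "gauss_family ?U qcoef (sphere_vecs N)"
    unfolding gauss_family_def using sphere_vecs_nonempty[of N] m
    by (auto intro!: continuous_intros exI[of _ 1] continuous_on_product_coordinates simp: qcoef_gram_diag sphere_vecs_def)
  have fam3: "gauss_family ?U (\<lambda>v p. - qcoef v p) (sphere_vecs N)"
    using m by (intro gauss_family_neg) auto
  have sub: "slice n (v 0) 1 \<subseteq> sphere_vecs N" unfolding N slice_def sphere_vecs_def by auto
  have N0: "0 < real N" using m by simp
  \<comment> \<open>The three factors are bounded separately; a product of numbers in \<open>[0, 1]\<close> is at least one minus the sum of the deficits.\<close>
  have rat: "1 - m / N - 2 / N - 5 / (real m)\<^sup>2 \<le> sqrt (n0 / N) * (1 - 1 / n0) * cos (pi / real (m + 2))"
  proof -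
    have "real n0 = real N - real m" using m by (simp add: n0_def of_nat_diff)
    then have x: "real n0 / N = 1 - m / N" using N0 by (simp add: field_simps)
    have y01: "0 \<le> real n0 / N" "real n0 / N \<le> 1" using m by (auto simp: n0_def)
    have "real n0 / N \<le> sqrt (n0 / N)"
      using y01 by (metis (no_types, opaque_lifting) mult_left_le real_le_rsqrt power2_eq_square)
    then have a: "1 - m / N \<le> sqrt (n0 / N)" using x by simp
    have "1 / real n0 \<le> 2 / N" using m n0 by (simp add: n0_def of_nat_diff field_simps)
    then have b: "1 - 2 / N \<le> 1 - 1 / n0" by simp
    have "(pi / real (m + 2))\<^sup>2 / 2 \<le> 5 / (real m)\<^sup>2"
    proof -
      have "pi \<le> 3.15" using pi_approx by simp
      then have "pi\<^sup>2 \<le> 3.15\<^sup>2" by (intro power_mono) auto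
      then have "pi\<^sup>2 / 2 \<le> 5" by (simp add: power2_eq_square)
      moreover have "(real m)\<^sup>2 \<le> (real (m + 2))\<^sup>2" by (intro power_mono) auto
      ultimately have "(pi\<^sup>2 / 2) / (real (m + 2))\<^sup>2 \<le> 5 / (real m)\<^sup>2"
        using m by (intro frac_le) auto
      then show ?thesis by (simp add: power_divide)
    qed
    then have c: "1 - 5 / (real m)\<^sup>2 \<le> cos (pi / real (m + 2))"
      using cos_ge_quadratic[of "pi / real (m + 2)"] by simp
    define A where "A = sqrt (n0 / N)" define B where "B = 1 - 1 / real n0" define D where "D = cos (pi / real (m + 2))"
    have A: "0 \<le> A" "A \<le> 1" using y01 by (auto simp: A_def)
    have B: "0 \<le> B" "B \<le> 1" using n0 by (auto simp: B_def)
    have D: "D \<le> 1" by (simp add: D_def)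
    have "0 \<le> (1 - A) * (1 - B)" using A B by simp
    then have "A + B - 1 \<le> A * B" by (simp add: algebra_simps)
    moreover have "0 \<le> (1 - A * B) * (1 - D)" using A B D by (intro mult_nonneg_nonneg) (auto intro: mult_le_one)
    then have "A * B + D - 1 \<le> A * B * D" by (simp add: algebra_simps)
    ultimately have "A + B + D - 2 \<le> A * B * D" by simp
    then show ?thesis using a b c unfolding A_def B_def D_def by linarith
  qed
  have eq: "sqrt (2 * real N) * (sqrt (n0 / N) * (1 - 1 / n0) * cos (pi / real (m + 2))) = sqrt 2 * \<kappa> * cos (pi / real (m + 2))"
    unfolding \<kappa>_def using N0 by (simp add: real_sqrt_mult real_sqrt_divide)
  have "r * (sqrt (2 * real N) * (1 - m / N - 2 / N - 5 / (real m)\<^sup>2)) \<le> r * (sqrt 2 * \<kappa> * cos (pi / real (m + 2)))"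
    using order_trans[OF mult_left_mono[OF rat] eq_refl[OF eq]] r by (intro mult_left_mono) simp_all
  then have "std_normal_cdf (r * sqrt (2 * real N) * (1 - m / N - 2 / N - 5 / (real m)\<^sup>2)) - 10 * r\<^sup>2
    \<le> std_normal_cdf (0 + r * (sqrt 2 * \<kappa> * (\<Sum>i<m. v i * v (Suc i)))) - r\<^sup>2 * (2 * 1 + 8 * 1)"
    unfolding v(3) by (intro diff_mono std_normal_cdf_mono) (simp_all add: mult.assoc)
  also have "\<dots> \<le> std_normal_cdf (0 + r * (sqrt 2 * \<kappa> * (\<Sum>i<m. v i * v (Suc i))))
      - r\<^sup>2 * (2 * (\<Sum>i\<le>m. v i ^ 4) + 8 * (\<Sum>i<m. (v i)\<^sup>2 * (v (Suc i))\<^sup>2))"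
    using sum_square_le_one[OF v(2)] by (intro diff_left_mono mult_left_mono add_mono) auto
  also have "\<dots> \<le> (\<integral>\<xi>. std_normal_cdf (0 + r * slice_sup n (v 0) 1 \<xi>) \<partial>gauss ?U)"
  proof -
    have "std_normal_cdf (0 + r * (sqrt 2 * \<kappa> * (\<Sum>i<m. v i * v (Suc i))))
        - r\<^sup>2 * (2 * (\<Sum>i\<le>m. v i ^ 4) + 8 * (\<Sum>i<m. (v i)\<^sup>2 * (v (Suc i))\<^sup>2))
      \<le> (\<integral>\<xi>. std_normal_cdf (0 + r * slice_sup n (v 0) (\<Sum>i\<le>m. (v i)\<^sup>2) \<xi>) \<partial>gauss (upper_pairs (Suc n)))"
      by (rule slice_sup_lower[OF r n0(1) _ n0(2)]) (use \<kappa> v(1) in auto)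
    then show ?thesis unfolding v(2) N .
  qed
  also have "\<dots> \<le> (\<integral>\<xi>. std_normal_cdf (0 + r * sup_form ?U qcoef (sphere_vecs N) \<xi>) \<partial>gauss ?U)"
  proof (rule integral_mono)
    show "integrable (gauss ?U) (\<lambda>\<xi>. std_normal_cdf (0 + r * slice_sup n (v 0) 1 \<xi>))"
      using sup_form_measurable[OF fam1] by (intro integrable_std_normal_cdf prob_space_gauss) (simp add: slice_sup_def N)
    show "integrable (gauss ?U) (\<lambda>\<xi>. std_normal_cdf (0 + r * sup_form ?U qcoef (sphere_vecs N) \<xi>))"
      using sup_form_measurable[OF fam2] by (intro integrable_std_normal_cdf prob_space_gauss) simp
    fix \<xi>
    have "slice_sup n (v 0) 1 \<xi> \<le> sup_form ?U qcoef (sphere_vecs N) \<xi>"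
      unfolding slice_sup_def N[symmetric] sup_form_le_iff[OF fam1] using sup_form_upper[OF fam2] sub by auto
    then show "std_normal_cdf (0 + r * slice_sup n (v 0) 1 \<xi>) \<le> std_normal_cdf (0 + r * sup_form ?U qcoef (sphere_vecs N) \<xi>)"
      using r by (intro std_normal_cdf_mono add_left_mono mult_left_mono)
  qed
  also have "\<dots> \<le> (\<integral>\<xi>. std_normal_cdf (0 + r * neg_min_form N \<xi>) \<partial>gauss ?U)"
    unfolding neg_min_form_def by (rule sup_form_dominance[OF fam2 fam3 _ _ r]) simp_all
  finally show ?thesis by simp
qed

text \<open>The losses \<open>m / N\<close> and \<open>1 / m\<^sup>2\<close> balance for \<open>m\<close> of order \<open>N powr (1 / 3)\<close>.\<close>

theorem neg_min_form_lower:
  assumes r: "0 \<le> r" and N: "8 \<le> N"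
  shows "std_normal_cdf (r * sqrt (2 * real N) * (1 - 9 * real N powr (- 2 / 3))) - 10 * r\<^sup>2
    \<le> (\<integral>\<xi>. std_normal_cdf (r * neg_min_form N \<xi>) \<partial>gauss (upper_pairs N))"
proof -
  define x where "x = real N powr (1 / 3)"
  define m where "m = nat \<lceil>x\<rceil>"
  have N8: "8 \<le> real N" using N by simp
  have "8 powr (1 / 3) \<le> x" unfolding x_def using N8 by (intro powr_mono2) auto
  moreover have "(8::real) powr (1 / 3) = 2"
  proof -
    have "(8::real) = 2 powr 3" by simp
    then have "(8::real) powr (1 / 3) = (2 powr 3) powr (1 / 3)" by (rule arg_cong)
    then show ?thesis by (simp only: powr_powr) simp
  qed
  ultimately have x2: "2 \<le> x" by simp
  have x3: "x ^ 3 = N" using N8 by (simp add: x_def powr_realpow[symmetric] powr_powr)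
  have x2': "1 / x\<^sup>2 = real N powr (- 2 / 3)"
    using N8 x2 by (simp add: x_def powr_realpow[symmetric] powr_powr powr_minus_divide)
  have mx: "x \<le> m" "m \<le> 2 * x" using x2 unfolding m_def by linarith+
  have m1: "1 \<le> m" using mx x2 by linarith
  have x4: "4 * x \<le> N"
  proof -
    have "2 * 2 \<le> x * x" using x2 by (intro mult_mono) auto
    then have "4 * x \<le> (x * x) * x" using x2 by (intro mult_right_mono) auto
    then show ?thesis using x3 by (simp add: power3_eq_cube)
  qed
  have m2: "2 * m \<le> N" using mx x4 by linarith
  have Nx: "real N = x * x\<^sup>2" using x3 by (simp add: power3_eq_cube power2_eq_square)
  have a: "m / N \<le> 2 / x\<^sup>2" unfolding Nx using mx x2 by (simp add: field_simps)
  have b: "2 / N \<le> 2 / x\<^sup>2" unfolding Nx using x2 by (intro divide_left_mono) auto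
  have c: "5 / (real m)\<^sup>2 \<le> 5 / x\<^sup>2" using mx x2 by (intro divide_left_mono power_mono mult_pos_pos) auto
  have "9 / x\<^sup>2 = 2 / x\<^sup>2 + 2 / x\<^sup>2 + 5 / x\<^sup>2" by (simp add: add_divide_distrib[symmetric])
  then have d: "1 - 9 * real N powr (- 2 / 3) \<le> 1 - m / N - 2 / N - 5 / (real m)\<^sup>2"
    using a b c unfolding x2'[symmetric] by simp
  have "std_normal_cdf (r * sqrt (2 * real N) * (1 - 9 * real N powr (- 2 / 3)))
     \<le> std_normal_cdf (r * sqrt (2 * real N) * (1 - m / N - 2 / N - 5 / (real m)\<^sup>2))"
    using d r by (intro std_normal_cdf_mono mult_left_mono) auto
  then show ?thesis using neg_min_form_lower_length[OF r m1 m2] by linarith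
qed

section \<open>The law of the norm of a Gaussian vector\<close>

interpretation lborels: product_sigma_finite "\<lambda>_. lborel :: real measure"
  by unfold_locales

lemma sets_PiM_lborel [measurable_cong]: "sets (PiM J (\<lambda>_. lborel :: real measure)) = sets (PiM J (\<lambda>_. borel))"
  by (rule sets_PiM_cong) auto

lemma sqnorm_measurable_self [measurable, simp]:
  "sqnorm J \<in> borel_measurable (PiM J (\<lambda>_. borel))" "sqnorm J \<in> borel_measurable (PiM J (\<lambda>_. lborel))"
  "sqnorm J \<in> borel_measurable (gauss J)"
proof -
  show 1: "sqnorm J \<in> borel_measurable (PiM J (\<lambda>_. borel))" by (rule sqnorm_measurable) simp
  show "sqnorm J \<in> borel_measurable (PiM J (\<lambda>_. lborel))"
    unfolding measurable_cong_sets[OF sets_PiM_lborel refl] by (rule 1)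
  show "sqnorm J \<in> borel_measurable (gauss J)"
    unfolding measurable_cong_sets[OF sets_gauss refl] by (rule 1)
qed

lemma PiM_lborel_scale:
  assumes J: "finite J" and c: "0 < (c::real)"
  shows "density (distr (PiM J (\<lambda>_. lborel)) (PiM J (\<lambda>_. lborel)) (\<lambda>x. \<lambda>i\<in>J. c * x i)) (\<lambda>_. ennreal (c ^ card J)) = PiM J (\<lambda>_. lborel)"
    (is "density ?D _ = ?L")
proof (rule lborels.PiM_eqI[OF J])
  show "sets (density ?D (\<lambda>_. ennreal (c ^ card J))) = sets ?L" by simp
  fix A :: "_ \<Rightarrow> real set" assume A: "\<And>i. i \<in> J \<Longrightarrow> A i \<in> sets lborel"
  have m: "(\<lambda>x. \<lambda>i\<in>J. c * x i) \<in> ?L \<rightarrow>\<^sub>M ?L" by measurable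
  have PA: "Pi\<^sub>E J A \<in> sets ?L" using A J by (intro sets_PiM_I_finite) auto
  have "emeasure ?D (Pi\<^sub>E J A) = (\<integral>\<^sup>+x. indicator (Pi\<^sub>E J A) (\<lambda>i\<in>J. c * x i) \<partial>?L)"
    using PA m by (subst nn_integral_indicator[symmetric], simp, subst nn_integral_distr) auto
  also have "\<dots> = (\<integral>\<^sup>+x. (\<Prod>i\<in>J. indicator (A i) (c * x i)) \<partial>?L)"
    by (intro nn_integral_cong) (use J in \<open>auto simp: indicator_def PiE_iff\<close>)
  also have "\<dots> = (\<Prod>i\<in>J. \<integral>\<^sup>+x. indicator (A i) (c * x) \<partial>lborel)"
    using A J by (intro lborels.product_nn_integral_prod) auto
  finally have "emeasure (density ?D (\<lambda>_. ennreal (c ^ card J))) (Pi\<^sub>E J A) = (\<Prod>i\<in>J. ennreal c) * (\<Prod>i\<in>J. \<integral>\<^sup>+x. indicator (A i) (c * x) \<partial>lborel)"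
    using PA c by (subst emeasure_density_const) (auto simp: ennreal_power)
  also have "\<dots> = (\<Prod>i\<in>J. ennreal c * (\<integral>\<^sup>+x. indicator (A i) (c * x) \<partial>lborel))"
    by (rule prod.distrib[symmetric])
  also have "\<dots> = (\<Prod>i\<in>J. emeasure lborel (A i))"
  proof (rule prod.cong[OF refl])
    fix i assume "i \<in> J"
    then have Ai: "A i \<in> sets borel" using A by simp
    then have "(indicator (A i) :: real \<Rightarrow> ennreal) \<in> borel_measurable borel" by simp
    from nn_integral_real_affine[OF this, of c 0] show "ennreal c * (\<integral>\<^sup>+x. indicator (A i) (c * x) \<partial>lborel) = emeasure lborel (A i)"
      using c Ai by simp
  qed
  finally show "emeasure (density ?D (\<lambda>_. ennreal (c ^ card J))) (Pi\<^sub>E J A) = (\<Prod>i\<in>J. emeasure lborel (A i))" .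
qed

lemma nn_integral_PiM_lborel_scale:
  assumes J: "finite J" and c: "0 < (c::real)" and f: "f \<in> borel_measurable (PiM J (\<lambda>_. borel))"
  shows "(\<integral>\<^sup>+x. f x \<partial>PiM J (\<lambda>_. lborel)) = ennreal (c ^ card J) * (\<integral>\<^sup>+x. f (\<lambda>i\<in>J. c * x i) \<partial>PiM J (\<lambda>_. lborel))"
proof -
  let ?L = "PiM J (\<lambda>_. lborel :: real measure)"
  have f': "f \<in> borel_measurable ?L" using f by (simp cong: measurable_cong_sets)
  have m: "(\<lambda>x. \<lambda>i\<in>J. c * x i) \<in> ?L \<rightarrow>\<^sub>M ?L" by measurable
  have "(\<integral>\<^sup>+x. f x \<partial>?L) = (\<integral>\<^sup>+x. f x \<partial>density (distr ?L ?L (\<lambda>x. \<lambda>i\<in>J. c * x i)) (\<lambda>_. ennreal (c ^ card J)))"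
    unfolding PiM_lborel_scale[OF J c] ..
  also have "\<dots> = (\<integral>\<^sup>+x. ennreal (c ^ card J) * f x \<partial>distr ?L ?L (\<lambda>x. \<lambda>i\<in>J. c * x i))"
    using f' by (subst nn_integral_density) auto
  also have "\<dots> = (\<integral>\<^sup>+x. ennreal (c ^ card J) * f (\<lambda>i\<in>J. c * x i) \<partial>?L)"
    using f' m by (subst nn_integral_distr) auto
  also have "\<dots> = ennreal (c ^ card J) * (\<integral>\<^sup>+x. f (\<lambda>i\<in>J. c * x i) \<partial>?L)"
    using measurable_compose[OF m f'] by (rule nn_integral_cmult)
  finally show ?thesis .
qed

lemma gauss_density:
  assumes J: "finite J"
  shows "gauss J = density (PiM J (\<lambda>_. lborel)) (\<lambda>x. ennreal ((1 / sqrt (2 * pi)) ^ card J * exp (- sqnorm J x / 2)))"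
    (is "_ = density ?L ?d")
  unfolding gauss_def
proof (rule normal_laws.PiM_eqI[OF J, symmetric])
  have dm: "?d \<in> borel_measurable ?L" by measurable
  show "sets (density ?L ?d) = sets (PiM J (\<lambda>_. normal_law))"
    by (simp, rule sets_PiM_cong) auto
  fix A :: "_ \<Rightarrow> real set" assume A: "\<And>i. i \<in> J \<Longrightarrow> A i \<in> sets normal_law"
  have PA: "Pi\<^sub>E J A \<in> sets ?L" using A J by (intro sets_PiM_I_finite) auto
  have d: "?d x = (\<Prod>i\<in>J. ennreal (std_normal_density (x i)))" for x
  proof -
    have "(\<Prod>i\<in>J. std_normal_density (x i)) = (1 / sqrt (2 * pi)) ^ card J * (\<Prod>i\<in>J. exp (- (x i)\<^sup>2 / 2))"
      unfolding std_normal_density_def prod.distrib by simp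
    also have "(\<Prod>i\<in>J. exp (- (x i)\<^sup>2 / 2)) = exp (- sqnorm J x / 2)"
      using J by (simp add: exp_sum[symmetric] sqnorm_def sum_negf sum_divide_distrib)
    finally show ?thesis by (simp add: prod_ennreal)
  qed
  have "emeasure (density ?L ?d) (Pi\<^sub>E J A) = (\<integral>\<^sup>+x. ?d x * indicator (Pi\<^sub>E J A) x \<partial>?L)"
    using dm PA by (rule emeasure_density)
  also have "\<dots> = (\<integral>\<^sup>+x. (\<Prod>i\<in>J. ennreal (std_normal_density (x i)) * indicator (A i) (x i)) \<partial>?L)"
    unfolding d prod.distrib
    by (intro nn_integral_cong) (use J in \<open>auto simp: indicator_def PiE_iff space_PiM split: if_splits\<close>)
  also have "\<dots> = (\<Prod>i\<in>J. \<integral>\<^sup>+x. ennreal (std_normal_density x) * indicator (A i) x \<partial>lborel)"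
    using A J by (intro lborels.product_nn_integral_prod) auto
  also have "\<dots> = (\<Prod>i\<in>J. emeasure normal_law (A i))"
    using A by (intro prod.cong refl emeasure_density[symmetric]) auto
  finally show "emeasure (density ?L ?d) (Pi\<^sub>E J A) = (\<Prod>i\<in>J. emeasure normal_law (A i))" .
qed

lemma nn_integral_gauss:
  assumes J: "finite J" and f: "f \<in> borel_measurable (PiM J (\<lambda>_. borel))"
  shows "(\<integral>\<^sup>+x. f x \<partial>gauss J) = (\<integral>\<^sup>+x. ennreal ((1 / sqrt (2 * pi)) ^ card J * exp (- sqnorm J x / 2)) * f x \<partial>PiM J (\<lambda>_. lborel))"
proof -
  have "f \<in> borel_measurable (PiM J (\<lambda>_. lborel))" using f by (simp cong: measurable_cong_sets)
  moreover have "(\<lambda>x. ennreal ((1 / sqrt (2 * pi)) ^ card J * exp (- sqnorm J x / 2))) \<in> borel_measurable (PiM J (\<lambda>_. lborel))"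
    by measurable
  ultimately show ?thesis unfolding gauss_density[OF J] by (subst nn_integral_density) auto
qed

lemma emeasure_ball:
  assumes J: "finite J" "J \<noteq> {}"
  shows "emeasure (PiM J (\<lambda>_. lborel)) {x \<in> space (PiM J (\<lambda>_. lborel)). sqrt (sqnorm J x) \<le> r} = ennreal (unit_ball_vol (card J) * (max 0 r) ^ card J)"
    (is "emeasure ?L (?B r) = _")
proof -
  have pos: "emeasure ?L (?B r) = ennreal (unit_ball_vol (card J) * r ^ card J)" if "0 < r" for r
    using emeasure_cball_aux[OF J(1) that] by (simp add: sqnorm_def Int_def conj_commute)
  have k: "0 < card J" using J by (simp add: card_gt_0_iff)
  consider "0 < r" | "r = 0" | "r < 0" by linarith
  then show ?thesis
  proof cases
    case 1 then show ?thesis using pos by simp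
  next
    case 2
    let ?V = "unit_ball_vol (card J)"
    have V: "0 < ?V" by simp
    have eps: "emeasure ?L (?B 0) \<le> 0 + ennreal e" if e: "0 < e" for e
    proof -
      \<comment> \<open>The origin has measure 0, as it lies in balls of arbitrarily small volume.\<close>
      define d where "d = min 1 (e / ?V)"
      have d: "0 < d" "d \<le> 1" "d \<le> e / ?V" using e V by (auto simp: d_def)
      have "emeasure ?L (?B 0) \<le> emeasure ?L (?B d)"
      proof (rule emeasure_mono)
        show "?B 0 \<subseteq> ?B d"
          by (rule Collect_mono, rule impI, erule conjE, rule conjI, assumption, erule order_trans) (use d in simp)
        show "?B d \<in> sets ?L" by measurable
      qed
      also have "\<dots> = ennreal (?V * d ^ card J)" by (rule pos[OF d(1)])
      also have "\<dots> \<le> ennreal e"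
      proof (rule ennreal_leI)
        have "d ^ card J \<le> d ^ 1" using d k by (intro power_decreasing) auto
        then have "?V * d ^ card J \<le> ?V * (e / ?V)" using d(3) V by (intro mult_left_mono) auto
        then show "?V * d ^ card J \<le> e" using V by simp
      qed
      finally show ?thesis by simp
    qed
    have "emeasure ?L (?B 0) \<le> 0" by (rule ennreal_le_epsilon, rule eps)
    then have "emeasure ?L (?B 0) = 0" by (simp only: le_zero_eq)
    then show ?thesis unfolding 2 using k by simp
  next
    case 3
    have "?B r = {}" using 3 real_sqrt_ge_zero[OF sqnorm_nonneg[of J]] by (auto simp: not_le intro: less_le_trans)
    then have "emeasure ?L (?B r) = 0" by (simp only: emeasure_empty)
    then show ?thesis using 3 k by simp
  qed
qed

text \<open>The derivative of the volume \<open>V * r ^ k\<close> of the ball is the density of the norm.\<close>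

lemma radial_law:
  assumes J: "finite J" "J \<noteq> {}"
  shows "distr (PiM J (\<lambda>_. lborel)) borel (\<lambda>x. sqrt (sqnorm J x))
    = density lborel (\<lambda>r. ennreal (card J * unit_ball_vol (card J) * r ^ (card J - 1)) * indicator {0..} r)" (is "?M = ?N")
proof (rule measure_eqI_generator_eq[where E = "range (\<lambda>r. {..r})" and \<Omega> = UNIV and A = "\<lambda>n. {..real n}"])
  let ?L = "PiM J (\<lambda>_. lborel :: real measure)" and ?V = "unit_ball_vol (card J)"
  have k: "0 < card J" using J by (simp add: card_gt_0_iff)
  have M: "emeasure ?M {..r} = ennreal (?V * (max 0 r) ^ card J)" for r
  proof -
    have "emeasure ?M {..r} = emeasure ?L ((\<lambda>x. sqrt (sqnorm J x)) -` {..r} \<inter> space ?L)"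
      by (rule emeasure_distr) auto
    also have "(\<lambda>x. sqrt (sqnorm J x)) -` {..r} \<inter> space ?L = {x \<in> space ?L. sqrt (sqnorm J x) \<le> r}" by auto
    finally show ?thesis using emeasure_ball[OF J] by simp
  qed
  have N: "emeasure ?N {..r} = ennreal (?V * (max 0 r) ^ card J)" for r
  proof -
    have "emeasure ?N {..r} = (\<integral>\<^sup>+x. ennreal (card J * ?V * x ^ (card J - 1)) * indicator {0..} x * indicator {..r} x \<partial>lborel)"
      by (rule emeasure_density) auto
    also have "\<dots> = (\<integral>\<^sup>+x. ennreal (card J * ?V * x ^ (card J - 1)) * indicator {0..r} x \<partial>lborel)"
      by (intro nn_integral_cong) (auto simp: indicator_def)
    also have "\<dots> = ennreal (?V * (max 0 r) ^ card J)"
    proof (cases "0 \<le> r")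
      case True
      have "(\<integral>\<^sup>+x. ennreal (card J * ?V * x ^ (card J - 1)) * indicator {0..r} x \<partial>lborel) = ennreal (?V * r ^ card J - ?V * 0 ^ card J)"
        using True by (intro nn_integral_FTC_Icc) (auto intro!: derivative_eq_intros)
      then show ?thesis using True k by simp
    next
      case False then show ?thesis using k by simp
    qed
    finally show ?thesis .
  qed
  show "Int_stable (range (\<lambda>r::real. {..r}))" by (auto simp: Int_stable_def intro!: image_eqI[of _ _ "min _ _"])
  show "sets ?M = sigma_sets UNIV (range (\<lambda>r. {..r}))" "sets ?N = sigma_sets UNIV (range (\<lambda>r. {..r}))"
    by (simp_all add: borel_eq_atMost)
  show "emeasure ?M X = emeasure ?N X" if "X \<in> range (\<lambda>r. {..r})" for X using that M N by auto
  show "emeasure ?M {..real n} \<noteq> \<infinity>" for n unfolding M by simp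
  show "(\<Union>n. {..real n}) = UNIV" using real_arch_simple by auto
qed auto

lemma nn_integral_radial:
  assumes J: "finite J" "J \<noteq> {}" and h: "h \<in> borel_measurable borel"
  shows "(\<integral>\<^sup>+x. h (sqrt (sqnorm J x)) \<partial>PiM J (\<lambda>_. lborel))
    = (\<integral>\<^sup>+r. ennreal (card J * unit_ball_vol (card J) * r ^ (card J - 1)) * indicator {0..} r * h r \<partial>lborel)"
proof -
  have "(\<integral>\<^sup>+x. h (sqrt (sqnorm J x)) \<partial>PiM J (\<lambda>_. lborel)) = (\<integral>\<^sup>+r. h r \<partial>distr (PiM J (\<lambda>_. lborel)) borel (\<lambda>x. sqrt (sqnorm J x)))"
    using h by (subst nn_integral_distr) auto
  then show ?thesis unfolding radial_law[OF J] using h by (subst (asm) nn_integral_density) auto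
qed

text \<open>Even and odd exponents are treated apart, with the recursion of the Gamma function at half
  integers.\<close>

lemma gaussian_half_moment:
  "(\<integral>\<^sup>+r. ennreal (r ^ p * exp (- r\<^sup>2)) * indicator {0..} r \<partial>lborel) = ennreal (Gamma ((real p + 1) / 2) / 2)"
proof -
  have "has_bochner_integral lborel (\<lambda>x::real. indicator {0..} x *\<^sub>R (exp (-x\<^sup>2) * x ^ p)) (Gamma ((real p + 1) / 2) / 2)"
  proof (cases "even p")
    case True
    then obtain k where p: "p = 2 * k" by auto
    have "Gamma (real k + 1 / 2) = sqrt pi * (fact (2 * k) / (2 ^ (2 * k) * fact k))"
    proof (induction k)
      case 0 then show ?case by (simp add: Gamma_one_half_real)
    next
      case (Suc k)
      have "Gamma (real (Suc k) + 1 / 2) = (real k + 1 / 2) * Gamma (real k + 1 / 2)"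
      proof -
        have "real k + 1 / 2 \<notin> \<int>\<^sub>\<le>\<^sub>0" using nonpos_Ints_nonpos[of "real k + 1 / 2"] by auto
        then show ?thesis using Gamma_plus1[of "real k + 1 / 2"] by (simp add: add_ac)
      qed
      also have "\<dots> = (real k + 1 / 2) * (sqrt pi * (fact (2 * k) / (2 ^ (2 * k) * fact k)))" by (simp only: Suc)
      also have "\<dots> = sqrt pi * (fact (2 * Suc k) / (2 ^ (2 * Suc k) * fact (Suc k)))"
        by (simp add: field_simps del: fact_Suc) (simp add: field_simps)
      finally show ?case .
    qed
    then show ?thesis using gaussian_moment_even_pos[of k] by (simp add: p add_divide_distrib mult_ac)
  next
    case False
    then obtain k where p: "p = 2 * k + 1" by (auto elim: oddE)
    have "Gamma (1 + real k) = fact k" using Gamma_fact[of k, where 'a = real] by simp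
    then show ?thesis using gaussian_moment_odd_pos[of k] by (simp add: p add_divide_distrib)
  qed
  then have "(\<integral>\<^sup>+r. ennreal (indicator {0..} r *\<^sub>R (exp (-r\<^sup>2) * r ^ p)) \<partial>lborel) = ennreal (Gamma ((real p + 1) / 2) / 2)"
    by (subst nn_integral_eq_integral) (auto simp: has_bochner_integral_iff indicator_def)
  then show ?thesis by (subst (asm) nn_integral_cong[where v = "\<lambda>r. ennreal (r ^ p * exp (- r\<^sup>2)) * indicator {0..} r"]) (auto simp: indicator_def mult.commute)
qed

text \<open>The scaling by \<open>sqrt 2\<close> replaces the weight \<open>exp (- r\<^sup>2 / 2)\<close> by \<open>exp (- r\<^sup>2)\<close>.\<close>

lemma gauss_norm_power:
  assumes J: "finite J" "J \<noteq> {}"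
  shows "(\<integral>\<^sup>+x. ennreal (sqrt (sqnorm J x) ^ p) \<partial>gauss J)
    = ennreal ((1 / sqrt (2 * pi)) ^ card J * sqrt 2 ^ (card J + p) * card J * unit_ball_vol (card J) * (Gamma ((real (card J + p)) / 2) / 2))"
proof -
  let ?L = "PiM J (\<lambda>_. lborel :: real measure)" and ?k = "card J"
  have k: "0 < ?k" using J by (simp add: card_gt_0_iff)
  define C where "C = (1 / sqrt (2 * pi)) ^ ?k"
  have C: "0 \<le> C" by (simp add: C_def)
  have sc: "sqnorm J (\<lambda>i\<in>J. sqrt 2 * x i) = 2 * sqnorm J x" for x
    by (simp add: sqnorm_def power_mult_distrib sum_distrib_left)
  have "(\<integral>\<^sup>+x. ennreal (sqrt (sqnorm J x) ^ p) \<partial>gauss J) = (\<integral>\<^sup>+x. ennreal (C * exp (- sqnorm J x / 2) * sqrt (sqnorm J x) ^ p) \<partial>?L)"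
    using C by (subst nn_integral_gauss[OF J(1)]) (auto simp: C_def ennreal_mult')
  also have "\<dots> = ennreal (sqrt 2 ^ ?k) * (\<integral>\<^sup>+x. ennreal (C * exp (- sqnorm J x) * (sqrt 2 * sqrt (sqnorm J x)) ^ p) \<partial>?L)"
    by (subst nn_integral_PiM_lborel_scale[OF J(1), of "sqrt 2"]) (auto simp: sc real_sqrt_mult)
  also have "(\<integral>\<^sup>+x. ennreal (C * exp (- sqnorm J x) * (sqrt 2 * sqrt (sqnorm J x)) ^ p) \<partial>?L)
     = (\<integral>\<^sup>+x. (\<lambda>r. ennreal (C * sqrt 2 ^ p * (r ^ p * exp (- r\<^sup>2)))) (sqrt (sqnorm J x)) \<partial>?L)"
    by (intro nn_integral_cong) (simp add: power_mult_distrib mult_ac)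
  also have "\<dots> = (\<integral>\<^sup>+r. ennreal (?k * unit_ball_vol ?k * r ^ (?k - 1)) * indicator {0..} r * ennreal (C * sqrt 2 ^ p * (r ^ p * exp (- r\<^sup>2))) \<partial>lborel)"
    by (rule nn_integral_radial[OF J]) auto
  also have "\<dots> = (\<integral>\<^sup>+r. ennreal (?k * unit_ball_vol ?k * C * sqrt 2 ^ p) * (ennreal (r ^ (?k - 1 + p) * exp (- r\<^sup>2)) * indicator {0..} r) \<partial>lborel)"
    using C by (intro nn_integral_cong) (auto simp: indicator_def ennreal_mult'[symmetric] power_add mult_ac)
  also have "\<dots> = ennreal (?k * unit_ball_vol ?k * C * sqrt 2 ^ p) * (\<integral>\<^sup>+r. ennreal (r ^ (?k - 1 + p) * exp (- r\<^sup>2)) * indicator {0..} r \<partial>lborel)"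
    by (rule nn_integral_cmult) auto
  also have "(\<integral>\<^sup>+r. ennreal (r ^ (?k - 1 + p) * exp (- r\<^sup>2)) * indicator {0..} r \<partial>lborel) = ennreal (Gamma ((real (?k + p)) / 2) / 2)"
    using k by (subst gaussian_half_moment) (simp add: of_nat_diff)
  finally have "(\<integral>\<^sup>+x. ennreal (sqrt (sqnorm J x) ^ p) \<partial>gauss J) = ennreal (sqrt 2 ^ ?k) *
      (ennreal (?k * unit_ball_vol ?k * C * sqrt 2 ^ p) * ennreal ((Gamma ((real (?k + p)) / 2) / 2)))" .
  also have "\<dots> = ennreal (sqrt 2 ^ ?k * (?k * unit_ball_vol ?k * C * sqrt 2 ^ p * (Gamma ((real (?k + p)) / 2) / 2)))"
  proof -
    have "0 \<le> ?k * unit_ball_vol ?k * C * sqrt 2 ^ p" "0 \<le> sqrt 2 ^ ?k" using C by auto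
    then show ?thesis by (simp only: ennreal_mult'[symmetric])
  qed
  finally show ?thesis by (simp only: C_def power_add mult_ac)
qed

text \<open>The quotient of the moments of order 1 and 0; taking the quotient removes the volume of the unit
  ball.\<close>

lemma gauss_norm_mean_Gamma:
  assumes J: "finite J" "J \<noteq> {}"
  shows "(\<integral>\<^sup>+x. ennreal (sqrt (sqnorm J x)) \<partial>gauss J) = ennreal (sqrt 2 * Gamma ((real (card J) + 1) / 2) / Gamma (real (card J) / 2))"
proof -
  let ?k = "card J"
  have k: "0 < ?k" using J by (simp add: card_gt_0_iff)
  define D where "D = (1 / sqrt (2 * pi)) ^ ?k * sqrt 2 ^ ?k * ?k * unit_ball_vol ?k / 2"
  have "1 = (\<integral>\<^sup>+x. ennreal (sqrt (sqnorm J x) ^ 0) \<partial>gauss J)"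
    using prob_space.emeasure_space_1[OF prob_space_gauss, of J] by simp
  also have "\<dots> = ennreal (D * Gamma (?k / 2))"
    unfolding gauss_norm_power[OF J] by (simp add: D_def mult_ac)
  finally have "ennreal 1 = ennreal (D * Gamma (?k / 2))" by simp
  then have D: "D * Gamma (?k / 2) = 1"
    by (metis ennreal_1 ennreal_eq_1)
  have G: "0 < Gamma (real ?k / 2)" using k by (intro Gamma_real_pos) auto
  have "(\<integral>\<^sup>+x. ennreal (sqrt (sqnorm J x) ^ 1) \<partial>gauss J) = ennreal (D * (sqrt 2 * Gamma ((real ?k + 1) / 2)))"
    unfolding gauss_norm_power[OF J] by (simp add: D_def mult_ac add_ac)
  moreover have "D = 1 / Gamma (?k / 2)" using D G by (simp add: field_simps)
  ultimately show ?thesis by simp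
qed

section \<open>Student's distribution as a mixture of normal distributions\<close>

text \<open>Student's distribution is the law of \<open>z / \<rho>\<close> for independent \<open>z\<close> and \<open>\<rho>\<close>, where \<open>z\<close> is standard normal.
  Given \<open>\<rho>\<close>, the density at \<open>t\<close> is \<open>\<rho> * std_normal_density (t * \<rho>)\<close>. Its exponent combines with that of
  the Gaussian weight to \<open>- (1 + t\<^sup>2 / l) * sqnorm J x / 2\<close>; the scaling by \<open>1 / a\<close> removes the dependence on
  \<open>t\<close> from the integral, and the mean of the norm supplies the normalizing constant.\<close>

lemma student_t_density_mixture:
  assumes J: "finite J" "J \<noteq> {}"
  defines "l \<equiv> card J"
  defines "\<rho> \<equiv> \<lambda>x. sqrt (sqnorm J x) / sqrt (real l)"
  shows "(\<integral>\<^sup>+x. ennreal (\<rho> x * std_normal_density (t * \<rho> x)) \<partial>gauss J) = ennreal (student_t_density l t)"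
proof -
  let ?L = "PiM J (\<lambda>_. lborel :: real measure)"
  have l: "0 < l" using J by (simp add: l_def card_gt_0_iff)
  define a where "a = sqrt (1 + t\<^sup>2 / l)"
  have a2: "a\<^sup>2 = 1 + t\<^sup>2 / l" by (simp add: a_def)
  have "1 + t\<^sup>2 / l > 0" using l by (intro add_pos_nonneg) auto
  then have a: "0 < a" by (simp add: a_def)
  define C where "C = (1 / sqrt (2 * pi)) ^ l"
  have C: "0 \<le> C" by (simp add: C_def)
  have sc: "sqrt (sqnorm J (\<lambda>i\<in>J. 1 / a * x i)) = 1 / a * sqrt (sqnorm J x)" for x
  proof -
    have "sqnorm J (\<lambda>i\<in>J. 1 / a * x i) = (1 / a)\<^sup>2 * sqnorm J x"
      unfolding sqnorm_def sum_distrib_left by (intro sum.cong) (simp_all add: power_mult_distrib power_divide)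
    then show ?thesis using a by (simp add: real_sqrt_mult)
  qed
  have "(\<integral>\<^sup>+x. ennreal (\<rho> x * std_normal_density (t * \<rho> x)) \<partial>gauss J)
     = (\<integral>\<^sup>+x. ennreal (C * exp (- sqnorm J x / 2) * (\<rho> x * std_normal_density (t * \<rho> x))) \<partial>?L)"
  proof -
    have m: "(\<lambda>x. ennreal (\<rho> x * std_normal_density (t * \<rho> x))) \<in> borel_measurable (PiM J (\<lambda>_. borel))"
      unfolding \<rho>_def by measurable
    have "0 \<le> C * exp (- sqnorm J x / 2)" for x using C by simp
    then show ?thesis
      unfolding nn_integral_gauss[OF J(1) m] l_def[symmetric] C_def[symmetric] by (simp only: ennreal_mult'[symmetric])
  qed
  also have "\<dots> = (\<integral>\<^sup>+x. ennreal (C * (1 / sqrt (2 * pi * l)) * (sqrt (sqnorm J x) * exp (- (a * sqrt (sqnorm J x))\<^sup>2 / 2))) \<partial>?L)"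
  proof (rule nn_integral_cong)
    fix x
    have "exp (- sqnorm J x / 2) * exp (- (t * \<rho> x)\<^sup>2 / 2) = exp (- (a * sqrt (sqnorm J x))\<^sup>2 / 2)"
      using l by (simp add: exp_add[symmetric] \<rho>_def power_mult_distrib power_divide a2 field_simps)
    moreover have "C * exp (- sqnorm J x / 2) * (\<rho> x * std_normal_density (t * \<rho> x)) = C * (1 / sqrt (2 * pi * l)) * (sqrt (sqnorm J x) * (exp (- sqnorm J x / 2) * exp (- (t * \<rho> x)\<^sup>2 / 2)))"
      by (simp add: std_normal_density_def \<rho>_def real_sqrt_mult mult_ac)
    ultimately show "ennreal (C * exp (- sqnorm J x / 2) * (\<rho> x * std_normal_density (t * \<rho> x))) = ennreal (C * (1 / sqrt (2 * pi * l)) * (sqrt (sqnorm J x) * exp (- (a * sqrt (sqnorm J x))\<^sup>2 / 2)))"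
      by simp
  qed
  also have "\<dots> = ennreal ((1 / a) ^ l) * (\<integral>\<^sup>+x. ennreal (C * (1 / sqrt (2 * pi * l)) * (1 / a * sqrt (sqnorm J x) * exp (- sqnorm J x / 2))) \<partial>?L)"
  proof -
    have "sqrt (sqnorm J (\<lambda>i\<in>J. x i / a)) = sqrt (sqnorm J x) / a" for x using sc[of x] by simp
    then show ?thesis
      using a by (subst nn_integral_PiM_lborel_scale[OF J(1), of "1 / a"]) (auto simp: l_def[symmetric] mult_ac)
  qed
  also have "(\<integral>\<^sup>+x. ennreal (C * (1 / sqrt (2 * pi * l)) * (1 / a * sqrt (sqnorm J x) * exp (- sqnorm J x / 2))) \<partial>?L)
     = (\<integral>\<^sup>+x. ennreal (1 / (a * sqrt (2 * pi * l))) * (ennreal (C * exp (- sqnorm J x / 2)) * ennreal (sqrt (sqnorm J x))) \<partial>?L)"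
    using C a by (intro nn_integral_cong) (simp add: ennreal_mult'[symmetric] mult_ac)
  also have "\<dots> = ennreal (1 / (a * sqrt (2 * pi * l))) * (\<integral>\<^sup>+x. ennreal (C * exp (- sqnorm J x / 2)) * ennreal (sqrt (sqnorm J x)) \<partial>?L)"
    by (rule nn_integral_cmult) measurable
  also have "(\<integral>\<^sup>+x. ennreal (C * exp (- sqnorm J x / 2)) * ennreal (sqrt (sqnorm J x)) \<partial>?L) = (\<integral>\<^sup>+x. ennreal (sqrt (sqnorm J x)) \<partial>gauss J)"
    by (subst nn_integral_gauss[OF J(1)]) (auto simp: C_def l_def)
  also have "\<dots> = ennreal (sqrt 2 * Gamma ((real l + 1) / 2) / Gamma (real l / 2))"
    unfolding l_def by (rule gauss_norm_mean_Gamma[OF J])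
  finally have "(\<integral>\<^sup>+x. ennreal (\<rho> x * std_normal_density (t * \<rho> x)) \<partial>gauss J)
     = ennreal ((1 / a) ^ l * (1 / (a * sqrt (2 * pi * l)) * (sqrt 2 * Gamma ((real l + 1) / 2) / Gamma (real l / 2))))"
    using a by (simp add: ennreal_mult'[symmetric])
  also have "(1 / a) ^ l * (1 / (a * sqrt (2 * pi * l)) * (sqrt 2 * Gamma ((real l + 1) / 2) / Gamma (real l / 2))) = student_t_density l t"
  proof -
    have p: "(1 + t\<^sup>2 / l) powr (- ((real l + 1) / 2)) = (1 / a) ^ l * (1 / a)"
    proof -
      have "(1 + t\<^sup>2 / l) powr (- ((real l + 1) / 2)) = (a powr 2) powr (- ((real l + 1) / 2))"
        using a a2 by (simp add: powr_numeral)
      also have "2 * (- ((real l + 1) / 2)) = - real (Suc l)" by (simp add: field_simps)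
      then have "(a powr 2) powr (- ((real l + 1) / 2)) = a powr (- real (Suc l))" by (simp only: powr_powr)
      also have "\<dots> = (1 / a) ^ Suc l"
        using a by (simp only: powr_minus powr_realpow) (simp add: power_one_over inverse_eq_divide)
      finally show ?thesis by simp
    qed
    show ?thesis unfolding student_t_density_def p by (simp add: real_sqrt_mult mult_ac)
  qed
  finally show ?thesis .
qed

lemma emeasure_normal_law_scaled:
  assumes \<rho>: "0 < \<rho>"
  shows "ennreal (std_normal_cdf (s * \<rho>)) = (\<integral>\<^sup>+t. ennreal (\<rho> * std_normal_density (t * \<rho>)) * indicator {..s} t \<partial>lborel)"
proof -
  have "ennreal (std_normal_cdf (s * \<rho>)) = emeasure normal_law {..s * \<rho>}"
    by (simp add: std_normal_cdf_atMost normal_law.emeasure_eq_measure)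
  also have "\<dots> = (\<integral>\<^sup>+u. ennreal (std_normal_density u) * indicator {..s * \<rho>} u \<partial>lborel)"
    by (rule emeasure_density) auto
  also have "\<dots> = ennreal \<rho> * (\<integral>\<^sup>+t. ennreal (std_normal_density (t * \<rho>)) * indicator {..s} t \<partial>lborel)"
    using \<rho> by (subst nn_integral_real_affine[of _ \<rho> 0]) (auto simp: indicator_def mult.commute intro!: arg_cong2[where f = "(*)"] nn_integral_cong)
  also have "\<dots> = (\<integral>\<^sup>+t. ennreal \<rho> * (ennreal (std_normal_density (t * \<rho>)) * indicator {..s} t) \<partial>lborel)"
    by (rule nn_integral_cmult[symmetric]) auto
  finally show ?thesis using \<rho> by (simp add: ennreal_mult' mult.assoc)
qed

lemma AE_gauss_norm_pos:
  assumes J: "finite J" "J \<noteq> {}"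
  shows "AE x in gauss J. 0 < sqrt (sqnorm J x)"
proof -
  let ?L = "PiM J (\<lambda>_. lborel :: real measure)"
  have k: "0 < card J" using J by (simp add: card_gt_0_iff)
  have "{x \<in> space ?L. \<not> 0 < sqrt (sqnorm J x)} = {x \<in> space ?L. sqrt (sqnorm J x) \<le> 0}" by auto
  then have "emeasure ?L {x \<in> space ?L. \<not> 0 < sqrt (sqnorm J x)} = 0"
    using emeasure_ball[OF J, of 0] k by simp
  moreover have "{x \<in> space ?L. \<not> 0 < sqrt (sqnorm J x)} \<in> sets ?L" by measurable
  ultimately have "AE x in ?L. 0 < sqrt (sqnorm J x)" by (intro AE_I[OF subset_refl])
  moreover have "(\<lambda>x. ennreal ((1 / sqrt (2 * pi)) ^ card J * exp (- sqnorm J x / 2))) \<in> borel_measurable ?L"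
    by measurable
  ultimately show ?thesis unfolding gauss_density[OF J(1)] by (subst AE_density) (auto elim: eventually_mono)
qed

text \<open>In this form the dependence on \<open>l\<close> is confined to the factor \<open>sqrt (sqnorm J x) / sqrt l\<close>, which is
  close to 1.\<close>

theorem student_t_cdf_mixture:
  assumes J: "finite J" "J \<noteq> {}"
  shows "student_t_cdf (card J) s = (\<integral>x. std_normal_cdf (s * (sqrt (sqnorm J x) / sqrt (card J))) \<partial>gauss J)"
proof -
  define l where "l = card J"
  have l: "0 < l" using J by (simp add: l_def card_gt_0_iff)
  define \<rho> where "\<rho> = (\<lambda>x. sqrt (sqnorm J x) / sqrt (real l))"
  interpret G: prob_space "gauss J" by (rule prob_space_gauss)
  interpret P: pair_sigma_finite "gauss J" lborel
    by (simp add: pair_sigma_finite_def sigma_finite_gauss sigma_finite_lborel)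
  have [measurable]: "\<rho> \<in> borel_measurable (gauss J)" unfolding \<rho>_def by simp
  have [measurable]: "student_t_density l \<in> borel_measurable borel" unfolding student_t_density_def[abs_def] by measurable
  have "(\<integral>\<^sup>+x. ennreal (std_normal_cdf (s * \<rho> x)) \<partial>gauss J)
     = (\<integral>\<^sup>+x. \<integral>\<^sup>+t. ennreal (\<rho> x * std_normal_density (t * \<rho> x)) * indicator {..s} t \<partial>lborel \<partial>gauss J)"
  proof -
    have "ennreal (std_normal_cdf (s * \<rho> x)) = (\<integral>\<^sup>+t. ennreal (\<rho> x * std_normal_density (t * \<rho> x)) * indicator {..s} t \<partial>lborel)"
      if "0 < sqrt (sqnorm J x)" for x
      using that l by (intro emeasure_normal_law_scaled) (simp add: \<rho>_def)
    then show ?thesis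
      using AE_gauss_norm_pos[OF J] by (intro nn_integral_cong_AE) (elim eventually_mono)
  qed
  also have "\<dots> = (\<integral>\<^sup>+t. \<integral>\<^sup>+x. ennreal (\<rho> x * std_normal_density (t * \<rho> x)) * indicator {..s} t \<partial>gauss J \<partial>lborel)"
    by (rule P.Fubini'[symmetric]) (unfold split_beta', measurable)
  also have "\<dots> = (\<integral>\<^sup>+t. ennreal (student_t_density l t) * indicator {..s} t \<partial>lborel)"
  proof (rule nn_integral_cong)
    fix t
    have "(\<integral>\<^sup>+x. ennreal (\<rho> x * std_normal_density (t * \<rho> x)) * indicator {..s} t \<partial>gauss J)
       = (\<integral>\<^sup>+x. ennreal (\<rho> x * std_normal_density (t * \<rho> x)) \<partial>gauss J) * indicator {..s} t"
      by (rule nn_integral_multc) measurable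
    then show "(\<integral>\<^sup>+x. ennreal (\<rho> x * std_normal_density (t * \<rho> x)) * indicator {..s} t \<partial>gauss J) = ennreal (student_t_density l t) * indicator {..s} t"
      using student_t_density_mixture[OF J, of t] by (simp add: \<rho>_def l_def)
  qed
  also have "\<dots> = emeasure (density lborel (student_t_density l)) {..s}"
    by (rule emeasure_density[symmetric]) auto
  finally have eq: "(\<integral>\<^sup>+x. ennreal (std_normal_cdf (s * \<rho> x)) \<partial>gauss J) = emeasure (density lborel (student_t_density l)) {..s}" .
  have "student_t_cdf l s = enn2real (\<integral>\<^sup>+x. ennreal (std_normal_cdf (s * \<rho> x)) \<partial>gauss J)"
    unfolding eq by (simp add: student_t_cdf_def cdf_def measure_def)
  also have "\<dots> = (\<integral>x. std_normal_cdf (s * \<rho> x) \<partial>gauss J)"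
    by (rule integral_eq_nn_integral[symmetric]) (auto simp: std_normal_cdf_bounds)
  finally show ?thesis unfolding l_def \<rho>_def .
qed

section \<open>Volumes of cones\<close>

lemma emeasure_cone_ball:
  assumes J: "finite J" and K: "K \<in> sets (PiM J (\<lambda>_. borel :: real measure))"
    and cone: "\<And>r x. 0 < r \<Longrightarrow> x \<in> K \<Longrightarrow> (\<lambda>i\<in>J. r * x i) \<in> K" and r: "0 < r"
  shows "emeasure (PiM J (\<lambda>_. lborel)) {x \<in> K. sqrt (sqnorm J x) \<le> r}
    = ennreal (r ^ card J) * emeasure (PiM J (\<lambda>_. lborel)) {x \<in> K. sqrt (sqnorm J x) \<le> 1}"
proof -
  let ?L = "PiM J (\<lambda>_. lborel :: real measure)"
  have Ksp: "K \<subseteq> J \<rightarrow>\<^sub>E UNIV" using sets.sets_into_space[OF K] by (simp add: space_PiM)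
  have KL: "K \<in> sets ?L" unfolding sets_PiM_lborel by (rule K)
  have meas: "{x \<in> K. sqrt (sqnorm J x) \<le> r} \<in> sets ?L" for r
  proof -
    have "{x \<in> space ?L. sqrt (sqnorm J x) \<le> r} \<in> sets ?L" by measurable
    then have "K \<inter> {x \<in> space ?L. sqrt (sqnorm J x) \<le> r} \<in> sets ?L" using KL by auto
    also have "K \<inter> {x \<in> space ?L. sqrt (sqnorm J x) \<le> r} = {x \<in> K. sqrt (sqnorm J x) \<le> r}"
      using Ksp by (auto simp: space_PiM)
    finally show ?thesis .
  qed
  have meas': "{x \<in> K. sqrt (sqnorm J x) \<le> r} \<in> sets (PiM J (\<lambda>_. borel))" for r
    using meas unfolding sets_PiM_lborel .
  have sc: "sqrt (sqnorm J (\<lambda>i\<in>J. r * x i)) = r * sqrt (sqnorm J x)" for x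
  proof -
    have "sqnorm J (\<lambda>i\<in>J. r * x i) = r\<^sup>2 * sqnorm J x"
      unfolding sqnorm_def sum_distrib_left by (intro sum.cong) (simp_all add: power_mult_distrib)
    then show ?thesis using r by (simp add: real_sqrt_mult)
  qed
  have inK: "(\<lambda>i\<in>J. r * x i) \<in> K \<longleftrightarrow> x \<in> K" if x: "x \<in> J \<rightarrow>\<^sub>E UNIV" for x
  proof
    assume "(\<lambda>i\<in>J. r * x i) \<in> K"
    then have "(\<lambda>i\<in>J. 1 / r * (\<lambda>i\<in>J. r * x i) i) \<in> K" by (rule cone[rotated]) (use r in simp)
    also have "(\<lambda>i\<in>J. 1 / r * (\<lambda>i\<in>J. r * x i) i) = x"
      using r x by (auto simp: fun_eq_iff PiE_def extensional_def)
    finally show "x \<in> K" .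
  qed (rule cone[OF r])
  have "emeasure ?L {x \<in> K. sqrt (sqnorm J x) \<le> r} = (\<integral>\<^sup>+x. indicator {x \<in> K. sqrt (sqnorm J x) \<le> r} x \<partial>?L)"
    using meas by simp
  also have "\<dots> = ennreal (r ^ card J) * (\<integral>\<^sup>+x. indicator {x \<in> K. sqrt (sqnorm J x) \<le> r} (\<lambda>i\<in>J. r * x i) \<partial>?L)"
    by (rule nn_integral_PiM_lborel_scale[OF J r]) (rule borel_measurable_indicator[OF meas'])
  also have "(\<integral>\<^sup>+x. indicator {x \<in> K. sqrt (sqnorm J x) \<le> r} (\<lambda>i\<in>J. r * x i) \<partial>?L) = (\<integral>\<^sup>+x. indicator {x \<in> K. sqrt (sqnorm J x) \<le> 1} x \<partial>?L)"
  proof (rule nn_integral_cong)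
    fix x assume "x \<in> space ?L"
    then have x: "x \<in> J \<rightarrow>\<^sub>E UNIV" by (simp add: space_PiM)
    have "r * sqrt (sqnorm J x) \<le> r \<longleftrightarrow> sqrt (sqnorm J x) \<le> 1"
      using r mult_le_cancel_left_pos[of r "sqrt (sqnorm J x)" 1] by simp
    then show "indicator {x \<in> K. sqrt (sqnorm J x) \<le> r} (\<lambda>i\<in>J. r * x i) = (indicator {x \<in> K. sqrt (sqnorm J x) \<le> 1} x :: ennreal)"
      unfolding indicator_def mem_Collect_eq inK[OF x] sc by simp
  qed
  also have "\<dots> = emeasure ?L {x \<in> K. sqrt (sqnorm J x) \<le> 1}" by (rule nn_integral_indicator[OF meas])
  finally show ?thesis .
qed

lemma exp_tail_integral:
  assumes a: "0 \<le> a"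
  shows "(\<integral>\<^sup>+r. ennreal (r * exp (- r\<^sup>2 / 2)) * indicator {a..} r \<partial>lborel) = ennreal (exp (- a\<^sup>2 / 2))"
proof -
  have "(\<integral>\<^sup>+r. ennreal (r * exp (- r\<^sup>2 / 2)) * indicator {a..} r \<partial>lborel) = ennreal (0 - (- exp (- a\<^sup>2 / 2)))"
  proof (rule nn_integral_FTC_atLeast)
    show "((\<lambda>x. - exp (- x\<^sup>2 / 2)) has_real_derivative x * exp (- x\<^sup>2 / 2)) (at x)" for x :: real
      by (auto intro!: derivative_eq_intros)
    show "((\<lambda>x::real. - exp (- x\<^sup>2 / 2)) \<longlongrightarrow> 0) at_top" by real_asymp
  qed (use a in auto)
  then show ?thesis by simp
qed

text \<open>The ratio between the Gaussian measure of a cone in dimension \<open>k\<close> and the volume of its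
  intersection with the unit ball.\<close>

definition radial_const :: "nat \<Rightarrow> ennreal" where
  "radial_const k = (\<integral>\<^sup>+r. ennreal ((1 / sqrt (2 * pi)) ^ k * (r * exp (- r\<^sup>2 / 2)) * r ^ k) * indicator {0..} r \<partial>lborel)"

text \<open>The Gaussian density is a mixture of indicators of balls around the origin, and by homogeneity
  the part of a cone in a ball of radius \<open>r\<close> has volume proportional to \<open>r ^ k\<close>.\<close>

lemma gauss_cone:
  assumes J: "finite J" and K: "K \<in> sets (PiM J (\<lambda>_. borel :: real measure))"
    and cone: "\<And>r x. 0 < r \<Longrightarrow> x \<in> K \<Longrightarrow> (\<lambda>i\<in>J. r * x i) \<in> K"
  shows "emeasure (gauss J) K = radial_const (card J) * emeasure (PiM J (\<lambda>_. lborel)) {x \<in> K. sqrt (sqnorm J x) \<le> 1}"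
proof -
  let ?L = "PiM J (\<lambda>_. lborel :: real measure)" and ?k = "card J"
  define C where "C = (1 / sqrt (2 * pi)) ^ ?k"
  have C: "0 \<le> C" by (simp add: C_def)
  interpret L: sigma_finite_measure ?L by (rule lborels.sigma_finite[OF J])
  interpret P: pair_sigma_finite ?L "lborel :: real measure"
    by (simp add: pair_sigma_finite_def L.sigma_finite_measure_axioms sigma_finite_lborel)
  have Ksp: "K \<subseteq> J \<rightarrow>\<^sub>E UNIV" using sets.sets_into_space[OF K] by (simp add: space_PiM)
  have KL[measurable]: "K \<in> sets ?L" unfolding sets_PiM_lborel by (rule K)
  have "emeasure (gauss J) K = (\<integral>\<^sup>+x. indicator K x \<partial>gauss J)" using K by simp
  also have "\<dots> = (\<integral>\<^sup>+x. ennreal (C * exp (- sqnorm J x / 2)) * indicator K x \<partial>?L)"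
    unfolding C_def by (rule nn_integral_gauss[OF J borel_measurable_indicator[OF K]])
  also have "\<dots> = (\<integral>\<^sup>+x. \<integral>\<^sup>+r. ennreal C * indicator K x * (ennreal (r * exp (- r\<^sup>2 / 2)) * indicator {sqrt (sqnorm J x)..} r) \<partial>lborel \<partial>?L)"
  proof (rule nn_integral_cong)
    fix x
    have "(\<integral>\<^sup>+r. ennreal C * indicator K x * (ennreal (r * exp (- r\<^sup>2 / 2)) * indicator {sqrt (sqnorm J x)..} r) \<partial>lborel)
       = ennreal C * indicator K x * ennreal (exp (- (sqrt (sqnorm J x))\<^sup>2 / 2))"
      using exp_tail_integral[of "sqrt (sqnorm J x)"] by (subst nn_integral_cmult) auto
    then show "ennreal (C * exp (- sqnorm J x / 2)) * indicator K x = (\<integral>\<^sup>+r. ennreal C * indicator K x * (ennreal (r * exp (- r\<^sup>2 / 2)) * indicator {sqrt (sqnorm J x)..} r) \<partial>lborel)"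
      using C by (simp add: ennreal_mult' mult_ac)
  qed
  also have "\<dots> = (\<integral>\<^sup>+r. \<integral>\<^sup>+x. ennreal C * indicator K x * (ennreal (r * exp (- r\<^sup>2 / 2)) * indicator {sqrt (sqnorm J x)..} r) \<partial>?L \<partial>lborel)"
  proof (rule P.Fubini'[symmetric])
    have "(\<lambda>z. indicator {sqrt (sqnorm J (fst z))..} (snd z) :: ennreal) = (\<lambda>z. if sqrt (sqnorm J (fst z)) \<le> snd z then 1 else 0)"
      by (auto simp: indicator_def)
    then have [measurable]: "(\<lambda>z. indicator {sqrt (sqnorm J (fst z))..} (snd z) :: ennreal) \<in> borel_measurable (?L \<Otimes>\<^sub>M lborel)"
      by simp measurable
    show "(\<lambda>(x, r). ennreal C * indicator K x * (ennreal (r * exp (- r\<^sup>2 / 2)) * indicator {sqrt (sqnorm J x)..} r)) \<in> borel_measurable (?L \<Otimes>\<^sub>M lborel)"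
      unfolding split_beta' by measurable
  qed
  also have "\<dots> = (\<integral>\<^sup>+r. ennreal (C * (r * exp (- r\<^sup>2 / 2)) * r ^ ?k) * indicator {0..} r * emeasure ?L {x \<in> K. sqrt (sqnorm J x) \<le> 1} \<partial>lborel)"
  proof (rule nn_integral_cong)
    fix r :: real
    let ?B = "\<lambda>r. {x \<in> K. sqrt (sqnorm J x) \<le> r}"
    show "(\<integral>\<^sup>+x. ennreal C * indicator K x * (ennreal (r * exp (- r\<^sup>2 / 2)) * indicator {sqrt (sqnorm J x)..} r) \<partial>?L)
      = ennreal (C * (r * exp (- r\<^sup>2 / 2)) * r ^ ?k) * indicator {0..} r * emeasure ?L (?B 1)"
    proof (cases "0 < r")
      case True
      have "{x \<in> space ?L. sqrt (sqnorm J x) \<le> r} \<in> sets ?L" by measurable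
      then have "K \<inter> {x \<in> space ?L. sqrt (sqnorm J x) \<le> r} \<in> sets ?L" using KL by auto
      also have "K \<inter> {x \<in> space ?L. sqrt (sqnorm J x) \<le> r} = ?B r"
        using Ksp by (auto simp: space_PiM)
      finally have Br: "?B r \<in> sets ?L" .
      have "(\<integral>\<^sup>+x. ennreal C * indicator K x * (ennreal (r * exp (- r\<^sup>2 / 2)) * indicator {sqrt (sqnorm J x)..} r) \<partial>?L)
        = (\<integral>\<^sup>+x. ennreal (C * (r * exp (- r\<^sup>2 / 2))) * indicator (?B r) x \<partial>?L)"
        using C by (intro nn_integral_cong) (auto simp: indicator_def ennreal_mult')
      also have "\<dots> = ennreal (C * (r * exp (- r\<^sup>2 / 2))) * emeasure ?L (?B r)"
        using Br by (rule nn_integral_cmult_indicator)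
      also have "emeasure ?L (?B r) = ennreal (r ^ ?k) * emeasure ?L (?B 1)"
        by (rule emeasure_cone_ball[OF J K cone True])
      finally show ?thesis using True C by (simp add: ennreal_mult' mult.assoc)
    next
      case False
      then have "ennreal (r * exp (- r\<^sup>2 / 2)) = 0" by (simp add: ennreal_neg mult_nonpos_nonneg)
      moreover have "ennreal (C * (r * exp (- r\<^sup>2 / 2)) * r ^ ?k) * indicator {0..} r = 0"
        using False by (cases "r = 0") (auto simp: indicator_def)
      ultimately show ?thesis by simp
    qed
  qed
  also have "\<dots> = radial_const ?k * emeasure ?L {x \<in> K. sqrt (sqnorm J x) \<le> 1}"
    unfolding radial_const_def C_def[symmetric] by (rule nn_integral_multc) auto
  finally show ?thesis .
qed

text \<open>The solid cone over the section of \<open>K\<close> with the sphere and the section of \<open>K\<close> with the ball differ at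
  most in the origin, which the solid cone contains if and only if the spherical set is nonempty.\<close>

lemma solid_cone_measure:
  fixes K :: "(nat \<Rightarrow> real) set"
  assumes K: "K \<in> sets (PiM {..l} (\<lambda>_. borel))"
    and cone: "\<And>r x. 0 < r \<Longrightarrow> x \<in> K \<Longrightarrow> (\<lambda>i\<in>{..l}. r * x i) \<in> K"
  shows "measure (PiM {..l} (\<lambda>_. lborel)) {(\<lambda>i\<in>{..l}. r * x i) | r x. 0 \<le> r \<and> r \<le> 1 \<and> x \<in> unit_sphere l \<inter> K}
    = measure (PiM {..l} (\<lambda>_. lborel)) {x \<in> K. sqrt (sqnorm {..l} x) \<le> 1}"
    (is "measure ?L ?T = measure ?L ?K1")
proof -
  let ?J = "{..l}" and ?q = "sqnorm {..l}"
  have us: "x \<in> unit_sphere l \<longleftrightarrow> x \<in> ?J \<rightarrow>\<^sub>E UNIV \<and> ?q x = 1" for x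
    by (simp add: unit_sphere_def sqnorm_def)
  have Ksp: "K \<subseteq> ?J \<rightarrow>\<^sub>E UNIV" using sets.sets_into_space[OF K] by (simp add: space_PiM)
  have KL: "K \<in> sets ?L" unfolding sets_PiM_lborel by (rule K)
  define Z where "Z = {x \<in> space ?L. sqrt (?q x) \<le> 0}"
  define B where "B = {x \<in> space ?L. sqrt (?q x) \<le> 1}"
  have ZB: "Z \<in> sets ?L" "B \<in> sets ?L" unfolding Z_def B_def by measurable
  have Z0: "emeasure ?L Z = 0" unfolding Z_def using emeasure_ball[of ?J 0] by simp
  have K1: "?K1 = K \<inter> B" using Ksp by (auto simp: B_def space_PiM)
  have sc: "?q (\<lambda>i\<in>?J. r * x i) = r\<^sup>2 * ?q x" for r x
    unfolding sqnorm_def sum_distrib_left by (intro sum.cong) (simp_all add: power_mult_distrib)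
  have T: "?T - Z = ?K1 - Z"
  proof (intro equalityI subsetI)
    fix y assume "y \<in> ?T - Z"
    then obtain r x where y: "y = (\<lambda>i\<in>?J. r * x i)" and r: "0 \<le> r" "r \<le> 1" and x: "x \<in> K" "?q x = 1" and yZ: "y \<notin> Z"
      by (auto simp: us)
    have "y \<in> space ?L" by (simp add: y space_PiM)
    then have "r \<noteq> 0" using yZ sc[of r x] by (auto simp: Z_def y)
    then have "0 < r" using r by simp
    then have "y \<in> K" unfolding y using x by (intro cone)
    moreover have "sqrt (?q y) \<le> 1" using r x by (simp add: y sc real_sqrt_mult)
    ultimately show "y \<in> ?K1 - Z" using yZ by simp
  next
    fix y assume y: "y \<in> ?K1 - Z"
    then have yJ: "y \<in> ?J \<rightarrow>\<^sub>E UNIV" using Ksp by auto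
    define q where "q = sqrt (?q y)"
    have q: "0 < q" "q \<le> 1" using y yJ by (auto simp: Z_def space_PiM q_def not_le)
    have q2: "?q y = q\<^sup>2" by (simp add: q_def)
    define x where "x = (\<lambda>i\<in>?J. (1 / q) * y i)"
    have "x \<in> K" unfolding x_def using y q by (intro cone) auto
    moreover have "?q x = 1" unfolding x_def sc q2 using q by (simp add: power_divide)
    ultimately have "x \<in> unit_sphere l \<inter> K" using Ksp us by auto
    moreover have "y = (\<lambda>i\<in>?J. q * x i)"
      using q yJ by (auto simp: fun_eq_iff x_def PiE_def extensional_def)
    ultimately have "y \<in> ?T" using q by (intro CollectI exI[of _ q] exI[of _ x] conjI) auto
    then show "y \<in> ?T - Z" using y by blast
  qed
  have TZ: "?T \<inter> Z = {} \<or> ?T \<inter> Z = Z"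
  proof (cases "unit_sphere l \<inter> K = {}")
    case True then show ?thesis by auto
  next
    case False
    then obtain x where x: "x \<in> unit_sphere l \<inter> K" by auto
    have "z \<in> ?T" if "z \<in> Z" for z
    proof -
      have zJ: "z \<in> ?J \<rightarrow>\<^sub>E UNIV" and "?q z \<le> 0" using that by (auto simp: Z_def space_PiM)
      then have "?q z = 0" using sqnorm_nonneg[of ?J z] by linarith
      then have "z i = 0" if "i \<in> ?J" for i
        using that by (simp add: sqnorm_def sum_nonneg_eq_0_iff)
      then have "z = (\<lambda>i\<in>?J. 0 * x i)" using zJ by (auto simp: fun_eq_iff PiE_def extensional_def)
      then show ?thesis using x by (intro CollectI exI[of _ 0] exI[of _ x]) auto
    qed
    then show ?thesis by auto
  qed
  have K1s: "?K1 \<in> sets ?L" unfolding K1 using KL ZB by auto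
  have Teq: "(?K1 - Z) \<union> (?T \<inter> Z) = ?T" using T by blast
  have "?T \<inter> Z \<in> sets ?L" using TZ by (elim disjE) (simp_all only: sets.empty_sets ZB)
  then have "(?K1 - Z) \<union> (?T \<inter> Z) \<in> sets ?L" using K1s ZB(1) by (intro sets.Un sets.Diff)
  then have Ts: "?T \<in> sets ?L" unfolding Teq .
  have "emeasure ?L ?T = emeasure ?L (?T - Z)"
    using emeasure_Diff_null_set[of Z ?L ?T] Z0 ZB Ts by (simp add: null_sets_def)
  also have "\<dots> = emeasure ?L (?K1 - Z)" unfolding T ..
  also have "\<dots> = emeasure ?L ?K1"
    using emeasure_Diff_null_set[of Z ?L ?K1] Z0 ZB K1s by (simp add: null_sets_def)
  finally show ?thesis by (simp add: measure_def)
qed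

text \<open>Applied to \<open>K\<close> and to the whole space, the preceding proportionality gives the claim; the constant
  cancels.\<close>

theorem relative_volume_cone:
  fixes K :: "(nat \<Rightarrow> real) set"
  assumes K: "K \<in> sets (PiM {..l} (\<lambda>_. borel))"
    and cone: "\<And>r x. 0 < r \<Longrightarrow> x \<in> K \<Longrightarrow> (\<lambda>i\<in>{..l}. r * x i) \<in> K"
  shows "relative_volume l (unit_sphere l \<inter> K) = measure (gauss {..l}) K"
proof -
  let ?L = "PiM {..l} (\<lambda>_. lborel :: real measure)" and ?J = "{..l}"
  let ?U = "?J \<rightarrow>\<^sub>E (UNIV :: real set)"
  define d where "d = enn2real (radial_const (card ?J))"
  have U: "?U \<in> sets (PiM ?J (\<lambda>_. borel))" using sets.top[of "PiM ?J (\<lambda>_. borel :: real measure)"] by (simp add: space_PiM)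
  have coneU: "(\<lambda>i\<in>?J. r * x i) \<in> ?U" for r :: real and x by simp
  have m: "measure (gauss ?J) A = d * measure ?L {x \<in> A. sqrt (sqnorm ?J x) \<le> 1}"
    if "A \<in> sets (PiM ?J (\<lambda>_. borel))" "\<And>r x. 0 < r \<Longrightarrow> x \<in> A \<Longrightarrow> (\<lambda>i\<in>?J. r * x i) \<in> A" for A :: "(nat \<Rightarrow> real) set"
    unfolding measure_def d_def using gauss_cone[of ?J A] that by (simp add: enn2real_mult)
  have "1 = measure (gauss ?J) ?U"
    using prob_space.prob_space[OF prob_space_gauss, of ?J] by simp
  then have one: "1 = d * measure ?L {x \<in> ?U. sqrt (sqnorm ?J x) \<le> 1}"
    using m[OF U] coneU by simp
  have us: "unit_sphere l \<inter> ?U = unit_sphere l" by (auto simp: unit_sphere_def)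
  have s1: "sphere_volume l (unit_sphere l) = real (l + 1) * measure ?L {x \<in> ?U. sqrt (sqnorm ?J x) \<le> 1}"
    using solid_cone_measure[OF U coneU] unfolding us sphere_volume_def by simp
  have s2: "sphere_volume l (unit_sphere l \<inter> K) = real (l + 1) * measure ?L {x \<in> K. sqrt (sqnorm ?J x) \<le> 1}"
  proof -
    have "measure ?L {(\<lambda>i\<in>?J. r * x i) | r x. 0 \<le> r \<and> r \<le> 1 \<and> x \<in> unit_sphere l \<inter> K} = measure ?L {x \<in> K. sqrt (sqnorm ?J x) \<le> 1}"
      by (rule solid_cone_measure[OF K]) (rule cone)
    then show ?thesis unfolding sphere_volume_def by simp
  qed
  have mK: "measure (gauss ?J) K = d * measure ?L {x \<in> K. sqrt (sqnorm ?J x) \<le> 1}"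
    by (rule m[OF K]) (rule cone)
  define b where "b = measure ?L {x \<in> ?U. sqrt (sqnorm ?J x) \<le> 1}"
  have b: "d * b = 1" using one by (simp add: b_def)
  then have "b \<noteq> 0" by auto
  moreover from this have "d = 1 / b" using b by (simp add: field_simps)
  ultimately show ?thesis
    unfolding relative_volume_def s1 s2 mK b_def[symmetric] by simp
qed

section \<open>The smallest eigenvalue as a Rayleigh quotient\<close>

definition bilin :: "nat \<Rightarrow> (nat \<Rightarrow> nat \<Rightarrow> real) \<Rightarrow> (nat \<Rightarrow> real) \<Rightarrow> (nat \<Rightarrow> real) \<Rightarrow> real" where
  "bilin n a v w = (\<Sum>i<n. \<Sum>j<n. v i * (a i j * w j))"

text \<open>Variation of the form in a direction \<open>e\<close>.\<close>

lemma bilin_add_scale: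
  assumes "\<And>i j. a i j = a j i"
  shows "bilin n a (\<lambda>i. v i + t * e i) (\<lambda>i. v i + t * e i) = bilin n a v v + 2 * t * bilin n a e v + t\<^sup>2 * bilin n a e e"
proof -
  have sym: "bilin n a v e = bilin n a e v"
    unfolding bilin_def by (subst sum.swap) (simp add: assms mult_ac)
  have "bilin n a (\<lambda>i. v i + t * e i) (\<lambda>i. v i + t * e i) = bilin n a v v + t * bilin n a v e + t * bilin n a e v + t\<^sup>2 * bilin n a e e"
    unfolding bilin_def sum_distrib_left sum.distrib[symmetric]
    by (intro sum.cong refl) (simp add: algebra_simps power2_eq_square)
  then show ?thesis by (simp add: sym)
qed

lemma bilin_scale: "bilin n a (\<lambda>i. c * v i) (\<lambda>i. c * v i) = c\<^sup>2 * bilin n a v v"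
  unfolding bilin_def sum_distrib_left by (intro sum.cong refl) (simp add: power2_eq_square mult_ac)

lemma dot_scale: "dot n (\<lambda>i. c * v i) (\<lambda>i. c * v i) = c\<^sup>2 * dot n v v"
  unfolding dot_def sum_distrib_left by (intro sum.cong refl) (simp add: power2_eq_square mult_ac)

lemma dot_add_scale: "dot n (\<lambda>i. v i + t * e i) (\<lambda>i. v i + t * e i) = dot n v v + 2 * t * dot n e v + t\<^sup>2 * dot n e e"
  unfolding dot_def sum_distrib_left sum.distrib[symmetric]
  by (intro sum.cong refl) (simp add: algebra_simps power2_eq_square)

lemma dot_pos_imp_normalized:
  assumes "0 < dot n w w"
  shows "(\<lambda>i. 1 / sqrt (dot n w w) * w i) \<in> sphere_vecs n"
  using assms by (simp only: sphere_vecs_def mem_Collect_eq dot_scale) (simp add: power_divide)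

lemma dot_zero_imp: "dot n w w = 0 \<Longrightarrow> i < n \<Longrightarrow> w i = 0"
  unfolding dot_def by (subst (asm) sum_nonneg_eq_0_iff) auto

lemma bilin_zero: "dot n w w = 0 \<Longrightarrow> bilin n a w w = 0"
  unfolding bilin_def using dot_zero_imp[of n w] by simp

lemma quadratic_nonneg_imp_linear_zero:
  fixes b c :: real
  assumes "\<And>t. 0 \<le> 2 * t * b + t\<^sup>2 * c"
  shows "b = 0"
proof (rule ccontr)
  assume b: "b \<noteq> 0"
  define d where "d = \<bar>c\<bar> + 1"
  have d: "0 < d" "c < d" by (auto simp: d_def)
  have "0 \<le> 2 * (- b / d) * b + (- b / d)\<^sup>2 * c" by (rule assms)
  also have "\<dots> = b\<^sup>2 / d\<^sup>2 * (c - 2 * d)" using d by (simp add: field_simps power2_eq_square)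
  finally have "0 \<le> b\<^sup>2 / d\<^sup>2 * (c - 2 * d)" .
  moreover have "0 < b\<^sup>2 / d\<^sup>2" using b d by simp
  then have "b\<^sup>2 / d\<^sup>2 * (c - 2 * d) < 0" using d by (intro mult_pos_neg) auto
  ultimately show False by simp
qed

text \<open>The unit sphere is a closed subset of a product of compact intervals. As the form sees only the
  coordinates below \<open>n\<close>, the others may be set to 0, which makes the sphere compact.\<close>

lemma rayleigh_minimizer:
  assumes n: "1 \<le> n"
  obtains v where "dot n v v = 1" "\<And>w. bilin n a v v * dot n w w \<le> bilin n a w w"
proof -
  define S where "S = (\<lambda>i. if i < n then {-1..1} else {0 :: real})"
  define W where "W = {v \<in> PiE UNIV S. dot n v v = 1}"
  have "compactin (product_topology (\<lambda>_. euclidean) UNIV) (PiE UNIV S)"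
    by (subst compactin_PiE) (auto simp: S_def)
  then have box: "compact (PiE UNIV S)" by (simp add: euclidean_product_topology)
  have cont: "continuous_on A (\<lambda>v. dot n v v)" "continuous_on A (\<lambda>v. bilin n a v v)" for A
    unfolding dot_def bilin_def by (intro continuous_intros continuous_on_product_coordinates; auto intro: continuous_on_subset[OF continuous_on_product_coordinates])+
  have "closed {v. dot n v v = 1}"
    by (intro closed_Collect_eq cont continuous_intros)
  then have "compact (PiE UNIV S \<inter> {v. dot n v v = 1})" by (rule compact_Int_closed[OF box])
  moreover have "PiE UNIV S \<inter> {v. dot n v v = 1} = W" by (auto simp: W_def)
  ultimately have "compact W" by simp
  moreover have "W \<noteq> {}"
  proof -
    have "dot n (\<lambda>i. if i = 0 then 1 else 0) (\<lambda>i. if i = 0 then 1 else 0) = 1"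
      using n by (simp add: dot_def if_distrib cong: if_cong)
    then have "(\<lambda>i. if i = 0 then 1 else 0) \<in> W" using n by (auto simp: W_def S_def PiE_def Pi_def)
    then show ?thesis by auto
  qed
  ultimately obtain v where v: "v \<in> W" and min: "\<And>w. w \<in> W \<Longrightarrow> bilin n a v v \<le> bilin n a w w"
    using continuous_attains_inf[of W "\<lambda>v. bilin n a v v"] cont(2) by blast
  show ?thesis
  proof (rule that[of v])
    show "dot n v v = 1" using v by (simp add: W_def)
    fix w
    show "bilin n a v v * dot n w w \<le> bilin n a w w"
    proof (cases "dot n w w = 0")
      case True then show ?thesis using bilin_zero[of n w a] by simp
    next
      case False
      then have d: "0 < dot n w w" using dot_nonneg[of n w] by simp
      define u where "u = (\<lambda>i. 1 / sqrt (dot n w w) * w i)"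
      define u' where "u' = (\<lambda>i. if i < n then u i else 0)"
      have u1: "dot n u u = 1" using dot_pos_imp_normalized[OF d] by (simp add: u_def sphere_vecs_def)
      have uu: "dot n u' u' = dot n u u" "bilin n a u' u' = bilin n a u u"
        unfolding dot_def bilin_def by (auto intro!: sum.cong simp: u'_def)
      have "\<bar>u i\<bar> \<le> 1" if "i < n" for i
      proof -
        have "u i * u i \<le> dot n u u" unfolding dot_def using that by (intro member_le_sum) auto
        then show ?thesis using u1 by (simp add: abs_square_le_1[symmetric] power2_eq_square)
      qed
      then have "u' \<in> PiE UNIV S" by (auto simp: S_def u'_def abs_le_iff PiE_def Pi_def)
      then have "u' \<in> W" using uu u1 by (simp add: W_def)
      then have "bilin n a v v \<le> (1 / sqrt (dot n w w))\<^sup>2 * bilin n a w w"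
        using min[of u'] uu(2) bilin_scale[of n a "1 / sqrt (dot n w w)" w] by (simp add: u_def)
      then show ?thesis using d by (simp add: power_divide field_simps)
    qed
  qed
qed

text \<open>The form \<open>bilin n a w w - m * dot n w w\<close> is nonnegative and vanishes at \<open>v\<close>, so its first variation at
  \<open>v\<close> vanishes in every coordinate direction.\<close>

lemma rayleigh_minimizer_eigenvector:
  assumes sym: "\<And>i j. a i j = a j i" and v: "dot n v v = 1" and min: "\<And>w. bilin n a v v * dot n w w \<le> bilin n a w w" and k: "k < n"
  shows "(\<Sum>j<n. a k j * v j) = bilin n a v v * v k"
proof -
  define e where "e = (\<lambda>i. if i = k then 1 else 0 :: real)"
  let ?m = "bilin n a v v"
  have ev: "bilin n a e v = (\<Sum>j<n. a k j * v j)"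
  proof -
    have "bilin n a e v = (\<Sum>i<n. if i = k then \<Sum>j<n. a k j * v j else 0)"
      unfolding bilin_def by (intro sum.cong refl) (auto simp: e_def)
    then show ?thesis using k by simp
  qed
  have dv: "dot n e v = v k"
  proof -
    have "dot n e v = (\<Sum>i<n. if i = k then v k else 0)" unfolding dot_def by (intro sum.cong refl) (auto simp: e_def)
    then show ?thesis using k by simp
  qed
  have "0 \<le> 2 * t * (bilin n a e v - ?m * v k) + t\<^sup>2 * (bilin n a e e - ?m * dot n e e)" for t
    using min[of "\<lambda>i. v i + t * e i"] unfolding bilin_add_scale[of a n v t e, OF sym] dot_add_scale v dv
    by (simp add: algebra_simps)
  then have "bilin n a e v - ?m * v k = 0" by (rule quadratic_nonneg_imp_linear_zero)
  then show ?thesis using ev by simp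
qed

lemma quadratic_form_vec:
  assumes A: "A \<in> carrier_mat n n" and v: "v \<in> carrier_vec n"
  shows "v \<bullet> (A *\<^sub>v v) = bilin n (\<lambda>i j. A $$ (i, j)) (\<lambda>i. v $ i) (\<lambda>i. v $ i)"
proof -
  have "v \<bullet> (A *\<^sub>v v) = (\<Sum>i<n. v $ i * (A *\<^sub>v v) $ i)"
    using A v by (auto simp: scalar_prod_def lessThan_atLeast0 intro!: sum.cong)
  also have "\<dots> = (\<Sum>i<n. v $ i * (\<Sum>j<n. A $$ (i, j) * v $ j))"
  proof (intro sum.cong refl)
    fix i assume "i \<in> {..<n}"
    then have "(A *\<^sub>v v) $ i = (\<Sum>j<n. A $$ (i, j) * v $ j)"
      using A v by (auto simp: scalar_prod_def lessThan_atLeast0 intro!: sum.cong)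
    then show "v $ i * (A *\<^sub>v v) $ i = v $ i * (\<Sum>j<n. A $$ (i, j) * v $ j)" by simp
  qed
  finally show ?thesis by (simp add: bilin_def sum_distrib_left)
qed

lemma sym_mats_iff: "A \<in> sym_mats n \<longleftrightarrow> A \<in> carrier_mat n n \<and> (\<forall>i<n. \<forall>j<n. A $$ (i, j) = A $$ (j, i))"
proof
  assume "A \<in> sym_mats n"
  then have A: "A \<in> carrier_mat n n" "transpose_mat A = A" by (auto simp: sym_mats_def)
  have "A $$ (i, j) = A $$ (j, i)" if "i < n" "j < n" for i j
    using arg_cong[OF A(2), of "\<lambda>B. B $$ (i, j)"] A(1) that by simp
  then show "A \<in> carrier_mat n n \<and> (\<forall>i<n. \<forall>j<n. A $$ (i, j) = A $$ (j, i))" using A by blast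
next
  assume *: "A \<in> carrier_mat n n \<and> (\<forall>i<n. \<forall>j<n. A $$ (i, j) = A $$ (j, i))"
  then have "transpose_mat A = A" by (intro eq_matI) auto
  then show "A \<in> sym_mats n" using * by (simp add: sym_mats_def)
qed

lemma bilin_cong: "(\<And>i j. i < n \<Longrightarrow> j < n \<Longrightarrow> a i j = b i j) \<Longrightarrow> (\<And>i. i < n \<Longrightarrow> v i = v' i) \<Longrightarrow> bilin n a v v = bilin n b v' v'"
  unfolding bilin_def by (intro sum.cong refl) auto

text \<open>The minimum of the Rayleigh quotient is an eigenvalue, and it is a lower bound of the others.\<close>

lemma min_eigenvalue_ge_iff:
  assumes A: "A \<in> sym_mats n" and n: "1 \<le> n"
  shows "t \<le> min_eigenvalue A \<longleftrightarrow> (\<forall>w. t * dot n w w \<le> bilin n (\<lambda>i j. A $$ (i, j)) w w)"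
proof -
  have Ac: "A \<in> carrier_mat n n" using A by (simp add: sym_mats_def)
  define a where "a = (\<lambda>i j. if i < n \<and> j < n then A $$ (i, j) else 0)"
  have a: "a i j = a j i" for i j using A by (auto simp: a_def sym_mats_iff)
  have aA: "bilin n (\<lambda>i j. A $$ (i, j)) w w = bilin n a w w" for w
    by (rule bilin_cong) (auto simp: a_def)
  obtain v where v: "dot n v v = 1" and min: "\<And>w. bilin n a v v * dot n w w \<le> bilin n a w w"
    using rayleigh_minimizer[OF n, of a] by blast
  define m where "m = bilin n a v v"
  have ev: "(\<Sum>j<n. a k j * v j) = m * v k" if "k < n" for k
    unfolding m_def by (rule rayleigh_minimizer_eigenvector[OF a v min that])
  have "eigenvector A (Matrix.vec n v) m"
    unfolding eigenvector_def
  proof (intro conjI)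
    show "Matrix.vec n v \<in> carrier_vec (dim_row A)" using Ac by simp
    show "Matrix.vec n v \<noteq> 0\<^sub>v (dim_row A)"
    proof
      assume "Matrix.vec n v = 0\<^sub>v (dim_row A)"
      then have "v i = 0" if "i < n" for i using Ac that arg_cong[of _ _ "\<lambda>u. u $ i"] by (metis carrier_matD(1) index_vec index_zero_vec(1))
      then have "dot n v v = 0" by (simp add: dot_def)
      then show False using v by simp
    qed
    show "A *\<^sub>v Matrix.vec n v = m \<cdot>\<^sub>v Matrix.vec n v"
    proof (rule eq_vecI)
      fix i assume "i < dim_vec (m \<cdot>\<^sub>v Matrix.vec n v)"
      then have i: "i < n" by simp
      have "(A *\<^sub>v Matrix.vec n v) $ i = (\<Sum>j<n. a i j * v j)"
        using Ac i by (auto simp: scalar_prod_def lessThan_atLeast0 a_def intro!: sum.cong)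
      then show "(A *\<^sub>v Matrix.vec n v) $ i = (m \<cdot>\<^sub>v Matrix.vec n v) $ i" using ev[OF i] i by simp
    qed (use Ac in simp)
  qed
  then have msp: "m \<in> spectrum A" by (auto simp: spectrum_def eigenvalue_def)
  have fin: "finite (spectrum A)" using card_finite_spectrum[OF Ac] by simp
  have le: "m \<le> \<mu>" if "\<mu> \<in> spectrum A" for \<mu>
  proof -
    from that obtain u where "eigenvector A u \<mu>" unfolding spectrum_def eigenvalue_def by blast
    then have u: "u \<in> carrier_vec n" "u \<noteq> 0\<^sub>v n" "A *\<^sub>v u = \<mu> \<cdot>\<^sub>v u"
      unfolding eigenvector_def carrier_matD(1)[OF Ac] by auto
    let ?w = "\<lambda>i. u $ i"
    have "bilin n a ?w ?w = u \<bullet> (\<mu> \<cdot>\<^sub>v u)" using quadratic_form_vec[OF Ac u(1)] u(3) aA by simp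
    also have "\<dots> = \<mu> * dot n ?w ?w" using u(1) by (simp add: scalar_prod_def dot_def lessThan_atLeast0 sum_distrib_left mult_ac)
    finally have q: "bilin n a ?w ?w = \<mu> * dot n ?w ?w" .
    have "dot n ?w ?w \<noteq> 0"
    proof
      assume z: "dot n ?w ?w = 0"
      have "u $ i = 0" if "i < n" for i by (rule dot_zero_imp[OF z that])
      then have "u = 0\<^sub>v n" using carrier_vecD[OF u(1)] by (intro eq_vecI) simp_all
      then show False using u(2) by simp
    qed
    then have "0 < dot n ?w ?w" using dot_nonneg[of n ?w] by simp
    then show ?thesis using min[of ?w] q by (simp add: m_def)
  qed
  have "min_eigenvalue A = m" unfolding min_eigenvalue_def by (rule Min_eqI[OF fin le msp])
  moreover have "t \<le> m \<longleftrightarrow> (\<forall>w. t * dot n w w \<le> bilin n a w w)"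
  proof
    assume "t \<le> m"
    then show "\<forall>w. t * dot n w w \<le> bilin n a w w"
      using min dot_nonneg unfolding m_def by (meson mult_right_mono order_trans)
  next
    assume "\<forall>w. t * dot n w w \<le> bilin n a w w"
    then have "t * dot n v v \<le> m" unfolding m_def by blast
    then show "t \<le> m" using v by simp
  qed
  ultimately show ?thesis unfolding aA by simp
qed

text \<open>The quadratic form of the symmetric matrix whose entries on and above the diagonal are \<open>B\<close>.\<close>

definition pform :: "nat \<Rightarrow> (nat \<times> nat \<Rightarrow> real) \<Rightarrow> (nat \<Rightarrow> real) \<Rightarrow> real" where
  "pform n B w = (\<Sum>p\<in>upper_pairs n. (if fst p = snd p then 1 else 2) * (B p * (w (fst p) * w (snd p))))"

lemma pform_sym_mat:
  assumes "A \<in> sym_mats n"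
  shows "bilin n (\<lambda>i j. A $$ (i, j)) w w = pform n (\<lambda>p. A $$ p) w"
proof -
  define a where "a = (\<lambda>i j. if i < n \<and> j < n then A $$ (i, j) else 0)"
  have a: "a i j = a j i" for i j using assms by (auto simp: a_def sym_mats_iff)
  have "bilin n (\<lambda>i j. A $$ (i, j)) w w = (\<Sum>i<n. \<Sum>j<n. a i j * (w i * w j))"
    unfolding bilin_def by (intro sum.cong refl) (auto simp: a_def)
  also have "\<dots> = (\<Sum>(i, j)\<in>upper_pairs n. if i = j then a i j * (w i * w j) else 2 * (a i j * (w i * w j)))"
    by (rule sum_symmetric_upper_pairs) (simp add: a mult.commute)
  also have "\<dots> = pform n (\<lambda>p. A $$ p) w"
    unfolding pform_def by (intro sum.cong refl) (auto simp: a_def upper_pairs_def)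
  finally show ?thesis .
qed

lemma pform_cong: "(\<And>p. p \<in> upper_pairs n \<Longrightarrow> B p = B' p) \<Longrightarrow> pform n B w = pform n B' w"
  unfolding pform_def by (intro sum.cong refl) auto

lemma pform_restrict [simp]: "pform n (restrict B (upper_pairs n)) w = pform n B w"
  by (rule pform_cong) auto

lemma pform_scale: "pform n (\<lambda>p. c * B p) w = c * pform n B w"
  unfolding pform_def sum_distrib_left by (intro sum.cong refl) auto

lemma pform_scale_vec: "pform n B (\<lambda>i. c * w i) = c\<^sup>2 * pform n B w"
  unfolding pform_def sum_distrib_left by (intro sum.cong refl) (auto simp: power2_eq_square)

definition entry_sd :: "nat \<times> nat \<Rightarrow> real" where
  "entry_sd p = (if fst p = snd p then 1 else sqrt (1 / 2))"

lemma entry_sd_pos: "0 < entry_sd p" by (simp add: entry_sd_def)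

lemma pform_entry_sd: "pform n (\<lambda>p. entry_sd p * \<xi> p) w = lin_form (upper_pairs n) (qcoef w) \<xi>"
proof -
  have "2 * sqrt (1 / 2) = sqrt 2" by (simp add: real_sqrt_divide real_div_sqrt)
  then show ?thesis
    unfolding pform_def lin_form_def
    by (intro sum.cong refl) (auto simp: entry_sd_def qcoef_def split: prod.splits)
qed

lemma psd_cone_iff:
  assumes "A \<in> sym_mats n"
  shows "A \<in> psd_cone n \<longleftrightarrow> (\<forall>w. 0 \<le> pform n (\<lambda>p. A $$ p) w)"
proof -
  have Ac: "A \<in> carrier_mat n n" using assms by (simp add: sym_mats_def)
  have "A \<in> psd_cone n \<longleftrightarrow> (\<forall>v\<in>carrier_vec n. 0 \<le> pform n (\<lambda>p. A $$ p) (\<lambda>i. v $ i))"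
    using assms quadratic_form_vec[OF Ac] pform_sym_mat[OF assms] by (auto simp: psd_cone_def)
  also have "\<dots> \<longleftrightarrow> (\<forall>w. 0 \<le> pform n (\<lambda>p. A $$ p) w)"
  proof (intro iffI allI ballI)
    fix w :: "nat \<Rightarrow> real"
    assume "\<forall>v\<in>carrier_vec n. 0 \<le> pform n (\<lambda>p. A $$ p) (\<lambda>i. v $ i)"
    then have "0 \<le> pform n (\<lambda>p. A $$ p) (\<lambda>i. Matrix.vec n w $ i)" by (rule bspec) simp
    also have "\<dots> = pform n (\<lambda>p. A $$ p) w"
      unfolding pform_def by (intro sum.cong refl) (auto simp: upper_pairs_def)
    finally show "0 \<le> pform n (\<lambda>p. A $$ p) w" .
  qed auto
  finally show ?thesis .
qed

lemma min_eigenvalue_neg_min_form: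
  assumes A: "A \<in> sym_mats n" and n: "1 \<le> n" and \<xi>: "\<And>p. p \<in> upper_pairs n \<Longrightarrow> A $$ p = entry_sd p * \<xi> p"
  shows "min_eigenvalue A = - neg_min_form n \<xi>"
proof -
  have pf: "bilin n (\<lambda>i j. A $$ (i, j)) w w = lin_form (upper_pairs n) (qcoef w) \<xi>" for w
    unfolding pform_sym_mat[OF A] pform_entry_sd[symmetric] by (rule pform_cong) (rule \<xi>)
  have neg: "lin_form (upper_pairs n) (\<lambda>p. - qcoef w p) \<xi> = - lin_form (upper_pairs n) (qcoef w) \<xi>" for w
    unfolding lin_form_def by (simp add: sum_negf)
  have "t \<le> min_eigenvalue A \<longleftrightarrow> t \<le> - neg_min_form n \<xi>" for t
  proof -
    have "t \<le> min_eigenvalue A \<longleftrightarrow> (\<forall>w. t * dot n w w \<le> bilin n (\<lambda>i j. A $$ (i, j)) w w)"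
      by (rule min_eigenvalue_ge_iff[OF A n])
    also have "\<dots> \<longleftrightarrow> (\<forall>w\<in>sphere_vecs n. t \<le> bilin n (\<lambda>i j. A $$ (i, j)) w w)"
    proof (intro iffI ballI allI)
      fix w assume "\<forall>w. t * dot n w w \<le> bilin n (\<lambda>i j. A $$ (i, j)) w w" "w \<in> sphere_vecs n"
      then show "t \<le> bilin n (\<lambda>i j. A $$ (i, j)) w w" by (auto simp: sphere_vecs_def dest: spec[of _ w])
    next
      fix w :: "nat \<Rightarrow> real"
      assume *: "\<forall>w\<in>sphere_vecs n. t \<le> bilin n (\<lambda>i j. A $$ (i, j)) w w"
      show "t * dot n w w \<le> bilin n (\<lambda>i j. A $$ (i, j)) w w"
      proof (cases "dot n w w = 0")
        case True then show ?thesis using bilin_zero[OF True] by simp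
      next
        case False
        then have d: "0 < dot n w w" using dot_nonneg[of n w] by simp
        from bspec[OF * dot_pos_imp_normalized[OF d]] have "t \<le> (1 / sqrt (dot n w w))\<^sup>2 * bilin n (\<lambda>i j. A $$ (i, j)) w w"
          unfolding bilin_scale .
        then show ?thesis using d by (simp add: power_divide field_simps)
      qed
    qed
    also have "\<dots> \<longleftrightarrow> neg_min_form n \<xi> \<le> - t"
      unfolding neg_min_form_def sup_form_le_iff[OF gauss_family_neg[OF n]] neg pf by auto
    finally show ?thesis by linarith
  qed
  from this[of "min_eigenvalue A"] this[of "- neg_min_form n \<xi>"] show ?thesis by auto
qed

section \<open>Linear combinations of GOE matrices\<close>

definition sym_of :: "nat \<Rightarrow> (nat \<times> nat \<Rightarrow> real) \<Rightarrow> real Matrix.mat" where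
  "sym_of n q = Matrix.mat n n (\<lambda>(i, j). q (min i j, max i j))"

lemma sym_of_entry: "p \<in> upper_pairs n \<Longrightarrow> sym_of n q $$ p = q p"
  by (auto simp: sym_of_def upper_pairs_def min_def max_def)

lemma sym_of_sym_mats: "sym_of n q \<in> sym_mats n"
  unfolding sym_mats_iff by (auto simp: sym_of_def min.commute max.commute)

lemma space_sym_borel [simp]: "space (sym_borel n) = sym_mats n"
  by (simp add: sym_borel_def)

lemma entry_measurable:
  assumes "i < n" "j < n"
  shows "(\<lambda>A. A $$ (i, j)) \<in> borel_measurable (sym_borel n)"
proof -
  have "(\<lambda>A. \<lambda>ij\<in>{..<n} \<times> {..<n}. A $$ ij) \<in> sym_borel n \<rightarrow>\<^sub>M (\<Pi>\<^sub>M ij\<in>{..<n} \<times> {..<n}. (borel :: real measure))"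
    unfolding sym_borel_def by (rule measurable_vimage_algebra1) (auto simp: space_PiM)
  from measurable_compose[OF this measurable_component_singleton[of "(i, j)"]] assms show ?thesis by simp
qed

lemma entry_measurable_upper: "p \<in> upper_pairs n \<Longrightarrow> (\<lambda>A. A $$ p) \<in> borel_measurable (sym_borel n)"
  using entry_measurable by (cases p) (auto simp: upper_pairs_def)

lemma sym_of_measurable:
  assumes "\<And>p. p \<in> upper_pairs n \<Longrightarrow> (\<lambda>x. f x p) \<in> borel_measurable M"
  shows "(\<lambda>x. sym_of n (f x)) \<in> M \<rightarrow>\<^sub>M sym_borel n"
  unfolding sym_borel_def
proof (rule measurable_vimage_algebra2)
  show "(\<lambda>x. sym_of n (f x)) \<in> space M \<rightarrow> sym_mats n" using sym_of_sym_mats by auto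
  show "(\<lambda>x. \<lambda>ij\<in>{..<n} \<times> {..<n}. sym_of n (f x) $$ ij) \<in> M \<rightarrow>\<^sub>M (\<Pi>\<^sub>M ij\<in>{..<n} \<times> {..<n}. (borel :: real measure))"
  proof (rule measurable_restrict)
    fix ij assume "ij \<in> {..<n} \<times> {..<n}"
    then obtain i j where ij: "ij = (i, j)" "i < n" "j < n" by auto
    have "(\<lambda>x. f x (min i j, max i j)) \<in> borel_measurable M"
      using ij by (intro assms) (auto simp: upper_pairs_def min_def max_def)
    then show "(\<lambda>x. sym_of n (f x) $$ ij) \<in> borel_measurable M" using ij by (simp add: sym_of_def)
  qed
qed

lemma normal_law_scaled:
  assumes \<sigma>: "0 < \<sigma>"
  shows "distr normal_law borel (\<lambda>x. \<sigma> * x) = density lborel (normal_density 0 \<sigma>)"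
proof (rule measure_eqI)
  fix A assume "A \<in> sets (distr normal_law borel (\<lambda>x. \<sigma> * x))"
  then have A: "A \<in> sets borel" by simp
  have d: "ennreal (std_normal_density x) = ennreal \<sigma> * ennreal (normal_density 0 \<sigma> (\<sigma> * x))" for x
    using \<sigma> by (simp add: ennreal_mult'[symmetric] normal_density_def real_sqrt_mult power_mult_distrib)
  have "emeasure (distr normal_law borel (\<lambda>x. \<sigma> * x)) A = (\<integral>\<^sup>+x. indicator A (\<sigma> * x) \<partial>normal_law)"
    using A by (subst nn_integral_indicator[symmetric], simp, subst nn_integral_distr) auto
  also have "\<dots> = (\<integral>\<^sup>+x. ennreal (std_normal_density x) * indicator A (\<sigma> * x) \<partial>lborel)"
    using A by (subst nn_integral_density) auto
  also have "\<dots> = (\<integral>\<^sup>+x. ennreal \<sigma> * (ennreal (normal_density 0 \<sigma> (\<sigma> * x)) * indicator A (\<sigma> * x)) \<partial>lborel)"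
    by (simp add: d mult.assoc)
  also have "\<dots> = ennreal \<sigma> * (\<integral>\<^sup>+x. ennreal (normal_density 0 \<sigma> (\<sigma> * x)) * indicator A (\<sigma> * x) \<partial>lborel)"
    using A by (intro nn_integral_cmult) auto
  also have "\<dots> = (\<integral>\<^sup>+x. ennreal (normal_density 0 \<sigma> x) * indicator A x \<partial>lborel)"
    using A \<sigma> by (subst nn_integral_real_affine[of "\<lambda>x. ennreal (normal_density 0 \<sigma> x) * indicator A x" \<sigma> 0]) auto
  also have "\<dots> = emeasure (density lborel (normal_density 0 \<sigma>)) A" using A by (subst emeasure_density) auto
  finally show "emeasure (distr normal_law borel (\<lambda>x. \<sigma> * x)) A = emeasure (density lborel (normal_density 0 \<sigma>)) A" .
qed simp

text \<open>A normal variable of standard deviation \<open>\<sigma>\<close> is \<open>\<sigma>\<close> times a standard one, so that the GOE becomes an image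
  of the standard Gaussian measure on the positions \<open>upper_pairs n\<close>.\<close>

lemma GOE_eq:
  "GOE n = distr (gauss (upper_pairs n)) (sym_borel n) (\<lambda>\<xi>. sym_of n (\<lambda>p. entry_sd p * \<xi> p))"
proof -
  let ?U = "upper_pairs n"
  define N where "N = (\<lambda>p. density lborel (normal_density 0 (entry_sd p)))"
  have Np: "prob_space (N p)" for p unfolding N_def by (rule prob_space_normal_density[OF entry_sd_pos])
  interpret N: product_sigma_finite N
    by (simp add: product_sigma_finite_def prob_space_imp_sigma_finite Np)
  have sN: "sets (PiM ?U N) = sets (PiM ?U (\<lambda>_. borel))" by (rule sets_PiM_cong) (auto simp: N_def)
  have m: "(\<lambda>\<xi>. \<lambda>p\<in>?U. entry_sd p * \<xi> p) \<in> gauss ?U \<rightarrow>\<^sub>M PiM ?U (\<lambda>_. borel)" by measurable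
  have eq: "distr (gauss ?U) (PiM ?U (\<lambda>_. borel)) (\<lambda>\<xi>. \<lambda>p\<in>?U. entry_sd p * \<xi> p) = PiM ?U N"
  proof (rule N.PiM_eqI)
    show "sets (distr (gauss ?U) (PiM ?U (\<lambda>_. borel)) (\<lambda>\<xi>. \<lambda>p\<in>?U. entry_sd p * \<xi> p)) = sets (PiM ?U N)" by (simp add: sN)
    fix A assume "\<And>p. p \<in> ?U \<Longrightarrow> A p \<in> sets (N p)"
    then have A: "A p \<in> sets borel" if "p \<in> ?U" for p using that by (simp add: N_def)
    have PA: "Pi\<^sub>E ?U A \<in> sets (PiM ?U (\<lambda>_. borel))" using A by (intro sets_PiM_I_finite) auto
    have "emeasure (distr (gauss ?U) (PiM ?U (\<lambda>_. borel)) (\<lambda>\<xi>. \<lambda>p\<in>?U. entry_sd p * \<xi> p)) (Pi\<^sub>E ?U A)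
       = (\<integral>\<^sup>+\<xi>. indicator (Pi\<^sub>E ?U A) (\<lambda>p\<in>?U. entry_sd p * \<xi> p) \<partial>gauss ?U)"
      using PA m by (subst nn_integral_indicator[symmetric], simp, subst nn_integral_distr) auto
    also have "\<dots> = (\<integral>\<^sup>+\<xi>. (\<Prod>p\<in>?U. indicator (A p) (entry_sd p * \<xi> p)) \<partial>gauss ?U)"
      by (intro nn_integral_cong) (auto simp: indicator_def PiE_iff)
    also have "\<dots> = (\<Prod>p\<in>?U. \<integral>\<^sup>+x. indicator (A p) (entry_sd p * x) \<partial>normal_law)"
      unfolding gauss_def using A by (intro normal_laws.product_nn_integral_prod) auto
    also have "\<dots> = (\<Prod>p\<in>?U. emeasure (N p) (A p))"
    proof (rule prod.cong[OF refl])
      fix p assume p: "p \<in> ?U"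
      have "emeasure (N p) (A p) = (\<integral>\<^sup>+x. indicator (A p) x \<partial>distr normal_law borel (\<lambda>x. entry_sd p * x))"
        unfolding N_def normal_law_scaled[OF entry_sd_pos, symmetric] using A[OF p] by simp
      also have "\<dots> = (\<integral>\<^sup>+x. indicator (A p) (entry_sd p * x) \<partial>normal_law)"
        using A[OF p] by (subst nn_integral_distr) auto
      finally show "(\<integral>\<^sup>+x. indicator (A p) (entry_sd p * x) \<partial>normal_law) = emeasure (N p) (A p)" ..
    qed
    finally show "emeasure (distr (gauss ?U) (PiM ?U (\<lambda>_. borel)) (\<lambda>\<xi>. \<lambda>p\<in>?U. entry_sd p * \<xi> p)) (Pi\<^sub>E ?U A) = (\<Prod>p\<in>?U. emeasure (N p) (A p))" .
  qed simp
  have Ueq: "{(i, j). i \<le> j \<and> j < n} = ?U" by (simp add: upper_pairs_def)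
  have Neq: "(\<lambda>(i, j). density lborel (normal_density 0 (if i = j then 1 else sqrt (1 / 2)))) = N"
    by (auto simp: N_def entry_sd_def)
  have "GOE n = distr (PiM ?U N) (sym_borel n) (sym_of n)"
    unfolding GOE_def Ueq Neq sym_of_def[abs_def] ..
  also have "\<dots> = distr (gauss ?U) (sym_borel n) (sym_of n \<circ> (\<lambda>\<xi>. \<lambda>p\<in>?U. entry_sd p * \<xi> p))"
    unfolding eq[symmetric] by (rule distr_distr[OF _ m]) (rule sym_of_measurable, measurable)
  also have "\<dots> = distr (gauss ?U) (sym_borel n) (\<lambda>\<xi>. sym_of n (\<lambda>p. entry_sd p * \<xi> p))"
  proof -
    have "sym_of n (\<lambda>p\<in>?U. entry_sd p * \<xi> p) = sym_of n (\<lambda>p. entry_sd p * \<xi> p)" for \<xi>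
      unfolding sym_of_def by (intro eq_matI) (auto simp: upper_pairs_def min_def max_def)
    then show ?thesis by (simp add: comp_def)
  qed
  finally show ?thesis .
qed

lemma goe_map_measurable: "(\<lambda>\<xi>. sym_of n (\<lambda>p. entry_sd p * \<xi> p)) \<in> gauss (upper_pairs n) \<rightarrow>\<^sub>M sym_borel n"
  by (rule sym_of_measurable) measurable

lemma prob_space_GOE: "prob_space (GOE n)"
  unfolding GOE_eq by (rule prob_space.prob_space_distr[OF prob_space_gauss goe_map_measurable])

lemma sets_GOE [simp, measurable_cong]: "sets (GOE n) = sets (sym_borel n)"
  by (simp add: GOE_eq)

text \<open>A linear combination of independent GOE matrices has the law of one GOE matrix multiplied by the
  norm of the coefficients: the matrices are integrated out one after the other, using the stability
  of the Gaussian measure. The induction is on the set of matrices for all \<open>H\<close>, since the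
  contribution of the matrix that is split off is absorbed into \<open>H\<close>.\<close>

lemma goe_linear_combination:
  fixes H :: "(nat \<times> nat \<Rightarrow> real) \<Rightarrow> ennreal"
  assumes "finite L" "H \<in> borel_measurable (PiM (upper_pairs n) (\<lambda>_. borel))"
  shows "(\<integral>\<^sup>+\<Lambda>. H (\<lambda>p\<in>upper_pairs n. \<Sum>k\<in>L. x k * (\<Lambda> k $$ p)) \<partial>PiM L (\<lambda>_. GOE n))
    = (\<integral>\<^sup>+\<xi>. H (\<lambda>p\<in>upper_pairs n. sqrt (sqnorm L x) * (entry_sd p * \<xi> p)) \<partial>gauss (upper_pairs n))"
  using assms
proof (induction L arbitrary: H rule: finite_induct)
  case empty
  interpret prob_space "gauss (upper_pairs n)" by (rule prob_space_gauss)
  show ?case by (simp add: PiM_empty nn_integral_count_space_finite sqnorm_def emeasure_space_1[simplified])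
next
  case (insert k L)
  let ?U = "upper_pairs n"
  interpret GU: prob_space "gauss ?U" by (rule prob_space_gauss)
  interpret UU: pair_sigma_finite "gauss ?U" "gauss ?U" by (rule pair_sigma_finite_gauss)
  interpret G: product_sigma_finite "\<lambda>_. GOE n"
    by (simp add: product_sigma_finite_def prob_space_imp_sigma_finite prob_space_GOE)
  have H: "H \<in> borel_measurable (PiM ?U (\<lambda>_. borel))" by fact
  define s where "s = sqrt (sqnorm L x)"
  have ent: "(\<lambda>\<Lambda>. \<Lambda> j $$ p) \<in> borel_measurable (PiM I (\<lambda>_. GOE n))" if "j \<in> I" "p \<in> ?U" for j p and I :: "'a set"
    by (rule measurable_compose[OF measurable_component_singleton[OF that(1)]]) (use entry_measurable_upper[OF that(2)] in \<open>simp cong: measurable_cong_sets\<close>)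
  have m1: "(\<lambda>\<Lambda>. H (\<lambda>p\<in>?U. \<Sum>j\<in>insert k L. x j * (\<Lambda> j $$ p))) \<in> borel_measurable (PiM (insert k L) (\<lambda>_. GOE n))"
    by (rule measurable_compose[OF _ H], rule measurable_restrict, intro borel_measurable_sum borel_measurable_times borel_measurable_const ent)
  have "(\<integral>\<^sup>+\<Lambda>. H (\<lambda>p\<in>?U. \<Sum>j\<in>insert k L. x j * (\<Lambda> j $$ p)) \<partial>PiM (insert k L) (\<lambda>_. GOE n))
     = (\<integral>\<^sup>+A. \<integral>\<^sup>+\<Lambda>. H (\<lambda>p\<in>?U. \<Sum>j\<in>insert k L. x j * ((\<Lambda>(k := A)) j $$ p)) \<partial>PiM L (\<lambda>_. GOE n) \<partial>GOE n)"
    by (rule G.product_nn_integral_insert_rev[OF insert.hyps m1])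
  also have "\<dots> = (\<integral>\<^sup>+A. \<integral>\<^sup>+\<xi>. H (\<lambda>p\<in>?U. x k * (A $$ p) + s * (entry_sd p * \<xi> p)) \<partial>gauss ?U \<partial>GOE n)"
  proof (rule nn_integral_cong)
    fix A
    define H' where "H' = (\<lambda>B. H (\<lambda>p\<in>?U. x k * (A $$ p) + B p))"
    have H': "H' \<in> borel_measurable (PiM ?U (\<lambda>_. borel))"
      unfolding H'_def by (rule measurable_compose[OF _ H], rule measurable_restrict, intro borel_measurable_add borel_measurable_const measurable_component_singleton)
    have "(\<Sum>j\<in>insert k L. x j * ((\<Lambda>(k := A)) j $$ p)) = x k * (A $$ p) + (\<Sum>j\<in>L. x j * (\<Lambda> j $$ p))" for \<Lambda> p
    proof -
      have "(\<Sum>j\<in>L. x j * ((\<Lambda>(k := A)) j $$ p)) = (\<Sum>j\<in>L. x j * (\<Lambda> j $$ p))"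
        using insert.hyps by (intro sum.cong refl) auto
      then show ?thesis using insert.hyps by simp
    qed
    then have 1: "H (\<lambda>p\<in>?U. \<Sum>j\<in>insert k L. x j * ((\<Lambda>(k := A)) j $$ p)) = H' (\<lambda>p\<in>?U. \<Sum>j\<in>L. x j * (\<Lambda> j $$ p))" for \<Lambda>
      unfolding H'_def by (intro arg_cong[of _ _ H] restrict_ext) simp
    have 2: "H' (\<lambda>p\<in>?U. s * (entry_sd p * \<xi> p)) = H (\<lambda>p\<in>?U. x k * (A $$ p) + s * (entry_sd p * \<xi> p))" for \<xi>
      unfolding H'_def by (intro arg_cong[of _ _ H] restrict_ext) simp
    show "(\<integral>\<^sup>+\<Lambda>. H (\<lambda>p\<in>?U. \<Sum>j\<in>insert k L. x j * ((\<Lambda>(k := A)) j $$ p)) \<partial>PiM L (\<lambda>_. GOE n))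
       = (\<integral>\<^sup>+\<xi>. H (\<lambda>p\<in>?U. x k * (A $$ p) + s * (entry_sd p * \<xi> p)) \<partial>gauss ?U)"
      unfolding 1 2[symmetric] unfolding s_def by (rule insert.IH[OF H'])
  qed
  also have "\<dots> = (\<integral>\<^sup>+\<eta>. \<integral>\<^sup>+\<xi>. H (\<lambda>p\<in>?U. x k * (entry_sd p * \<eta> p) + s * (entry_sd p * \<xi> p)) \<partial>gauss ?U \<partial>gauss ?U)"
  proof -
    have "(\<lambda>(A, \<xi>). H (\<lambda>p\<in>?U. x k * (A $$ p) + s * (entry_sd p * \<xi> p))) \<in> borel_measurable (sym_borel n \<Otimes>\<^sub>M gauss ?U)"
      unfolding split_beta'
      by (rule measurable_compose[OF _ H], rule measurable_restrict,
          intro borel_measurable_add borel_measurable_times borel_measurable_const measurable_compose[OF measurable_fst entry_measurable_upper] measurable_compose[OF measurable_snd])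
         auto
    then have m: "(\<lambda>A. \<integral>\<^sup>+\<xi>. H (\<lambda>p\<in>?U. x k * (A $$ p) + s * (entry_sd p * \<xi> p)) \<partial>gauss ?U) \<in> borel_measurable (sym_borel n)"
      by (rule GU.borel_measurable_nn_integral)
    have "(\<lambda>p\<in>?U. x k * (sym_of n (\<lambda>p. entry_sd p * \<eta> p) $$ p) + s * (entry_sd p * \<xi> p)) = (\<lambda>p\<in>?U. x k * (entry_sd p * \<eta> p) + s * (entry_sd p * \<xi> p))" for \<eta> \<xi>
      by (intro restrict_ext) (simp add: sym_of_entry)
    then show ?thesis
      unfolding GOE_eq using m by (subst nn_integral_distr[OF goe_map_measurable]) simp_all
  qed
  also have "\<dots> = (\<integral>\<^sup>+z. H (\<lambda>p\<in>?U. entry_sd p * (case z of (\<eta>, \<xi>) \<Rightarrow> \<lambda>p\<in>?U. x k * \<eta> p + s * \<xi> p) p) \<partial>(gauss ?U \<Otimes>\<^sub>M gauss ?U))"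
  proof -
    have m: "(\<lambda>(\<eta>, \<xi>). H (\<lambda>p\<in>?U. x k * (entry_sd p * \<eta> p) + s * (entry_sd p * \<xi> p))) \<in> borel_measurable (gauss ?U \<Otimes>\<^sub>M gauss ?U)"
      unfolding split_beta' by (rule measurable_compose[OF _ H]) measurable
    have "(\<lambda>p\<in>?U. entry_sd p * (\<lambda>p\<in>?U. x k * \<eta> p + s * \<xi> p) p) = (\<lambda>p\<in>?U. x k * (entry_sd p * \<eta> p) + s * (entry_sd p * \<xi> p))" for \<eta> \<xi>
      by (intro restrict_ext) (simp add: algebra_simps)
    then show ?thesis using GU.nn_integral_fst[OF m] by (simp add: split_beta')
  qed
  also have "\<dots> = (\<integral>\<^sup>+\<xi>. H (\<lambda>p\<in>?U. entry_sd p * \<xi> p) \<partial>distr (gauss ?U \<Otimes>\<^sub>M gauss ?U) (PiM ?U (\<lambda>_. borel)) (\<lambda>(\<eta>, \<xi>). \<lambda>p\<in>?U. x k * \<eta> p + s * \<xi> p))"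
  proof (rule nn_integral_distr[symmetric])
    show "(\<lambda>\<xi>. H (\<lambda>p\<in>?U. entry_sd p * \<xi> p)) \<in> borel_measurable (distr (gauss ?U \<Otimes>\<^sub>M gauss ?U) (PiM ?U (\<lambda>_. borel)) (\<lambda>(\<eta>, \<xi>). \<lambda>p\<in>?U. x k * \<eta> p + s * \<xi> p))"
      by (rule measurable_compose[OF _ H]) measurable
  qed measurable
  also have "\<dots> = (\<integral>\<^sup>+\<xi>. H (\<lambda>p\<in>?U. entry_sd p * (\<lambda>p\<in>?U. sqrt ((x k)\<^sup>2 + s\<^sup>2) * \<xi> p) p) \<partial>gauss ?U)"
    unfolding gauss_stable[OF finite_upper_pairs]
  proof (rule nn_integral_distr)
    show "(\<lambda>\<xi>. H (\<lambda>p\<in>?U. entry_sd p * \<xi> p)) \<in> borel_measurable (distr (gauss ?U) (PiM ?U (\<lambda>_. borel)) (\<lambda>\<xi>. \<lambda>p\<in>?U. sqrt ((x k)\<^sup>2 + s\<^sup>2) * \<xi> p))"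
      by (rule measurable_compose[OF _ H]) measurable
  qed measurable
  also have "\<dots> = (\<integral>\<^sup>+\<xi>. H (\<lambda>p\<in>?U. sqrt (sqnorm (insert k L) x) * (entry_sd p * \<xi> p)) \<partial>gauss ?U)"
  proof -
    have "(x k)\<^sup>2 + s\<^sup>2 = sqnorm (insert k L) x" using insert.hyps by (simp add: s_def) (simp add: sqnorm_def)
    then have "(\<lambda>p\<in>?U. entry_sd p * (\<lambda>p\<in>?U. sqrt ((x k)\<^sup>2 + s\<^sup>2) * \<xi> p) p) = (\<lambda>p\<in>?U. sqrt (sqnorm (insert k L) x) * (entry_sd p * \<xi> p))" for \<xi>
      by (intro restrict_ext) simp
    then show ?thesis by simp
  qed
  finally show ?case .
qed

lemma independent_GOE_linear_combination:
  assumes l: "1 \<le> l" and ind: "independent_GOE M l n Q"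
    and S: "S \<in> sets (PiM (upper_pairs n) (\<lambda>_. borel))"
  shows "measure M {\<omega> \<in> space M. (\<lambda>p\<in>upper_pairs n. \<Sum>k=1..l. x k * (Q k \<omega> $$ p)) \<in> S}
    = measure (gauss (upper_pairs n)) {\<xi> \<in> space (gauss (upper_pairs n)). (\<lambda>p\<in>upper_pairs n. sqrt (sqnorm {1..l} x) * (entry_sd p * \<xi> p)) \<in> S}"
proof -
  let ?U = "upper_pairs n" and ?L = "{1..l}"
  interpret prob_space M using ind by (simp add: independent_GOE_def)
  have iv: "indep_vars (\<lambda>_. sym_borel n) Q ?L" and law: "\<And>k. k \<in> ?L \<Longrightarrow> distr M (sym_borel n) (Q k) = GOE n"
    using ind by (auto simp: independent_GOE_def)
  have rv: "Q k \<in> M \<rightarrow>\<^sub>M sym_borel n" if "k \<in> ?L" for k using iv that by (simp add: indep_vars_def)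
  have "distr M (PiM ?L (\<lambda>_. sym_borel n)) (\<lambda>\<omega>. \<lambda>k\<in>?L. Q k \<omega>) = PiM ?L (\<lambda>k. distr M (sym_borel n) (Q k))"
    using iv l by (subst indep_vars_iff_distr_eq_PiM'[symmetric]) (use rv in auto)
  also have "\<dots> = PiM ?L (\<lambda>_. GOE n)" by (rule PiM_cong) (use law in auto)
  finally have joint: "distr M (PiM ?L (\<lambda>_. sym_borel n)) (\<lambda>\<omega>. \<lambda>k\<in>?L. Q k \<omega>) = PiM ?L (\<lambda>_. GOE n)" .
  have mQ: "(\<lambda>\<omega>. \<lambda>k\<in>?L. Q k \<omega>) \<in> M \<rightarrow>\<^sub>M PiM ?L (\<lambda>_. sym_borel n)" by (rule measurable_restrict) (rule rv)
  define h where "h = (\<lambda>\<Lambda>. \<lambda>p\<in>?U. \<Sum>k\<in>?L. x k * (\<Lambda> k $$ p))"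
  have ent: "(\<lambda>\<Lambda>. \<Lambda> k $$ p) \<in> borel_measurable (PiM ?L (\<lambda>_. sym_borel n))" if "k \<in> ?L" "p \<in> ?U" for k p
    by (rule measurable_compose[OF measurable_component_singleton[OF that(1)] entry_measurable_upper[OF that(2)]])
  have mh: "h \<in> PiM ?L (\<lambda>_. sym_borel n) \<rightarrow>\<^sub>M PiM ?U (\<lambda>_. borel)"
    unfolding h_def
    by (rule measurable_restrict, intro borel_measurable_sum borel_measurable_times borel_measurable_const ent)
  have iS: "(indicator S :: _ \<Rightarrow> ennreal) \<in> borel_measurable (PiM ?U (\<lambda>_. borel))" by (rule borel_measurable_indicator[OF S])
  have hQ: "h (\<lambda>k\<in>?L. Q k \<omega>) = (\<lambda>p\<in>?U. \<Sum>k=1..l. x k * (Q k \<omega> $$ p))" for \<omega>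
    unfolding h_def by (intro restrict_ext sum.cong) auto
  have E: "{\<omega> \<in> space M. (\<lambda>p\<in>?U. \<Sum>k=1..l. x k * (Q k \<omega> $$ p)) \<in> S} \<in> sets M"
    unfolding hQ[symmetric] using measurable_sets[OF measurable_compose[OF mQ mh] S] by (simp add: vimage_def Int_def conj_commute)
  have mg: "(\<lambda>\<xi>. \<lambda>p\<in>?U. sqrt (sqnorm ?L x) * (entry_sd p * \<xi> p)) \<in> gauss ?U \<rightarrow>\<^sub>M PiM ?U (\<lambda>_. borel)" by measurable
  have F: "{\<xi> \<in> space (gauss ?U). (\<lambda>p\<in>?U. sqrt (sqnorm ?L x) * (entry_sd p * \<xi> p)) \<in> S} \<in> sets (gauss ?U)"
    using measurable_sets[OF mg S] by (simp add: vimage_def Int_def conj_commute)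
  have "emeasure M {\<omega> \<in> space M. (\<lambda>p\<in>?U. \<Sum>k=1..l. x k * (Q k \<omega> $$ p)) \<in> S} = (\<integral>\<^sup>+\<omega>. indicator S (h (\<lambda>k\<in>?L. Q k \<omega>)) \<partial>M)"
    unfolding hQ by (subst nn_integral_indicator[OF E, symmetric]) (auto intro!: nn_integral_cong simp: indicator_def)
  also have "\<dots> = (\<integral>\<^sup>+\<Lambda>. indicator S (h \<Lambda>) \<partial>PiM ?L (\<lambda>_. GOE n))"
    unfolding joint[symmetric] using measurable_compose[OF mh iS] by (subst nn_integral_distr[OF mQ]) auto
  also have "\<dots> = (\<integral>\<^sup>+\<xi>. indicator S (\<lambda>p\<in>?U. sqrt (sqnorm ?L x) * (entry_sd p * \<xi> p)) \<partial>gauss ?U)"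
    unfolding h_def by (rule goe_linear_combination[OF _ iS]) simp
  also have "\<dots> = emeasure (gauss ?U) {\<xi> \<in> space (gauss ?U). (\<lambda>p\<in>?U. sqrt (sqnorm ?L x) * (entry_sd p * \<xi> p)) \<in> S}"
    by (subst nn_integral_indicator[OF F, symmetric]) (auto intro!: nn_integral_cong simp: indicator_def)
  finally show ?thesis by (simp add: measure_def)
qed

section \<open>The expected relative volume\<close>

lemma pform_add: "pform n (\<lambda>p. B p + B' p) w = pform n B w + pform n B' w"
  unfolding pform_def sum.distrib[symmetric] by (intro sum.cong refl) (simp add: algebra_simps)

lemma pform_one: "pform n (\<lambda>p. (1\<^sub>m n :: real Matrix.mat) $$ p) w = dot n w w"
proof -
  have "(1\<^sub>m n :: real Matrix.mat) \<in> sym_mats n" by (auto simp: sym_mats_iff)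
  then have "pform n (\<lambda>p. (1\<^sub>m n :: real Matrix.mat) $$ p) w = bilin n (\<lambda>i j. (1\<^sub>m n :: real Matrix.mat) $$ (i, j)) w w"
    by (rule pform_sym_mat[symmetric])
  also have "\<dots> = (\<Sum>i<n. \<Sum>j<n. if j = i then w i * w i else 0)"
    unfolding bilin_def by (intro sum.cong refl) auto
  also have "\<dots> = dot n w w" by (simp add: dot_def)
  finally show ?thesis .
qed

definition cone_form :: "nat \<Rightarrow> nat \<Rightarrow> (nat \<Rightarrow> real Matrix.mat) \<Rightarrow> (nat \<Rightarrow> real) \<Rightarrow> (nat \<Rightarrow> real) \<Rightarrow> real" where
  "cone_form l n Q x w = x 0 * dot n w w
     + 1 / sqrt (2 * real n * real l) * pform n (\<lambda>p. \<Sum>k = 1..l. x k * (Q k $$ p)) w"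

definition spectrahedral_cone :: "nat \<Rightarrow> nat \<Rightarrow> (nat \<Rightarrow> real Matrix.mat) \<Rightarrow> (nat \<Rightarrow> real) set" where
  "spectrahedral_cone l n Q = {x \<in> {..l} \<rightarrow>\<^sub>E UNIV. \<forall>w. 0 \<le> cone_form l n Q x w}"

lemma spherical_spectrahedron_cone:
  assumes Q: "\<And>k. k \<in> {1..l} \<Longrightarrow> Q k \<in> sym_mats n"
  shows "spherical_spectrahedron l n Q = unit_sphere l \<inter> spectrahedral_cone l n Q"
proof -
  let ?c = "1 / sqrt (2 * real n * real l)"
  have "x 0 \<cdot>\<^sub>m 1\<^sub>m n + ?c \<cdot>\<^sub>m Matrix.mat n n (\<lambda>(i, j). \<Sum>k = 1..l. x k * (Q k $$ (i, j))) \<in> psd_cone n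
    \<longleftrightarrow> (\<forall>w. 0 \<le> cone_form l n Q x w)" (is "?X \<in> _ \<longleftrightarrow> _") for x
  proof -
    have XC: "?X \<in> carrier_mat n n" by simp
    have ent: "?X $$ (i, j) = x 0 * (1\<^sub>m n $$ (i, j)) + ?c * (\<Sum>k = 1..l. x k * (Q k $$ (i, j)))" if "i < n" "j < n" for i j
      using that by simp
    have "Q k $$ (i, j) = Q k $$ (j, i)" if "i < n" "j < n" "k \<in> {1..l}" for i j k
      using Q[OF that(3)] that unfolding sym_mats_iff by blast
    then have ssym: "(\<Sum>k = 1..l. x k * (Q k $$ (i, j))) = (\<Sum>k = 1..l. x k * (Q k $$ (j, i)))" if "i < n" "j < n" for i j
      using that by (intro sum.cong refl) auto
    have XS: "?X \<in> sym_mats n"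
      unfolding sym_mats_iff
    proof (intro conjI allI impI XC)
      fix i j assume ij: "i < n" "j < n"
      have o: "(1\<^sub>m n :: real Matrix.mat) $$ (i, j) = 1\<^sub>m n $$ (j, i)" using ij by auto
      show "?X $$ (i, j) = ?X $$ (j, i)" unfolding ent[OF ij] ent[OF ij(2,1)] o ssym[OF ij] ..
    qed
    have "pform n (\<lambda>p. ?X $$ p) w = cone_form l n Q x w" for w
    proof -
      have "pform n (\<lambda>p. ?X $$ p) w = pform n (\<lambda>p. x 0 * (1\<^sub>m n $$ p) + ?c * (\<Sum>k = 1..l. x k * (Q k $$ p))) w"
      proof (rule pform_cong)
        fix p assume "p \<in> upper_pairs n"
        then obtain i j where "p = (i, j)" "i < n" "j < n" by (auto simp: upper_pairs_def)
        then show "?X $$ p = x 0 * (1\<^sub>m n $$ p) + ?c * (\<Sum>k = 1..l. x k * (Q k $$ p))" using ent by simp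
      qed
      then show ?thesis unfolding pform_add pform_scale pform_one cone_form_def .
    qed
    then show ?thesis unfolding psd_cone_iff[OF XS] by simp
  qed
  then show ?thesis
    unfolding spherical_spectrahedron_def spectrahedral_cone_def by (auto simp: unit_sphere_def)
qed

lemma spectrahedral_cone_scale:
  assumes r: "0 < r" and x: "x \<in> spectrahedral_cone l n Q"
  shows "(\<lambda>i\<in>{..l}. r * x i) \<in> spectrahedral_cone l n Q"
proof -
  have "cone_form l n Q (\<lambda>i\<in>{..l}. r * x i) w = r * cone_form l n Q x w" for w
  proof -
    have "(\<Sum>k = 1..l. (\<lambda>i\<in>{..l}. r * x i) k * (Q k $$ p)) = r * (\<Sum>k = 1..l. x k * (Q k $$ p))" for p
      unfolding sum_distrib_left by (intro sum.cong refl) auto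
    then show ?thesis unfolding cone_form_def by (simp add: pform_scale algebra_simps)
  qed
  then show ?thesis using x r by (auto simp: spectrahedral_cone_def)
qed

lemma continuous_form: "continuous_on UNIV (\<lambda>w. a * dot n w w + c * pform n B w)"
  unfolding dot_def pform_def by (intro continuous_intros continuous_on_product_coordinates)

text \<open>Countably many test vectors decide positive semidefiniteness, which makes the event measurable.\<close>

lemma form_nonneg_dense:
  assumes "closure D = (UNIV :: (nat \<Rightarrow> real) set)"
  shows "(\<forall>w. 0 \<le> a * dot n w w + c * pform n B w) \<longleftrightarrow> (\<forall>w\<in>D. 0 \<le> a * dot n w w + c * pform n B w)"
proof
  assume *: "\<forall>w\<in>D. 0 \<le> a * dot n w w + c * pform n B w"
  have "closed {w. 0 \<le> a * dot n w w + c * pform n B w}"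
    by (intro closed_Collect_le continuous_form continuous_intros)
  then have "closure D \<subseteq> {w. 0 \<le> a * dot n w w + c * pform n B w}" using * by (intro closure_minimal) auto
  then show "\<forall>w. 0 \<le> a * dot n w w + c * pform n B w" using assms by auto
qed auto

text \<open>For \<open>s = 0\<close> both sides state \<open>0 \<le> a\<close>.\<close>

lemma form_nonneg_iff_neg_min:
  assumes n: "1 \<le> n" and s: "0 \<le> s"
  shows "(\<forall>w. 0 \<le> a * dot n w w + s * pform n (\<lambda>p. entry_sd p * \<xi> p) w) \<longleftrightarrow> s * neg_min_form n \<xi> \<le> a"
proof -
  let ?f = "\<lambda>w. lin_form (upper_pairs n) (qcoef w) \<xi>"
  have neg: "lin_form (upper_pairs n) (\<lambda>p. - qcoef w p) \<xi> = - ?f w" for w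
    unfolding lin_form_def by (simp add: sum_negf)
  have "(\<forall>w. 0 \<le> a * dot n w w + s * ?f w) \<longleftrightarrow> (\<forall>w\<in>sphere_vecs n. - (s * ?f w) \<le> a)"
  proof (intro iffI ballI allI)
    fix w assume "\<forall>w. 0 \<le> a * dot n w w + s * ?f w" "w \<in> sphere_vecs n"
    then show "- (s * ?f w) \<le> a" by (auto simp: sphere_vecs_def dest!: spec[of _ w])
  next
    fix w :: "nat \<Rightarrow> real"
    assume *: "\<forall>w\<in>sphere_vecs n. - (s * ?f w) \<le> a"
    show "0 \<le> a * dot n w w + s * ?f w"
    proof (cases "dot n w w = 0")
      case True
      then have "?f w = 0" unfolding pform_entry_sd[symmetric] pform_def
        using dot_zero_imp[OF True] by (intro sum.neutral) (auto simp: upper_pairs_def)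
      then show ?thesis using True by simp
    next
      case False
      then have d: "0 < dot n w w" using dot_nonneg[of n w] by simp
      have "?f (\<lambda>i. 1 / sqrt (dot n w w) * w i) = (1 / sqrt (dot n w w))\<^sup>2 * ?f w"
        unfolding pform_entry_sd[symmetric] by (rule pform_scale_vec)
      with bspec[OF * dot_pos_imp_normalized[OF d]] have "- (s * (?f w / dot n w w)) \<le> a"
        using d by (simp add: power_divide)
      then have "- (s * (?f w / dot n w w)) * dot n w w \<le> a * dot n w w" using d by (intro mult_right_mono) auto
      then show ?thesis using d by simp
    qed
  qed
  also have "\<dots> \<longleftrightarrow> s * neg_min_form n \<xi> \<le> a"
  proof (cases "s = 0")
    case True then show ?thesis using sphere_vecs_nonempty[OF n] by auto
  next
    case False
    then have s: "0 < s" using s by simp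
    have "s * neg_min_form n \<xi> \<le> a \<longleftrightarrow> neg_min_form n \<xi> \<le> a / s" using s by (simp add: field_simps)
    also have "\<dots> \<longleftrightarrow> (\<forall>w\<in>sphere_vecs n. - ?f w \<le> a / s)"
      unfolding neg_min_form_def sup_form_le_iff[OF gauss_family_neg[OF n]] neg ..
    also have "\<dots> \<longleftrightarrow> (\<forall>w\<in>sphere_vecs n. - (s * ?f w) \<le> a)" using s by (simp add: field_simps)
    finally show ?thesis by simp
  qed
  finally show ?thesis unfolding pform_entry_sd .
qed

lemma neg_min_form_measurable: "1 \<le> n \<Longrightarrow> neg_min_form n \<in> borel_measurable (PiM (upper_pairs n) (\<lambda>_. borel))"
  unfolding neg_min_form_def by (rule sup_form_measurable[OF gauss_family_neg])

lemma sqnorm_measurable_gauss: "J \<subseteq> I \<Longrightarrow> sqnorm J \<in> borel_measurable (gauss I)"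
  unfolding measurable_cong_sets[OF sets_gauss refl] by (rule sqnorm_measurable)

text \<open>For fixed \<open>t\<close> the condition is on \<open>x 0\<close> given the other coordinates, which are independent of it.\<close>

lemma gauss_halfspace_cone:
  fixes l :: nat
  shows "measure (gauss {..l}) {x \<in> space (gauss {..l}). sqrt (sqnorm {1..l} x) * t \<le> x 0}
    = (\<integral>y. std_normal_cdf (- (sqrt (sqnorm {1..l} y) * t)) \<partial>gauss {1..l})"
proof -
  let ?G = "gauss {..l}"
  interpret prob_space ?G by (rule prob_space_gauss)
  have I: "{..l} = insert 0 {1..l}" by auto
  have z: "0 \<notin> {1..l}" by simp
  let ?E = "{x \<in> space ?G. sqrt (sqnorm {1..l} x) * t \<le> x 0}"
  have [measurable]: "sqnorm {1..l} \<in> borel_measurable ?G" by (rule sqnorm_measurable_gauss) auto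
  have E: "?E \<in> sets ?G" by measurable
  define f where "f = (\<lambda>x :: nat \<Rightarrow> real. if sqrt (sqnorm {1..l} x) * t \<le> x 0 then 1 else 0 :: real)"
  have int: "integrable ?G f"
  proof (rule integrable_const_bound[of _ 1])
    show "f \<in> borel_measurable ?G" unfolding f_def by measurable
    show "AE x in ?G. norm (f x) \<le> 1" by (simp add: f_def)
  qed
  have "measure ?G ?E = (\<integral>x. indicator ?E x \<partial>?G)"
    using E by (subst Bochner_Integration.integral_indicator) (simp add: Int_absorb2 sets.sets_into_space del: space_gauss)
  also have "\<dots> = (\<integral>x. f x \<partial>?G)" by (intro Bochner_Integration.integral_cong) (auto simp: f_def indicator_def)
  also have "\<dots> = (\<integral>y. \<integral>z. f (y(0 := z)) \<partial>normal_law \<partial>gauss {1..l})"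
    using gauss_integral_insert[OF _ z, of f] int unfolding I by simp
  also have "\<dots> = (\<integral>y. std_normal_cdf (- (sqrt (sqnorm {1..l} y) * t)) \<partial>gauss {1..l})"
  proof (rule Bochner_Integration.integral_cong[OF refl])
    fix y :: "nat \<Rightarrow> real"
    let ?a = "sqrt (sqnorm {1..l} y) * t"
    have "sqnorm {1..l} (y(0 := z)) = sqnorm {1..l} y" for z unfolding sqnorm_def by (intro sum.cong) auto
    then have "(\<integral>z. f (y(0 := z)) \<partial>normal_law) = (\<integral>z. indicator {?a..} z \<partial>normal_law)"
      by (intro Bochner_Integration.integral_cong) (auto simp: f_def indicator_def)
    also have "\<dots> = measure normal_law (space normal_law - {..<?a})"
    proof -
      have "space normal_law - {..<?a} = {?a..}" by auto
      then show ?thesis by simp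
    qed
    also have "\<dots> = 1 - std_normal_cdf ?a"
      by (subst normal_law.prob_compl) (auto simp: std_normal_cdf_lessThan)
    also have "\<dots> = std_normal_cdf (- ?a)" by (simp add: std_normal_cdf_uminus)
    finally show "(\<integral>z. f (y(0 := z)) \<partial>normal_law) = std_normal_cdf (- ?a)" .
  qed
  finally show ?thesis .
qed

text \<open>The relative volume is the probability that a standard Gaussian \<open>x\<close> in dimension \<open>l + 1\<close> lies in the
  spectrahedral cone. Exchanging the integrals, \<open>x\<close> is fixed first and the matrices are replaced by a single
  GOE matrix multiplied by the norm of \<open>(x 1, \<dots>, x l)\<close>; the event is then an inequality between \<open>x 0\<close>,
  this norm and the smallest eigenvalue. Exchanging once more, the matrix is fixed and the probability over
  \<open>x\<close> is a value of Student's distribution function.\<close>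

theorem expected_relative_volume_mixture:
  assumes l: "1 \<le> l" and n: "1 \<le> n" and ind: "independent_GOE M l n Q"
  shows "expected_relative_volume M l n Q
    = (\<integral>\<xi>. student_t_cdf l (- neg_min_form n \<xi> / sqrt (2 * real n)) \<partial>gauss (upper_pairs n))"
proof -
  let ?G = "gauss {..l}" and ?U = "upper_pairs n" and ?GU = "gauss (upper_pairs n)"
  let ?c = "1 / sqrt (2 * real n * real l)" and ?T = "neg_min_form n"
  interpret M: prob_space M using ind by (simp add: independent_GOE_def)
  interpret G: prob_space ?G by (rule prob_space_gauss)
  interpret GU: prob_space ?GU by (rule prob_space_gauss)
  interpret MG: pair_prob_space M ?G ..
  interpret UG: pair_prob_space ?GU ?G ..
  have rv: "Q k \<in> M \<rightarrow>\<^sub>M sym_borel n" if "k \<in> {1..l}" for k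
    using ind that by (simp add: independent_GOE_def M.indep_vars_def)
  have Qs: "Q k \<omega> \<in> sym_mats n" if "k \<in> {1..l}" "\<omega> \<in> space M" for k \<omega>
    using measurable_space[OF rv[OF that(1)] that(2)] by simp
  have ent: "(\<lambda>\<omega>. Q k \<omega> $$ p) \<in> borel_measurable M" if "k \<in> {1..l}" "p \<in> ?U" for k p
    by (rule measurable_compose[OF rv[OF that(1)] entry_measurable_upper[OF that(2)]])
  \<comment> \<open>A countable dense set of test vectors.\<close>
  obtain D :: "(nat \<Rightarrow> real) set" where D: "countable D" "D \<subseteq> UNIV" "UNIV \<subseteq> closure D" by (rule countable_subfamily)
  then have clD: "closure D = UNIV" by auto
  define E where "E = {z \<in> space (M \<Otimes>\<^sub>M ?G). \<forall>w\<in>D. 0 \<le> cone_form l n (\<lambda>k. Q k (fst z)) (snd z) w}"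
  have cfm: "(\<lambda>z. cone_form l n (\<lambda>k. Q k (fst z)) (snd z) w) \<in> borel_measurable (M \<Otimes>\<^sub>M ?G)" for w
    unfolding cone_form_def pform_def
    by (intro borel_measurable_add borel_measurable_times borel_measurable_const borel_measurable_sum
        measurable_compose[OF measurable_fst ent] measurable_compose[OF measurable_snd])
      (auto simp: gauss_def intro!: measurable_component_singleton cong: measurable_cong_sets)
  have E: "E \<in> sets (M \<Otimes>\<^sub>M ?G)"
    unfolding E_def using D(1) cfm by measurable
  have inE: "(\<omega>, x) \<in> E \<longleftrightarrow> x \<in> spectrahedral_cone l n (\<lambda>k. Q k \<omega>)" if "\<omega> \<in> space M" "x \<in> space ?G" for \<omega> x
  proof -
    have "(\<forall>w. 0 \<le> cone_form l n (\<lambda>k. Q k \<omega>) x w) \<longleftrightarrow> (\<forall>w\<in>D. 0 \<le> cone_form l n (\<lambda>k. Q k \<omega>) x w)"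
      unfolding cone_form_def by (rule form_nonneg_dense[OF clD])
    then show ?thesis using that by (simp add: E_def space_pair_measure spectrahedral_cone_def)
  qed
  have intE: "integrable (M \<Otimes>\<^sub>M ?G) (\<lambda>(\<omega>, x). indicator E (\<omega>, x) :: real)"
    by (rule MG.integrable_const_bound[of _ 1]) (use E in \<open>auto simp: indicator_def\<close>)
  have "expected_relative_volume M l n Q = (\<integral>\<omega>. \<integral>x. indicator E (\<omega>, x) \<partial>?G \<partial>M)"
    unfolding expected_relative_volume_def
  proof (rule Bochner_Integration.integral_cong[OF refl])
    fix \<omega> assume \<omega>: "\<omega> \<in> space M"
    let ?K = "spectrahedral_cone l n (\<lambda>k. Q k \<omega>)"
    have "Pair \<omega> -` E \<in> sets ?G" using sets_Pair1[OF E] .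
    moreover have K: "Pair \<omega> -` E = ?K"
    proof (intro equalityI subsetI)
      fix x assume "x \<in> Pair \<omega> -` E"
      then have "x \<in> space ?G" "(\<omega>, x) \<in> E" using sets.sets_into_space[OF E] by (auto simp: space_pair_measure)
      then show "x \<in> ?K" using inE \<omega> by blast
    next
      fix x assume x: "x \<in> ?K"
      then have "x \<in> space ?G" by (simp add: spectrahedral_cone_def)
      then show "x \<in> Pair \<omega> -` E" using inE[OF \<omega>] x by blast
    qed
    ultimately have Ks: "?K \<in> sets ?G" by simp
    have "relative_volume l (spherical_spectrahedron l n (\<lambda>k. Q k \<omega>)) = measure ?G ?K"
    proof -
      have "spherical_spectrahedron l n (\<lambda>k. Q k \<omega>) = unit_sphere l \<inter> ?K"
        using Qs \<omega> by (intro spherical_spectrahedron_cone) auto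
      moreover have "relative_volume l (unit_sphere l \<inter> ?K) = measure ?G ?K"
        by (rule relative_volume_cone) (use Ks in \<open>auto intro: spectrahedral_cone_scale\<close>)
      ultimately show ?thesis by simp
    qed
    also have "\<dots> = measure ?G (?K \<inter> space ?G)" using sets.sets_into_space[OF Ks] by (simp add: Int_absorb2)
    also have "\<dots> = (\<integral>x. indicator ?K x \<partial>?G)" by (rule Bochner_Integration.integral_indicator[symmetric])
    also have "\<dots> = (\<integral>x. indicator E (\<omega>, x) \<partial>?G)"
      using inE[OF \<omega>] by (intro Bochner_Integration.integral_cong refl) (simp add: indicator_def)
    finally show "relative_volume l (spherical_spectrahedron l n (\<lambda>k. Q k \<omega>)) = (\<integral>x. indicator E (\<omega>, x) \<partial>?G)" .
  qed
  also have "\<dots> = (\<integral>x. \<integral>\<omega>. indicator E (\<omega>, x) \<partial>M \<partial>?G)"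
    by (rule MG.Fubini_integral[OF intE, symmetric])
  also have "\<dots> = (\<integral>x. measure ?GU {\<xi> \<in> space ?GU. ?c * sqrt (sqnorm {1..l} x) * ?T \<xi> \<le> x 0} \<partial>?G)"
  proof (rule Bochner_Integration.integral_cong[OF refl])
    fix x assume x: "x \<in> space ?G"
    define S where "S = {B \<in> space (PiM ?U (\<lambda>_. borel)). \<forall>w\<in>D. 0 \<le> x 0 * dot n w w + ?c * pform n B w}"
    have pm: "(\<lambda>B. x 0 * dot n w w + ?c * pform n B w) \<in> borel_measurable (PiM ?U (\<lambda>_. borel))" for w
      unfolding pform_def
      by (intro borel_measurable_add borel_measurable_times borel_measurable_const borel_measurable_sum measurable_component_singleton)
    have S: "S \<in> sets (PiM ?U (\<lambda>_. borel))" unfolding S_def using D(1) pm by measurable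
    have "(\<integral>\<omega>. indicator E (\<omega>, x) \<partial>M) = (\<integral>\<omega>. indicator {\<omega> \<in> space M. (\<lambda>p\<in>?U. \<Sum>k=1..l. x k * (Q k \<omega> $$ p)) \<in> S} \<omega> \<partial>M)"
      using x by (intro Bochner_Integration.integral_cong refl) (simp add: indicator_def E_def S_def space_pair_measure cone_form_def space_PiM)
    also have "\<dots> = measure M ({\<omega> \<in> space M. (\<lambda>p\<in>?U. \<Sum>k=1..l. x k * (Q k \<omega> $$ p)) \<in> S} \<inter> space M)"
      by (rule Bochner_Integration.integral_indicator)
    also have "{\<omega> \<in> space M. (\<lambda>p\<in>?U. \<Sum>k=1..l. x k * (Q k \<omega> $$ p)) \<in> S} \<inter> space M = {\<omega> \<in> space M. (\<lambda>p\<in>?U. \<Sum>k=1..l. x k * (Q k \<omega> $$ p)) \<in> S}" by auto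
    also have "measure M \<dots> = measure ?GU {\<xi> \<in> space ?GU. (\<lambda>p\<in>?U. sqrt (sqnorm {1..l} x) * (entry_sd p * \<xi> p)) \<in> S}"
      by (rule independent_GOE_linear_combination[OF l ind S])
    also have "{\<xi> \<in> space ?GU. (\<lambda>p\<in>?U. sqrt (sqnorm {1..l} x) * (entry_sd p * \<xi> p)) \<in> S} = {\<xi> \<in> space ?GU. ?c * sqrt (sqnorm {1..l} x) * ?T \<xi> \<le> x 0}"
    proof (rule Collect_cong, rule conj_cong[OF refl])
      fix \<xi> :: "nat \<times> nat \<Rightarrow> real"
      let ?s = "sqrt (sqnorm {1..l} x)"
      have "(\<lambda>p\<in>?U. ?s * (entry_sd p * \<xi> p)) \<in> S \<longleftrightarrow> (\<forall>w\<in>D. 0 \<le> x 0 * dot n w w + ?c * pform n (\<lambda>p. ?s * (entry_sd p * \<xi> p)) w)"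
        by (simp add: S_def space_PiM)
      also have "\<dots> \<longleftrightarrow> (\<forall>w. 0 \<le> x 0 * dot n w w + ?c * pform n (\<lambda>p. ?s * (entry_sd p * \<xi> p)) w)"
        by (rule form_nonneg_dense[OF clD, symmetric])
      also have "\<dots> \<longleftrightarrow> (\<forall>w. 0 \<le> x 0 * dot n w w + (?c * ?s) * pform n (\<lambda>p. entry_sd p * \<xi> p) w)"
        by (simp only: pform_scale mult.assoc)
      also have "\<dots> \<longleftrightarrow> ?c * ?s * ?T \<xi> \<le> x 0"
        by (rule form_nonneg_iff_neg_min[OF n]) simp
      finally show "(\<lambda>p\<in>?U. ?s * (entry_sd p * \<xi> p)) \<in> S \<longleftrightarrow> ?c * ?s * ?T \<xi> \<le> x 0" .
    qed
    finally show "(\<integral>\<omega>. indicator E (\<omega>, x) \<partial>M) = measure ?GU {\<xi> \<in> space ?GU. ?c * sqrt (sqnorm {1..l} x) * ?T \<xi> \<le> x 0}" .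
  qed
  also have "\<dots> = (\<integral>x. \<integral>\<xi>. (if sqrt (sqnorm {1..l} x) * (?c * ?T \<xi>) \<le> x 0 then 1 else 0) \<partial>?GU \<partial>?G)"
  proof (rule Bochner_Integration.integral_cong[OF refl])
    fix x
    let ?F = "{\<xi> \<in> space ?GU. ?c * sqrt (sqnorm {1..l} x) * ?T \<xi> \<le> x 0}"
    have "measure ?GU ?F = measure ?GU (?F \<inter> space ?GU)" by (rule arg_cong[of _ _ "measure ?GU"]) auto
    also have "\<dots> = (\<integral>\<xi>. indicator ?F \<xi> \<partial>?GU)" by (rule Bochner_Integration.integral_indicator[symmetric])
    also have "\<dots> = (\<integral>\<xi>. (if sqrt (sqnorm {1..l} x) * (?c * ?T \<xi>) \<le> x 0 then 1 else 0) \<partial>?GU)"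
      by (intro Bochner_Integration.integral_cong refl) (simp add: indicator_def mult_ac)
    finally show "measure ?GU ?F = (\<integral>\<xi>. (if sqrt (sqnorm {1..l} x) * (?c * ?T \<xi>) \<le> x 0 then 1 else 0) \<partial>?GU)" .
  qed
  also have "\<dots> = (\<integral>\<xi>. \<integral>x. (if sqrt (sqnorm {1..l} x) * (?c * ?T \<xi>) \<le> x 0 then 1 else 0) \<partial>?G \<partial>?GU)"
  proof (rule UG.Fubini_integral)
    have Tm: "?T \<in> borel_measurable ?GU" using neg_min_form_measurable[OF n] by simp
    have sm: "sqnorm {1..l} \<in> borel_measurable ?G" by (rule sqnorm_measurable_gauss) auto
    have xm: "(\<lambda>x. x 0) \<in> borel_measurable ?G" unfolding gauss_def by measurable
    have "{z \<in> space (?GU \<Otimes>\<^sub>M ?G). sqrt (sqnorm {1..l} (snd z)) * (?c * ?T (fst z)) \<le> (snd z) 0} \<in> sets (?GU \<Otimes>\<^sub>M ?G)"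
      using Tm sm xm by measurable
    then have "(\<lambda>z. if sqrt (sqnorm {1..l} (snd z)) * (?c * ?T (fst z)) \<le> (snd z) 0 then 1 else 0 :: real) \<in> borel_measurable (?GU \<Otimes>\<^sub>M ?G)"
      by (intro measurable_If) (auto simp: pred_def)
    then show "integrable (?GU \<Otimes>\<^sub>M ?G) (\<lambda>(\<xi>, x). if sqrt (sqnorm {1..l} x) * (?c * ?T \<xi>) \<le> x 0 then 1 else 0 :: real)"
      by (intro UG.integrable_const_bound[of _ 1]) (auto simp: split_beta')
  qed
  also have "\<dots> = (\<integral>\<xi>. student_t_cdf l (- ?T \<xi> / sqrt (2 * real n)) \<partial>?GU)"
  proof (rule Bochner_Integration.integral_cong[OF refl])
    fix \<xi>
    let ?t = "?c * ?T \<xi>"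
    let ?F = "{x \<in> space ?G. sqrt (sqnorm {1..l} x) * ?t \<le> x 0}"
    have "(\<integral>x. (if sqrt (sqnorm {1..l} x) * ?t \<le> x 0 then 1 else 0) \<partial>?G) = (\<integral>x. indicator ?F x \<partial>?G)"
      by (intro Bochner_Integration.integral_cong refl) (simp add: indicator_def)
    also have "\<dots> = measure ?G (?F \<inter> space ?G)" by (rule Bochner_Integration.integral_indicator)
    also have "?F \<inter> space ?G = ?F" by auto
    also have "measure ?G ?F = (\<integral>y. std_normal_cdf (- (sqrt (sqnorm {1..l} y) * ?t)) \<partial>gauss {1..l})"
      by (rule gauss_halfspace_cone)
    also have "\<dots> = (\<integral>y. std_normal_cdf ((- ?T \<xi> / sqrt (2 * real n)) * (sqrt (sqnorm {1..l} y) / sqrt (card {1..l}))) \<partial>gauss {1..l})"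
      by (intro Bochner_Integration.integral_cong refl arg_cong[of _ _ std_normal_cdf]) (simp add: real_sqrt_mult)
    also have "\<dots> = student_t_cdf (card {1..l}) (- ?T \<xi> / sqrt (2 * real n))"
      by (rule student_t_cdf_mixture[symmetric]) (use l in auto)
    finally show "(\<integral>x. (if sqrt (sqnorm {1..l} x) * ?t \<le> x 0 then 1 else 0) \<partial>?G) = student_t_cdf l (- ?T \<xi> / sqrt (2 * real n))"
      by simp
  qed
  finally show ?thesis .
qed

lemma student_t_cdf_measurable:
  assumes "1 \<le> l" shows "student_t_cdf l \<in> borel_measurable borel"
proof (rule borel_measurable_mono, rule monoI)
  fix s t :: real assume st: "s \<le> t"
  have J: "finite {1..l}" "{1..l} \<noteq> {}" using assms by auto
  have int: "integrable (gauss {1..l}) (\<lambda>x. std_normal_cdf (s * (sqrt (sqnorm {1..l} x) / sqrt (card {1..l}))))" for s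
    by (rule integrable_std_normal_cdf[OF prob_space_gauss]) measurable
  have "student_t_cdf (card {1..l}) s \<le> student_t_cdf (card {1..l}) t"
    unfolding student_t_cdf_mixture[OF J] using int st
    by (intro integral_mono) (auto intro!: std_normal_cdf_mono mult_right_mono divide_right_mono)
  then show "student_t_cdf l s \<le> student_t_cdf l t" by simp
qed

text \<open>The right-hand side is a function on the coordinates of the Gaussian vector; measurability of
  the smallest eigenvalue is inherited from the supremum over a countable set.\<close>

lemma GOE_expectation_min_eigenvalue:
  assumes n: "1 \<le> n" and f: "f \<in> borel_measurable borel"
  shows "(\<integral>A. f (scaled_min_eigenvalue n A) \<partial>GOE n) = (\<integral>\<xi>. f (- neg_min_form n \<xi> / sqrt (2 * real n)) \<partial>gauss (upper_pairs n) :: real)"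
proof -
  let ?U = "upper_pairs n"
  define h where "h = (\<lambda>A :: real Matrix.mat. f (- neg_min_form n (\<lambda>p\<in>?U. A $$ p / entry_sd p) / sqrt (2 * real n)))"
  have eq: "f (scaled_min_eigenvalue n A) = h A" if A: "A \<in> sym_mats n" for A
  proof -
    have "min_eigenvalue A = - neg_min_form n (\<lambda>p\<in>?U. A $$ p / entry_sd p)"
      by (rule min_eigenvalue_neg_min_form[OF A n]) (use entry_sd_pos in \<open>simp add: less_imp_neq[symmetric]\<close>)
    then show ?thesis by (simp add: h_def scaled_min_eigenvalue_def)
  qed
  have "(\<lambda>A. \<lambda>p\<in>?U. A $$ p / entry_sd p) \<in> sym_borel n \<rightarrow>\<^sub>M PiM ?U (\<lambda>_. borel)"
    by (rule measurable_restrict, intro borel_measurable_divide borel_measurable_const entry_measurable_upper)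
  from measurable_compose[OF this neg_min_form_measurable[OF n]]
  have "(\<lambda>A. neg_min_form n (\<lambda>p\<in>?U. A $$ p / entry_sd p)) \<in> borel_measurable (sym_borel n)" .
  then have h: "h \<in> borel_measurable (sym_borel n)"
    unfolding h_def by (intro measurable_compose[OF _ f] borel_measurable_divide borel_measurable_uminus borel_measurable_const)
  have "(\<integral>A. f (scaled_min_eigenvalue n A) \<partial>GOE n) = (\<integral>A. h A \<partial>GOE n)"
    by (rule Bochner_Integration.integral_cong[OF refl], rule eq) (simp add: GOE_eq)
  also have "\<dots> = (\<integral>\<xi>. h (sym_of n (\<lambda>p. entry_sd p * \<xi> p)) \<partial>gauss ?U)"
    unfolding GOE_eq by (rule integral_distr[OF goe_map_measurable h])
  also have "\<dots> = (\<integral>\<xi>. f (- neg_min_form n \<xi> / sqrt (2 * real n)) \<partial>gauss ?U)"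
  proof (rule Bochner_Integration.integral_cong[OF refl])
    fix \<xi> :: "nat \<times> nat \<Rightarrow> real"
    assume "\<xi> \<in> space (gauss ?U)"
    then have "(\<lambda>p\<in>?U. sym_of n (\<lambda>p. entry_sd p * \<xi> p) $$ p / entry_sd p) = \<xi>"
      using entry_sd_pos by (auto simp: fun_eq_iff sym_of_entry PiE_def extensional_def less_imp_neq[symmetric])
    then show "h (sym_of n (\<lambda>p. entry_sd p * \<xi> p)) = f (- neg_min_form n \<xi> / sqrt (2 * real n))"
      by (simp add: h_def)
  qed
  finally show ?thesis .
qed

text \<open>Upper and lower bound together, with \<open>r = R / sqrt (2 * n)\<close>; the errors of order \<open>r\<^sup>2\<close> become
  \<open>R\<^sup>2 / n\<close>.\<close>

lemma neg_min_form_cdf_estimate: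
  assumes n: "8 \<le> n" and R: "0 \<le> R"
  shows "\<bar>(\<integral>\<xi>. std_normal_cdf (R * (- neg_min_form n \<xi> / sqrt (2 * real n))) \<partial>gauss (upper_pairs n)) - std_normal_cdf (- R)\<bar>
    \<le> 9 * R * real n powr (- 2 / 3) + 5 * R\<^sup>2 / real n"
proof -
  let ?U = "upper_pairs n" and ?T = "neg_min_form n" and ?d = "real n powr (- 2 / 3)"
  define r where "r = R / sqrt (2 * real n)"
  have n1: "1 \<le> n" using n by simp
  have r: "0 \<le> r" using R by (simp add: r_def)
  have rR: "r * sqrt (2 * real n) = R" using n by (simp add: r_def)
  have r2: "r\<^sup>2 = R\<^sup>2 / (2 * real n)" by (simp add: r_def power_divide)
  interpret prob_space "gauss ?U" by (rule prob_space_gauss)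
  have int: "integrable (gauss ?U) (\<lambda>\<xi>. std_normal_cdf (r * ?T \<xi>))"
    using neg_min_form_measurable[OF n1] by (intro integrable_std_normal_cdf prob_space_gauss) simp
  have "(\<integral>\<xi>. std_normal_cdf (R * (- ?T \<xi> / sqrt (2 * real n))) \<partial>gauss ?U) = (\<integral>\<xi>. 1 - std_normal_cdf (r * ?T \<xi>) \<partial>gauss ?U)"
    unfolding std_normal_cdf_uminus[symmetric] by (simp add: r_def)
  also have "\<dots> = 1 - (\<integral>\<xi>. std_normal_cdf (r * ?T \<xi>) \<partial>gauss ?U)" using int prob_space by simp
  finally have eq: "(\<integral>\<xi>. std_normal_cdf (R * (- ?T \<xi> / sqrt (2 * real n))) \<partial>gauss ?U) - std_normal_cdf (- R)
     = std_normal_cdf R - (\<integral>\<xi>. std_normal_cdf (r * ?T \<xi>) \<partial>gauss ?U)" by (simp add: std_normal_cdf_uminus)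
  have up: "(\<integral>\<xi>. std_normal_cdf (r * ?T \<xi>) \<partial>gauss ?U) \<le> std_normal_cdf R + 5 * r\<^sup>2"
    using neg_min_form_upper[OF n1 r] unfolding rR .
  have lo: "std_normal_cdf (R * (1 - 9 * ?d)) - 10 * r\<^sup>2 \<le> (\<integral>\<xi>. std_normal_cdf (r * ?T \<xi>) \<partial>gauss ?U)"
    using neg_min_form_lower[OF r n] unfolding rR .
  have "R * (1 - 9 * ?d) \<le> R" using R by (simp add: algebra_simps)
  from std_normal_cdf_lipschitz[OF this] have "std_normal_cdf R - std_normal_cdf (R * (1 - 9 * ?d)) \<le> 9 * R * ?d"
    by (simp add: algebra_simps)
  moreover have "10 * r\<^sup>2 = 5 * R\<^sup>2 / real n" "5 * r\<^sup>2 \<le> 5 * R\<^sup>2 / real n" using n by (simp_all add: r2 field_simps)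
  moreover have "0 \<le> 9 * R * ?d" using R by simp
  ultimately show ?thesis unfolding eq abs_le_iff using up lo by linarith
qed

text \<open>The ratio \<open>\<rho>\<close> has mean \<open>1 + O(1 / l)\<close> and mean square deviation \<open>O(1 / l)\<close> from 1.\<close>

lemma gauss_norm_ratio_estimate:
  assumes J: "finite J" "J \<noteq> {}"
  defines "l \<equiv> card J"
  defines "\<rho> \<equiv> \<lambda>x. sqrt (sqnorm J x) / sqrt (real l)"
  shows "\<bar>(\<integral>x. std_normal_cdf (- \<rho> x) \<partial>gauss J) - std_normal_cdf (- 1)\<bar> \<le> 3 / real l"
    and "integrable (gauss J) \<rho>" "(\<integral>x. \<rho> x \<partial>gauss J) \<le> 1"
    and "integrable (gauss J) (\<lambda>x. (\<rho> x)\<^sup>2)" "(\<integral>x. (\<rho> x)\<^sup>2 \<partial>gauss J) = 1"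
proof -
  let ?G = "gauss J"
  interpret prob_space ?G by (rule prob_space_gauss)
  have l: "1 \<le> real l" using J by (simp add: l_def Suc_le_eq card_gt_0_iff)
  note nm = gauss_norm_mean[OF J(1) order_refl J(2), folded l_def] and nv = gauss_norm_variance[OF J(1) order_refl J(2), folded l_def] and sq = sqnorm_gauss[OF J(1) order_refl, folded l_def]
  show i1: "integrable ?G \<rho>" unfolding \<rho>_def using nm(1) by auto
  have E1: "(\<integral>x. \<rho> x \<partial>?G) = (\<integral>x. sqrt (sqnorm J x) \<partial>?G) / sqrt (real l)" unfolding \<rho>_def by simp
  show e1: "(\<integral>x. \<rho> x \<partial>?G) \<le> 1" unfolding E1 using nm(3) l by (simp add: divide_le_eq)
  have e2: "1 - 1 / real l \<le> (\<integral>x. \<rho> x \<partial>?G)" unfolding E1 using nm(2) l by (simp add: le_divide_eq mult.commute)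
  have p2: "(\<rho> x)\<^sup>2 = sqnorm J x / real l" for x by (simp add: \<rho>_def power_divide)
  show "integrable ?G (\<lambda>x. (\<rho> x)\<^sup>2)" unfolding p2 using sq(1) by auto
  show "(\<integral>x. (\<rho> x)\<^sup>2 \<partial>?G) = 1" unfolding p2 using sq(2) l by simp
  have v: "(\<rho> x - 1)\<^sup>2 = (sqrt (sqnorm J x) - sqrt (real l))\<^sup>2 / real l" for x
  proof -
    have "\<rho> x - 1 = (sqrt (sqnorm J x) - sqrt (real l)) / sqrt (real l)" using l by (simp add: \<rho>_def field_simps)
    then show ?thesis using l by (simp add: power_divide)
  qed
  have i2: "integrable ?G (\<lambda>x. (\<rho> x - 1)\<^sup>2)" unfolding v using nv(1) by auto
  have "(\<integral>x. (\<rho> x - 1)\<^sup>2 \<partial>?G) = (\<integral>x. (sqrt (sqnorm J x) - sqrt (real l))\<^sup>2 \<partial>?G) / real l" unfolding v by simp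
  also have "\<dots> \<le> 2 / real l" using nv(2) l by (intro divide_right_mono) auto
  finally have e3: "(\<integral>x. (\<rho> x - 1)\<^sup>2 \<partial>?G) \<le> 2 / real l" .
  let ?\<phi> = "std_normal_density (-1)"
  have i0: "integrable ?G (\<lambda>x. std_normal_cdf (- \<rho> x))"
    by (rule integrable_std_normal_cdf[OF prob_space_gauss]) (use i1 in auto)
  have t: "\<bar>std_normal_cdf (- \<rho> x) - std_normal_cdf (- 1) + ?\<phi> * (\<rho> x - 1)\<bar> \<le> (\<rho> x - 1)\<^sup>2" for x
  proof -
    have "std_normal_cdf (- \<rho> x) - std_normal_cdf (- 1) - ?\<phi> * (- \<rho> x - - 1)
       = std_normal_cdf (- \<rho> x) - std_normal_cdf (- 1) + ?\<phi> * (\<rho> x - 1)" by (simp add: algebra_simps)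
    moreover have "(- \<rho> x - - 1)\<^sup>2 = (\<rho> x - 1)\<^sup>2" by (simp add: power2_eq_square algebra_simps)
    ultimately show ?thesis using std_normal_cdf_taylor[of "- \<rho> x" "- 1"] by simp
  qed
  have "(\<integral>x. std_normal_cdf (- \<rho> x) \<partial>?G) - std_normal_cdf (- 1) + ?\<phi> * ((\<integral>x. \<rho> x \<partial>?G) - 1)
     = (\<integral>x. std_normal_cdf (- \<rho> x) - std_normal_cdf (- 1) + ?\<phi> * (\<rho> x - 1) \<partial>?G)"
    using i0 i1 prob_space by simp
  then have "\<bar>(\<integral>x. std_normal_cdf (- \<rho> x) \<partial>?G) - std_normal_cdf (- 1) + ?\<phi> * ((\<integral>x. \<rho> x \<partial>?G) - 1)\<bar>
     \<le> (\<integral>x. \<bar>std_normal_cdf (- \<rho> x) - std_normal_cdf (- 1) + ?\<phi> * (\<rho> x - 1)\<bar> \<partial>?G)"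
    using integral_abs_bound by simp
  also have "\<dots> \<le> (\<integral>x. (\<rho> x - 1)\<^sup>2 \<partial>?G)"
    using i0 i1 i2 t by (intro integral_mono) auto
  finally have "\<bar>(\<integral>x. std_normal_cdf (- \<rho> x) \<partial>?G) - std_normal_cdf (- 1) + ?\<phi> * ((\<integral>x. \<rho> x \<partial>?G) - 1)\<bar> \<le> 2 / real l"
    using e3 by linarith
  moreover have "\<bar>?\<phi> * ((\<integral>x. \<rho> x \<partial>?G) - 1)\<bar> \<le> 1 * (1 / real l)"
    unfolding abs_mult using e1 e2 std_normal_density_le1[of "-1"] by (intro mult_mono) auto
  ultimately show "\<bar>(\<integral>x. std_normal_cdf (- \<rho> x) \<partial>?G) - std_normal_cdf (- 1)\<bar> \<le> 3 / real l" by simp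
qed

text \<open>The estimate at a fixed ratio is integrated over the ratio \<open>\<rho>\<close>, whose mean is at most 1 and whose mean
  square is 1, so that the errors stay uniform in \<open>l\<close>. Since \<open>1 / n \<le> n powr (- 2 / 3)\<close>, the
  contributions are \<open>9 + 5\<close> times \<open>n powr (- 2 / 3)\<close> and \<open>3 / l\<close>.\<close>

theorem expected_relative_volume_asymptotics:
  assumes l: "1 \<le> l" and n: "8 \<le> n" and ind: "independent_GOE M l n Q"
  shows "\<bar>expected_relative_volume M l n Q - std_normal_cdf (- 1)\<bar> \<le> 14 * (1 / real l + real n powr (- 2 / 3))"
proof -
  let ?U = "upper_pairs n" and ?J = "{1..l}" and ?T = "neg_min_form n" and ?d = "real n powr (- 2 / 3)"
  have n1: "1 \<le> n" using n by simp
  have J: "finite ?J" "?J \<noteq> {}" "card ?J = l" using l by auto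
  interpret U: prob_space "gauss ?U" by (rule prob_space_gauss)
  interpret J: prob_space "gauss ?J" by (rule prob_space_gauss)
  interpret UJ: pair_prob_space "gauss ?U" "gauss ?J" ..
  define \<rho> where "\<rho> = (\<lambda>x. sqrt (sqnorm ?J x) / sqrt (real l))"
  have chi: "\<bar>(\<integral>x. std_normal_cdf (- \<rho> x) \<partial>gauss ?J) - std_normal_cdf (- 1)\<bar> \<le> 3 / real l"
    "integrable (gauss ?J) \<rho>" "(\<integral>x. \<rho> x \<partial>gauss ?J) \<le> 1"
    "integrable (gauss ?J) (\<lambda>x. (\<rho> x)\<^sup>2)" "(\<integral>x. (\<rho> x)\<^sup>2 \<partial>gauss ?J) = 1"
    unfolding \<rho>_def by (rule gauss_norm_ratio_estimate[OF J(1,2), unfolded J(3)])+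
  have \<rho>0: "0 \<le> \<rho> x" for x by (simp add: \<rho>_def)
  define g where "g = (\<lambda>\<xi> x. std_normal_cdf (\<rho> x * (- ?T \<xi> / sqrt (2 * real n))))"
  have Tm: "?T \<in> borel_measurable (gauss ?U)" using neg_min_form_measurable[OF n1] by simp
  have \<rho>m: "\<rho> \<in> borel_measurable (gauss ?J)" using chi(2) by simp
  have gm: "(\<lambda>(\<xi>, x). g \<xi> x) \<in> borel_measurable (gauss ?U \<Otimes>\<^sub>M gauss ?J)"
    unfolding g_def split_beta' using Tm \<rho>m by measurable
  have gi: "integrable (gauss ?U \<Otimes>\<^sub>M gauss ?J) (\<lambda>(\<xi>, x). g \<xi> x)"
    by (rule UJ.integrable_const_bound[of _ 1]) (use gm in \<open>auto simp: g_def\<close>)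
  have "expected_relative_volume M l n Q = (\<integral>\<xi>. \<integral>x. g \<xi> x \<partial>gauss ?J \<partial>gauss ?U)"
    unfolding expected_relative_volume_mixture[OF l n1 ind]
    using student_t_cdf_mixture[OF J(1,2), unfolded J(3)] by (simp add: g_def \<rho>_def mult.commute)
  also have "\<dots> = (\<integral>x. \<integral>\<xi>. g \<xi> x \<partial>gauss ?U \<partial>gauss ?J)"
    by (rule UJ.Fubini_integral[OF gi, symmetric])
  finally have eq: "expected_relative_volume M l n Q = (\<integral>x. \<integral>\<xi>. g \<xi> x \<partial>gauss ?U \<partial>gauss ?J)" .
  have hi: "integrable (gauss ?J) (\<lambda>x. \<integral>\<xi>. g \<xi> x \<partial>gauss ?U)"
    by (rule UJ.integrable_snd[OF gi])
  have pi: "integrable (gauss ?J) (\<lambda>x. std_normal_cdf (- \<rho> x))"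
    by (rule integrable_std_normal_cdf[OF prob_space_gauss]) (use \<rho>m in auto)
  have bi: "integrable (gauss ?J) (\<lambda>x. 9 * \<rho> x * ?d + 5 * (\<rho> x)\<^sup>2 / real n)"
    using chi(2,4) by auto
  have "\<bar>expected_relative_volume M l n Q - (\<integral>x. std_normal_cdf (- \<rho> x) \<partial>gauss ?J)\<bar>
     = \<bar>\<integral>x. (\<integral>\<xi>. g \<xi> x \<partial>gauss ?U) - std_normal_cdf (- \<rho> x) \<partial>gauss ?J\<bar>"
    unfolding eq using hi pi by simp
  also have "\<dots> \<le> (\<integral>x. \<bar>(\<integral>\<xi>. g \<xi> x \<partial>gauss ?U) - std_normal_cdf (- \<rho> x)\<bar> \<partial>gauss ?J)"
    by (rule integral_abs_bound)
  also have "\<dots> \<le> (\<integral>x. 9 * \<rho> x * ?d + 5 * (\<rho> x)\<^sup>2 / real n \<partial>gauss ?J)"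
  proof (rule integral_mono[OF _ bi])
    show "integrable (gauss ?J) (\<lambda>x. \<bar>(\<integral>\<xi>. g \<xi> x \<partial>gauss ?U) - std_normal_cdf (- \<rho> x)\<bar>)" using hi pi by auto
    show "\<bar>(\<integral>\<xi>. g \<xi> x \<partial>gauss ?U) - std_normal_cdf (- \<rho> x)\<bar> \<le> 9 * \<rho> x * ?d + 5 * (\<rho> x)\<^sup>2 / real n" for x
      unfolding g_def by (rule neg_min_form_cdf_estimate[OF n \<rho>0])
  qed
  also have "\<dots> = 9 * (\<integral>x. \<rho> x \<partial>gauss ?J) * ?d + 5 * (\<integral>x. (\<rho> x)\<^sup>2 \<partial>gauss ?J) / real n"
    using chi(2,4) by simp
  also have "\<dots> \<le> 9 * 1 * ?d + 5 / real n"
    using chi(3,5) by (intro add_mono mult_right_mono) auto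
  finally have 1: "\<bar>expected_relative_volume M l n Q - (\<integral>x. std_normal_cdf (- \<rho> x) \<partial>gauss ?J)\<bar> \<le> 9 * ?d + 5 / real n" by simp
  have "1 / real n = real n powr (- 1)" using n by (simp add: powr_minus_divide)
  also have "\<dots> \<le> ?d" using n by (intro powr_mono) auto
  finally have "9 * ?d + 5 / real n \<le> 14 * ?d" by simp
  then have "\<bar>expected_relative_volume M l n Q - std_normal_cdf (- 1)\<bar> \<le> 14 * ?d + 3 / real l"
    using 1 chi(1) by linarith
  also have "\<dots> \<le> 14 * (1 / real l + ?d)" using l by (simp add: field_simps)
  finally show ?thesis .
qed

theorem theorem1p1:
  shows "(\<forall>l n (M :: 'a measure) (Q :: nat \<Rightarrow> 'a \<Rightarrow> real Matrix.mat).
            1 \<le> l \<and> 1 \<le> n \<and> independent_GOE M l n Q \<longrightarrow>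
              expected_relative_volume M l n Q =
                (\<integral>A. student_t_cdf l (scaled_min_eigenvalue n A) \<partial>(GOE n)))
       \<and> (\<exists>C > 0. \<exists>m0 :: nat. \<forall>l n (M :: 'a measure) (Q :: nat \<Rightarrow> 'a \<Rightarrow> real Matrix.mat).
            1 \<le> l \<and> 1 \<le> n \<and> m0 \<le> l \<and> m0 \<le> n \<and> independent_GOE M l n Q \<longrightarrow>
              \<bar>expected_relative_volume M l n Q - std_normal_cdf (- 1)\<bar>
                \<le> C * (1 / real l + real n powr (- 2 / 3)))"
proof (intro conjI allI impI)
  fix l n and M :: "'a measure" and Q :: "nat \<Rightarrow> 'a \<Rightarrow> real Matrix.mat"
  assume "1 \<le> l \<and> 1 \<le> n \<and> independent_GOE M l n Q"
  then have l: "1 \<le> l" and n: "1 \<le> n" and ind: "independent_GOE M l n Q" by auto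
  show "expected_relative_volume M l n Q = (\<integral>A. student_t_cdf l (scaled_min_eigenvalue n A) \<partial>(GOE n))"
    unfolding expected_relative_volume_mixture[OF l n ind] GOE_expectation_min_eigenvalue[OF n student_t_cdf_measurable[OF l]] ..
next
  show "\<exists>C > 0. \<exists>m0 :: nat. \<forall>l n (M :: 'a measure) (Q :: nat \<Rightarrow> 'a \<Rightarrow> real Matrix.mat).
            1 \<le> l \<and> 1 \<le> n \<and> m0 \<le> l \<and> m0 \<le> n \<and> independent_GOE M l n Q \<longrightarrow>
              \<bar>expected_relative_volume M l n Q - std_normal_cdf (- 1)\<bar>
                \<le> C * (1 / real l + real n powr (- 2 / 3))"
    by (rule exI[of _ 14], rule conjI, simp, rule exI[of _ 8]) (use expected_relative_volume_asymptotics in blast)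
qed

end
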